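(* Let $\Gamma$ be a discrete group, $X$ a $\Gamma$-space, and $\mathcal B$ a unital $\Gamma$-$C^*$-algebra. Consider $C(X)\otimes_{\min}\mathcal B$ with the diagonal $\Gamma$-action. Let $N=\ker(\Gamma\curvearrowright\mathcal B)$. Assume that $N$ is $X$-plump and that $N\curvearrowright X$ is minimal. Then for every intermediate $C^*$-algebra $\mathcal A$ with $$C(X)\rtimes_r\Gamma\subseteq\mathcal A\subseteq (C(X)\otimes_{\min}\mathcal B)\rtimes_r\Gamma$$ we have $\mathbb E(\mathcal A)\subseteq\mathcal A$. If, in addition, $\Gamma$ has the approximation property (AP), then $\mathcal A$ is a crossed product of the form $(C(X)\otimes_{\min}\tilde{\mathcal B})\rtimes_r\Gamma$, where $\tilde{\mathcal B}$ is a $\Gamma$-invariant $C^*$-subalgebra of $\mathcal B$.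
   Context: A $\Gamma$-space is a nonempty compact Hausdorff space with an action of the discrete group $\Gamma$ by homeomorphisms; an action is minimal if every orbit is dense. A $\Gamma$-$C^*$-algebra is a $C^*$-algebra with an action of $\Gamma$ by $*$-automorphisms; $\ker(\Gamma\curvearrowright\mathcal B)$ is the set of elements acting trivially on $\mathcal B$. $\rtimes_r$ denotes the reduced crossed product, $\lambda(s)$ the canonical unitaries, and $\mathbb E:(C(X)\otimes_{\min}\mathcal B)\rtimes_r\Gamma\to C(X)\otimes_{\min}\mathcal B$ the canonical conditional expectation ($c\lambda(s)\mapsto c$ if $s=e$ and $0$ otherwise). $C(X)\rtimes_r\Gamma$ is included via $f\mapsto f\otimes 1$. A subgroup $H\le\Gamma$ is $X$-plump if for every $\varepsilon>0$ and $a\in C(X)\rtimes_r\Gamma$ there are $s_1,\dots,s_m\in H$ and nonnegative $g_1,\dots,g_m\in C(X)$ with $\sum_j g_j^2=1$ such that $\|\sum_{j}g_j\lambda(s_j)a\lambda(s_j)^*g_j-\mathbb E(a)\|<\varepsilon$ (here $\mathbb E$ is the canonical expectation onto $C(X)$). AP is the approximation property of Haagerup and Kraus. *)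

theory Defs
  imports "HOL-Analysis.Analysis"
begin

section \<open>Complex normed spaces, C*-algebras and Hilbert spaces\<close>

class complex_normed_vector = real_normed_vector +
  fixes scaleC :: "complex \<Rightarrow> 'a \<Rightarrow> 'a" (infixr "*\<^sub>C" 75)
  assumes scaleC_add_right: "a *\<^sub>C (x + y) = a *\<^sub>C x + a *\<^sub>C y"
    and scaleC_add_left: "(a + b) *\<^sub>C x = a *\<^sub>C x + b *\<^sub>C x"
    and scaleC_scaleC: "a *\<^sub>C b *\<^sub>C x = (a * b) *\<^sub>C x"
    and scaleC_of_real: "complex_of_real r *\<^sub>C x = r *\<^sub>R x"
    and norm_scaleC: "norm (a *\<^sub>C x) = cmod a * norm x"

text \<open>A possibly non-unital C*-algebra. Unital ones are the types of sort
  \<open>{cstar_algebra, real_normed_algebra_1}\<close>; the second class only adds a unit of norm one,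
  so it excludes the zero algebra.\<close>

class cstar_algebra = complex_normed_vector + real_normed_algebra + complete_space +
  fixes star :: "'a \<Rightarrow> 'a"
  assumes scaleC_mult_left: "(a *\<^sub>C x) * y = a *\<^sub>C (x * y)"
    and scaleC_mult_right: "x * (a *\<^sub>C y) = a *\<^sub>C (x * y)"
    and star_add: "star (x + y) = star x + star y"
    and star_scaleC: "star (a *\<^sub>C x) = cnj a *\<^sub>C star x"
    and star_mult: "star (x * y) = star y * star x"
    and star_star: "star (star x) = x"
    and cstar_identity: "norm (star x * x) = (norm x)\<^sup>2"

text \<open>Inner products are linear in the first argument.\<close>

class complex_hilbert_space = complex_normed_vector + complete_space +
  fixes cinner :: "'a \<Rightarrow> 'a \<Rightarrow> complex"
  assumes cinner_add_left: "cinner (x + y) z = cinner x z + cinner y z"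
    and cinner_scaleC_left: "cinner (a *\<^sub>C x) y = a * cinner x y"
    and cinner_commute: "cinner x y = cnj (cinner y x)"
    and cinner_self: "cinner x x = complex_of_real ((norm x)\<^sup>2)"

subclass (in cstar_algebra) banach ..

subclass (in complex_hilbert_space) banach ..

instantiation complex :: complex_hilbert_space
begin

definition scaleC_complex :: "complex \<Rightarrow> complex \<Rightarrow> complex"
  where "scaleC_complex a x = a * x"

definition cinner_complex :: "complex \<Rightarrow> complex \<Rightarrow> complex"
  where "cinner_complex x y = x * cnj y"

instance
proof
  fix a b x y z :: complex and r :: real
  show "a *\<^sub>C (x + y) = a *\<^sub>C x + a *\<^sub>C y" "(a + b) *\<^sub>C x = a *\<^sub>C x + b *\<^sub>C x"
    "a *\<^sub>C b *\<^sub>C x = (a * b) *\<^sub>C x" "cinner (x + y) z = cinner x z + cinner y z"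
    "cinner (a *\<^sub>C x) y = a * cinner x y"
    by (simp_all add: scaleC_complex_def cinner_complex_def algebra_simps)
  show "complex_of_real r *\<^sub>C x = r *\<^sub>R x" "norm (a *\<^sub>C x) = cmod a * norm x"
    by (simp_all add: scaleC_complex_def scaleR_conv_of_real norm_mult)
  show "cinner x y = cnj (cinner y x)"
    by (simp add: cinner_complex_def)
  show "cinner x x = complex_of_real ((norm x)\<^sup>2)"
    by (simp only: cinner_complex_def complex_norm_square)
qed

end

global_interpretation complex_vector:
  vector_space "scaleC :: complex \<Rightarrow> 'a \<Rightarrow> 'a::complex_normed_vector"
  defines cspan = complex_vector.span
    and csubspace = complex_vector.subspace
  by standard
    (simp_all add: scaleC_add_right scaleC_add_left scaleC_scaleC
      scaleC_of_real[of 1, simplified])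

definition cstar_subalgebra :: "'a::cstar_algebra set \<Rightarrow> bool"
  where "cstar_subalgebra S \<longleftrightarrow> csubspace S \<and> closed S \<and>
    (\<forall>x\<in>S. \<forall>y\<in>S. x * y \<in> S) \<and> (\<forall>x\<in>S. star x \<in> S)"

definition star_hom :: "('a::cstar_algebra \<Rightarrow> 'b::cstar_algebra) \<Rightarrow> bool"
  where "star_hom \<pi> \<longleftrightarrow> (\<forall>x y. \<pi> (x + y) = \<pi> x + \<pi> y) \<and> (\<forall>a x. \<pi> (a *\<^sub>C x) = a *\<^sub>C \<pi> x) \<and>
    (\<forall>x y. \<pi> (x * y) = \<pi> x * \<pi> y) \<and> (\<forall>x. \<pi> (star x) = star (\<pi> x))"

lemma cinner_add_right: "cinner x (y + z) = cinner x y + cinner x z"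
  by (simp only: cinner_commute[of x] cinner_add_left complex_cnj_add)

lemma cinner_scaleC_right: "cinner x (a *\<^sub>C y) = cnj a * cinner x y"
  by (simp only: cinner_commute[of x] cinner_scaleC_left complex_cnj_mult)

lemma cinner_zero_left [simp]: "cinner 0 y = 0"
  using cinner_add_left[of 0 0 y] by simp

lemma cinner_zero_right [simp]: "cinner y 0 = 0"
  by (simp only: cinner_commute[of y 0] cinner_zero_left complex_cnj_zero)

lemma cinner_minus_left: "cinner (- x) y = - cinner x y"
proof -
  have "cinner x y + cinner (- x) y = 0"
    using cinner_add_left[of x "- x" y] by simp
  then show ?thesis
    by (simp add: eq_neg_iff_add_eq_0 add.commute)
qed

lemma cinner_minus_right: "cinner x (- y) = - cinner x y"
  by (simp only: cinner_commute[of x] cinner_minus_left complex_cnj_minus)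

lemma cinner_diff_left: "cinner (x - y) z = cinner x z - cinner y z"
  using cinner_add_left[of x "- y" z] by (simp add: cinner_minus_left)

lemma cinner_diff_right: "cinner x (y - z) = cinner x y - cinner x z"
  using cinner_add_right[of x y "- z"] by (simp add: cinner_minus_right)

lemma norm_add_square:
  "(norm (x + y))\<^sup>2 = (norm x)\<^sup>2 + 2 * Re (cinner x y) + (norm y)\<^sup>2"
proof -
  have "complex_of_real ((norm (x + y))\<^sup>2) = cinner x x + cinner x y + (cinner y x + cinner y y)"
    by (simp only: cinner_self[symmetric] cinner_add_left cinner_add_right add_ac)
  then have "(norm (x + y))\<^sup>2 = Re (cinner x x + cinner x y + (cinner y x + cinner y y))"
    by (metis Re_complex_of_real)
  also have "\<dots> = (norm x)\<^sup>2 + 2 * Re (cinner x y) + (norm y)\<^sup>2"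
    using cinner_commute[of y x] by (simp add: cinner_self del: of_real_power)
  finally show ?thesis .
qed

lemma norm_diff_square:
  "(norm (x - y))\<^sup>2 = (norm x)\<^sup>2 - 2 * Re (cinner x y) + (norm y)\<^sup>2"
  using norm_add_square[of x "- y"] by (simp add: cinner_minus_right)

lemma Re_cinner_le: "Re (cinner x y) \<le> norm x * norm y"
proof -
  have "(norm (x + y))\<^sup>2 \<le> (norm x + norm y)\<^sup>2"
    by (rule power_mono) (auto simp: norm_triangle_ineq)
  then show ?thesis
    unfolding norm_add_square by (simp add: power2_sum)
qed

lemma norm_cinner_le: "cmod (cinner x y) \<le> norm x * norm y"
proof (cases "cinner x y = 0")
  case False
  define c where "c = cnj (cinner x y) / cmod (cinner x y)"
  have c: "cmod c = 1"
    using False by (simp add: c_def norm_divide)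
  have "cinner (c *\<^sub>C x) y = complex_of_real (cmod (cinner x y))"
    using False by (simp add: cinner_scaleC_left c_def complex_norm_square[symmetric] power2_eq_square
        mult.commute)
  then have "cmod (cinner x y) = Re (cinner (c *\<^sub>C x) y)"
    by simp
  also have "\<dots> \<le> norm x * norm y"
    using Re_cinner_le[of "c *\<^sub>C x" y] by (simp add: norm_scaleC c)
  finally show ?thesis .
qed simp

section \<open>The Hilbert space of square-summable families\<close>

typedef (overloaded) ('i, 'h::complex_hilbert_space) ell2 =
  "{f :: 'i \<Rightarrow> 'h. (\<lambda>i. (norm (f i))\<^sup>2) summable_on UNIV}"
  morphisms ell2_apply Abs_ell2
  by (rule exI[of _ "\<lambda>_. 0"]) simp

setup_lifting type_definition_ell2

lemma ell2_iff_bounded: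
  fixes f :: "'i \<Rightarrow> 'h::real_normed_vector"
  assumes "\<And>F. finite F \<Longrightarrow> L2_set (\<lambda>i. norm (f i)) F \<le> C"
  shows "(\<lambda>i. (norm (f i))\<^sup>2) summable_on UNIV"
    and "sqrt (\<Sum>\<^sub>\<infinity>i. (norm (f i))\<^sup>2) \<le> C"
proof -
  have C: "0 \<le> C"
    using assms[of "{}"] by simp
  have le: "(\<Sum>i\<in>F. (norm (f i))\<^sup>2) \<le> C\<^sup>2" if "finite F" for F
    using assms[OF that] unfolding L2_set_def by (metis sqrt_le_D)
  show *: "(\<lambda>i. (norm (f i))\<^sup>2) summable_on UNIV"
    by (rule nonneg_bdd_above_summable_on) (auto intro!: bdd_aboveI2 le)
  show "sqrt (\<Sum>\<^sub>\<infinity>i. (norm (f i))\<^sup>2) \<le> C"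
    by (rule real_le_lsqrt) (use C in \<open>auto intro!: infsum_le_finite_sums * le infsum_nonneg\<close>)
qed

lemma L2_set_le_ell2:
  fixes f :: "'i \<Rightarrow> 'h::real_normed_vector"
  assumes "(\<lambda>i. (norm (f i))\<^sup>2) summable_on UNIV" "finite F"
  shows "L2_set (\<lambda>i. norm (f i)) F \<le> sqrt (\<Sum>\<^sub>\<infinity>i. (norm (f i))\<^sup>2)"
  unfolding L2_set_def by (rule real_sqrt_le_mono, rule finite_sum_le_infsum) (use assms in auto)

lemma L2_set_norm_add:
  fixes f g :: "'i \<Rightarrow> 'h::real_normed_vector"
  shows "L2_set (\<lambda>i. norm (f i + g i)) F \<le> L2_set (\<lambda>i. norm (f i)) F + L2_set (\<lambda>i. norm (g i)) F"
  by (rule order_trans[OF L2_set_mono L2_set_triangle_ineq]) (auto simp: norm_triangle_ineq)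

lemma ell2_add:
  fixes f g :: "'i \<Rightarrow> 'h::real_normed_vector"
  assumes "(\<lambda>i. (norm (f i))\<^sup>2) summable_on UNIV" "(\<lambda>i. (norm (g i))\<^sup>2) summable_on UNIV"
  shows "(\<lambda>i. (norm (f i + g i))\<^sup>2) summable_on UNIV"
    and "sqrt (\<Sum>\<^sub>\<infinity>i. (norm (f i + g i))\<^sup>2) \<le>
      sqrt (\<Sum>\<^sub>\<infinity>i. (norm (f i))\<^sup>2) + sqrt (\<Sum>\<^sub>\<infinity>i. (norm (g i))\<^sup>2)"
proof -
  have *: "L2_set (\<lambda>i. norm (f i + g i)) F \<le>
      sqrt (\<Sum>\<^sub>\<infinity>i. (norm (f i))\<^sup>2) + sqrt (\<Sum>\<^sub>\<infinity>i. (norm (g i))\<^sup>2)" if "finite F" for F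
    using L2_set_norm_add[of f g F] L2_set_le_ell2[OF assms(1) that] L2_set_le_ell2[OF assms(2) that]
    by linarith
  show "(\<lambda>i. (norm (f i + g i))\<^sup>2) summable_on UNIV"
    "sqrt (\<Sum>\<^sub>\<infinity>i. (norm (f i + g i))\<^sup>2) \<le>
      sqrt (\<Sum>\<^sub>\<infinity>i. (norm (f i))\<^sup>2) + sqrt (\<Sum>\<^sub>\<infinity>i. (norm (g i))\<^sup>2)"
    using ell2_iff_bounded[of "\<lambda>i. f i + g i", OF *] by blast+
qed

lemma ell2_scaled:
  fixes f :: "'i \<Rightarrow> 'h::real_normed_vector" and g :: "'i \<Rightarrow> 'k::real_normed_vector"
  assumes "(\<lambda>i. (norm (f i))\<^sup>2) summable_on UNIV" "0 \<le> C" "\<And>i. norm (g i) \<le> C * norm (f i)"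
  shows "(\<lambda>i. (norm (g i))\<^sup>2) summable_on UNIV"
    and "sqrt (\<Sum>\<^sub>\<infinity>i. (norm (g i))\<^sup>2) \<le> C * sqrt (\<Sum>\<^sub>\<infinity>i. (norm (f i))\<^sup>2)"
proof -
  have *: "L2_set (\<lambda>i. norm (g i)) F \<le> C * sqrt (\<Sum>\<^sub>\<infinity>i. (norm (f i))\<^sup>2)" if "finite F" for F
  proof -
    have "L2_set (\<lambda>i. norm (g i)) F \<le> L2_set (\<lambda>i. C * norm (f i)) F"
      by (rule L2_set_mono) (use assms in auto)
    also have "\<dots> = C * L2_set (\<lambda>i. norm (f i)) F"
      using L2_set_right_distrib[OF \<open>0 \<le> C\<close>] by metis
    also have "\<dots> \<le> C * sqrt (\<Sum>\<^sub>\<infinity>i. (norm (f i))\<^sup>2)"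
      by (rule mult_left_mono[OF L2_set_le_ell2]) (use assms that in auto)
    finally show ?thesis .
  qed
  show "(\<lambda>i. (norm (g i))\<^sup>2) summable_on UNIV"
    "sqrt (\<Sum>\<^sub>\<infinity>i. (norm (g i))\<^sup>2) \<le> C * sqrt (\<Sum>\<^sub>\<infinity>i. (norm (f i))\<^sup>2)"
    using ell2_iff_bounded[of g, OF *] by blast+
qed

lemma ell2_scale_norm:
  fixes f :: "'i \<Rightarrow> 'h::real_normed_vector" and g :: "'i \<Rightarrow> 'k::real_normed_vector"
  assumes "\<And>i. norm (g i) = C * norm (f i)" "0 \<le> C"
  shows "sqrt (\<Sum>\<^sub>\<infinity>i. (norm (g i))\<^sup>2) = C * sqrt (\<Sum>\<^sub>\<infinity>i. (norm (f i))\<^sup>2)"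
proof -
  have "(\<Sum>\<^sub>\<infinity>i. (norm (g i))\<^sup>2) = C\<^sup>2 * (\<Sum>\<^sub>\<infinity>i. (norm (f i))\<^sup>2)"
    by (simp add: assms(1) power_mult_distrib infsum_cmult_right')
  then show ?thesis
    using assms(2) by (simp add: real_sqrt_mult)
qed

instantiation ell2 :: (type, complex_hilbert_space) complex_normed_vector
begin

lift_definition zero_ell2 :: "('a, 'b) ell2" is "\<lambda>_. 0"
  by simp

lift_definition plus_ell2 :: "('a, 'b) ell2 \<Rightarrow> ('a, 'b) ell2 \<Rightarrow> ('a, 'b) ell2"
  is "\<lambda>f g i. f i + g i"
  by (rule ell2_add)

lift_definition uminus_ell2 :: "('a, 'b) ell2 \<Rightarrow> ('a, 'b) ell2" is "\<lambda>f i. - f i"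
  by simp

lift_definition minus_ell2 :: "('a, 'b) ell2 \<Rightarrow> ('a, 'b) ell2 \<Rightarrow> ('a, 'b) ell2"
  is "\<lambda>f g i. f i - g i"
  using ell2_add(1)[of _ "\<lambda>i. - g i" for g] by fastforce

lift_definition scaleR_ell2 :: "real \<Rightarrow> ('a, 'b) ell2 \<Rightarrow> ('a, 'b) ell2" is "\<lambda>r f i. r *\<^sub>R f i"
  by (erule ell2_scaled(1)[of _ "\<bar>r\<bar>" for r]) auto

lift_definition scaleC_ell2 :: "complex \<Rightarrow> ('a, 'b) ell2 \<Rightarrow> ('a, 'b) ell2" is "\<lambda>a f i. a *\<^sub>C f i"
  by (erule ell2_scaled(1)[of _ "cmod a" for a]) (auto simp: norm_scaleC)

lift_definition norm_ell2 :: "('a, 'b) ell2 \<Rightarrow> real"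
  is "\<lambda>f. sqrt (\<Sum>\<^sub>\<infinity>i. (norm (f i))\<^sup>2)" .

definition dist_ell2 :: "('a, 'b) ell2 \<Rightarrow> ('a, 'b) ell2 \<Rightarrow> real"
  where "dist_ell2 f g = norm (f - g)"

definition sgn_ell2 :: "('a, 'b) ell2 \<Rightarrow> ('a, 'b) ell2"
  where "sgn_ell2 f = inverse (norm f) *\<^sub>R f"

definition uniformity_ell2 :: "(('a, 'b) ell2 \<times> ('a, 'b) ell2) filter"
  where "uniformity_ell2 = (INF e\<in>{0 <..}. principal {(x, y). dist x y < e})"

definition open_ell2 :: "('a, 'b) ell2 set \<Rightarrow> bool"
  where "open_ell2 S = (\<forall>x\<in>S. \<forall>\<^sub>F (x', y) in uniformity. x' = x \<longrightarrow> y \<in> S)"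

instance
proof
  fix f g h :: "('a, 'b) ell2" and r s :: real and a b :: complex
  show "f + g + h = f + (g + h)" "f + g = g + f" "0 + f = f" "- f + f = 0" "f - g = f + - g"
    "r *\<^sub>R (f + g) = r *\<^sub>R f + r *\<^sub>R g" "(r + s) *\<^sub>R f = r *\<^sub>R f + s *\<^sub>R f"
    "r *\<^sub>R s *\<^sub>R f = (r * s) *\<^sub>R f" "1 *\<^sub>R f = f"
    "a *\<^sub>C (f + g) = a *\<^sub>C f + a *\<^sub>C g" "(a + b) *\<^sub>C f = a *\<^sub>C f + b *\<^sub>C f"
    "a *\<^sub>C b *\<^sub>C f = (a * b) *\<^sub>C f" "complex_of_real r *\<^sub>C f = r *\<^sub>R f"
    by (transfer; auto simp: algebra_simps scaleR_add_left scaleC_add_right scaleC_add_left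
        scaleC_scaleC scaleC_of_real)+
  show "dist f g = norm (f - g)" "sgn f = inverse (norm f) *\<^sub>R f"
    "uniformity = (INF e\<in>{0 <..}. principal {(x, y::('a, 'b) ell2). dist x y < e})"
    "open S = (\<forall>x\<in>S. \<forall>\<^sub>F (x', y) in uniformity. x' = x \<longrightarrow> y \<in> S)" for S :: "('a, 'b) ell2 set"
    by (simp_all add: dist_ell2_def sgn_ell2_def uniformity_ell2_def open_ell2_def)
  show "norm f = 0 \<longleftrightarrow> f = 0"
  proof transfer
    fix f :: "'a \<Rightarrow> 'b"
    assume f: "(\<lambda>i. (norm (f i))\<^sup>2) summable_on UNIV"
    show "sqrt (\<Sum>\<^sub>\<infinity>i. (norm (f i))\<^sup>2) = 0 \<longleftrightarrow> f = (\<lambda>_. 0)"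
    proof
      assume "sqrt (\<Sum>\<^sub>\<infinity>i. (norm (f i))\<^sup>2) = 0"
      then have "norm (f i) \<le> 0" for i
        using L2_set_le_ell2[OF f, of "{i}"] by simp
      then show "f = (\<lambda>_. 0)"
        by auto
    qed simp
  qed
  show "norm (f + g) \<le> norm f + norm g"
    by transfer (rule ell2_add)
  show "norm (r *\<^sub>R f) = \<bar>r\<bar> * norm f"
    by transfer (rule ell2_scale_norm, auto)
  show "norm (a *\<^sub>C f) = cmod a * norm f"
    by transfer (rule ell2_scale_norm, auto simp: norm_scaleC)
qed

end

lemma L2_set_le_norm_ell2: "finite F \<Longrightarrow> L2_set (\<lambda>i. norm (ell2_apply f i)) F \<le> norm f"
  by transfer (rule L2_set_le_ell2)

lemma norm_ell2_le: "(\<And>F. finite F \<Longrightarrow> L2_set (\<lambda>i. norm (ell2_apply f i)) F \<le> C) \<Longrightarrow> norm f \<le> C"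
  by transfer (rule ell2_iff_bounded)

lemma norm_ell2_apply_le: "norm (ell2_apply f i) \<le> norm f"
  using L2_set_le_norm_ell2[of "{i}" f] by simp

lemma ell2_eqI: "(\<And>i. ell2_apply f i = ell2_apply g i) \<Longrightarrow> f = g"
  by transfer auto

lemma ell2_cinner_summable:
  fixes f g :: "'i \<Rightarrow> 'h::complex_hilbert_space"
  assumes "(\<lambda>i. (norm (f i))\<^sup>2) summable_on UNIV" "(\<lambda>i. (norm (g i))\<^sup>2) summable_on UNIV"
  shows "(\<lambda>i. cinner (f i) (g i)) summable_on UNIV"
proof (rule abs_summable_summable, rule summable_on_comparison_test)
  show "(\<lambda>i. (norm (f i))\<^sup>2 + (norm (g i))\<^sup>2) summable_on UNIV"
    by (rule summable_on_add) (use assms in auto)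
  fix i
  have "2 * (norm (f i) * norm (g i)) \<le> (norm (f i))\<^sup>2 + (norm (g i))\<^sup>2"
    using sum_squares_bound[of "norm (f i)" "norm (g i)"] by simp
  moreover have "0 \<le> norm (f i) * norm (g i)"
    by simp
  ultimately show "norm (cinner (f i) (g i)) \<le> (norm (f i))\<^sup>2 + (norm (g i))\<^sup>2"
    using norm_cinner_le[of "f i" "g i"] by linarith
qed auto

instantiation ell2 :: (type, complex_hilbert_space) complex_hilbert_space
begin

definition cinner_ell2 :: "('a, 'b) ell2 \<Rightarrow> ('a, 'b) ell2 \<Rightarrow> complex"
  where "cinner_ell2 f g = (\<Sum>\<^sub>\<infinity>i. cinner (ell2_apply f i) (ell2_apply g i))"

instance
proof
  fix f g h :: "('a, 'b) ell2" and a :: complex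
  have summable: "(\<lambda>i. cinner (ell2_apply f i) (ell2_apply g i)) summable_on UNIV" for f g :: "('a, 'b) ell2"
    using ell2_apply[of f] ell2_apply[of g] by (intro ell2_cinner_summable) auto
  show "cinner (f + g) h = cinner f h + cinner g h"
    by (simp add: cinner_ell2_def plus_ell2.rep_eq cinner_add_left infsum_add summable)
  show "cinner (a *\<^sub>C f) g = a * cinner f g"
    by (simp add: cinner_ell2_def scaleC_ell2.rep_eq cinner_scaleC_left infsum_cmult_right')
  show "cinner f g = cnj (cinner g f)"
    by (simp only: cinner_ell2_def infsum_cnj[symmetric] cinner_commute[symmetric])
  have "((\<lambda>i. complex_of_real ((norm (ell2_apply f i))\<^sup>2)) has_sum
      complex_of_real (\<Sum>\<^sub>\<infinity>i. (norm (ell2_apply f i))\<^sup>2)) UNIV"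
    unfolding has_sum_of_real_iff using ell2_apply[of f] by simp
  then show "cinner f f = complex_of_real ((norm f)\<^sup>2)"
    by (simp add: cinner_ell2_def norm_ell2.rep_eq cinner_self infsum_nonneg infsumI
        del: of_real_power)
next
  fix X :: "nat \<Rightarrow> ('a, 'b) ell2"
  assume X: "Cauchy X"
  have "Cauchy (\<lambda>n. ell2_apply (X n) i)" for i
  proof (rule CauchyI)
    fix e :: real
    assume "0 < e"
    then obtain M where M: "\<And>m n. m \<ge> M \<Longrightarrow> n \<ge> M \<Longrightarrow> norm (X m - X n) < e"
      using CauchyD[OF X] by blast
    have "norm (ell2_apply (X m) i - ell2_apply (X n) i) \<le> norm (X m - X n)" for m n
      using norm_ell2_apply_le[of "X m - X n" i] by (simp add: minus_ell2.rep_eq)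
    then show "\<exists>M. \<forall>m\<ge>M. \<forall>n\<ge>M. norm (ell2_apply (X m) i - ell2_apply (X n) i) < e"
      using le_less_trans[OF _ M] by blast
  qed
  then have "\<forall>i. \<exists>l. (\<lambda>n. ell2_apply (X n) i) \<longlonglongrightarrow> l"
    using Cauchy_convergent unfolding convergent_def by blast
  then obtain g where g: "\<And>i. (\<lambda>n. ell2_apply (X n) i) \<longlonglongrightarrow> g i"
    using choice[of "\<lambda>i l. (\<lambda>n. ell2_apply (X n) i) \<longlonglongrightarrow> l"] by blast
  have close: "\<exists>M. \<forall>n\<ge>M. \<forall>F. finite F \<longrightarrow> L2_set (\<lambda>i. norm (ell2_apply (X n) i - g i)) F \<le> e"
    if "0 < e" for e
  proof -
    obtain M where M: "\<And>m n. m \<ge> M \<Longrightarrow> n \<ge> M \<Longrightarrow> norm (X m - X n) < e"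
      using CauchyD[OF X \<open>0 < e\<close>] by blast
    have "L2_set (\<lambda>i. norm (ell2_apply (X n) i - g i)) F \<le> e" if "M \<le> n" "finite F" for n F
    proof (rule tendsto_upperbound)
      show "(\<lambda>m. L2_set (\<lambda>i. norm (ell2_apply (X n) i - ell2_apply (X m) i)) F) \<longlonglongrightarrow>
          L2_set (\<lambda>i. norm (ell2_apply (X n) i - g i)) F"
        unfolding L2_set_def by (intro tendsto_intros g)
      show "\<forall>\<^sub>F m in sequentially. L2_set (\<lambda>i. norm (ell2_apply (X n) i - ell2_apply (X m) i)) F \<le> e"
      proof (rule eventually_sequentiallyI)
        fix m
        assume "M \<le> m"
        then have "norm (X n - X m) \<le> e"
          using M[of n m] \<open>M \<le> n\<close> by simp
        then show "L2_set (\<lambda>i. norm (ell2_apply (X n) i - ell2_apply (X m) i)) F \<le> e"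
          using L2_set_le_norm_ell2[OF \<open>finite F\<close>, of "X n - X m"] by (simp add: minus_ell2.rep_eq)
      qed
    qed simp
    then show ?thesis
      by blast
  qed
  obtain M where M: "\<And>F. finite F \<Longrightarrow> L2_set (\<lambda>i. norm (ell2_apply (X M) i - g i)) F \<le> 1"
    using close[of 1] by auto
  have "(\<lambda>i. (norm (- (ell2_apply (X M) i - g i)))\<^sup>2) summable_on UNIV"
    using ell2_iff_bounded(1)[OF M] by (simp only: norm_minus_cancel)
  then have "(\<lambda>i. (norm (ell2_apply (X M) i + - (ell2_apply (X M) i - g i)))\<^sup>2) summable_on UNIV"
    by (rule ell2_add(1)[rotated]) (use ell2_apply in blast)
  then have "(\<lambda>i. (norm (g i))\<^sup>2) summable_on UNIV"
    by simp
  then have G: "ell2_apply (Abs_ell2 g) = g"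
    by (simp add: Abs_ell2_inverse)
  have "X \<longlonglongrightarrow> Abs_ell2 g"
  proof (rule LIMSEQ_I)
    fix e :: real
    assume "0 < e"
    then obtain M where "\<forall>n\<ge>M. \<forall>F. finite F \<longrightarrow>
        L2_set (\<lambda>i. norm (ell2_apply (X n) i - g i)) F \<le> e / 2"
      using close[of "e / 2"] by auto
    then have "norm (X n - Abs_ell2 g) \<le> e / 2" if "n \<ge> M" for n
      using that by (intro norm_ell2_le) (simp add: minus_ell2.rep_eq G)
    moreover have "e / 2 < e"
      using \<open>0 < e\<close> by simp
    ultimately show "\<exists>M. \<forall>n\<ge>M. norm (X n - Abs_ell2 g) < e"
      using le_less_trans by blast
  qed
  then show "convergent X"
    unfolding convergent_def by blast
qed

end


section \<open>The C*-algebra of bounded operators on a Hilbert space\<close>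

definition bounded_clinear :: "('a::complex_normed_vector \<Rightarrow> 'b::complex_normed_vector) \<Rightarrow> bool"
  where "bounded_clinear f \<longleftrightarrow> bounded_linear f \<and> (\<forall>a x. f (a *\<^sub>C x) = a *\<^sub>C f x)"

lemma bounded_clinearI:
  assumes "\<And>x y. f (x + y) = f x + f y" "\<And>a x. f (a *\<^sub>C x) = a *\<^sub>C f x"
    "\<And>x. norm (f x) \<le> norm x * K"
  shows "bounded_clinear f"
proof -
  have "f (r *\<^sub>R x) = r *\<^sub>R f x" for r x
    using assms(2)[of "complex_of_real r" x] by (simp only: scaleC_of_real)
  then show ?thesis
    unfolding bounded_clinear_def by (auto intro!: bounded_linear_intro[where K = K] assms)
qed

lemma bounded_clinear_bounded_linear: "bounded_clinear f \<Longrightarrow> bounded_linear f"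
  by (simp add: bounded_clinear_def)

lemma bounded_clinear_scaleC: "bounded_clinear f \<Longrightarrow> f (a *\<^sub>C x) = a *\<^sub>C f x"
  by (simp add: bounded_clinear_def)

lemma bounded_clinear_add: "bounded_clinear f \<Longrightarrow> f (x + y) = f x + f y"
  by (simp add: bounded_clinear_def bounded_linear.linear linear_add)

lemma cinner_eqI:
  fixes y z :: "'h::complex_hilbert_space"
  assumes "\<And>x. cinner x y = cinner x z"
  shows "y = z"
proof -
  have "complex_of_real ((norm (y - z))\<^sup>2) = 0"
    unfolding cinner_self[symmetric] using assms[of "y - z"] by (simp add: cinner_diff_right)
  then show ?thesis
    by simp
qed

lemma riesz_representation:
  fixes f :: "'h::complex_hilbert_space \<Rightarrow> complex"
  assumes "bounded_clinear f"
  shows "\<exists>y. \<forall>x. f x = cinner x y"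
proof -
  interpret bounded_linear f
    using assms by (rule bounded_clinear_bounded_linear)
  obtain K where K: "\<And>x. norm (f x) \<le> norm x * K"
    using bounded by blast
  define J where "J x = (norm x)\<^sup>2 - 2 * Re (f x)" for x
  have J_ge: "- K\<^sup>2 \<le> J x" for x
  proof -
    have "Re (f x) \<le> norm x * K"
      using K[of x] abs_Re_le_cmod[of "f x"] by linarith
    moreover have "0 \<le> (norm x - K)\<^sup>2"
      by simp
    ultimately show ?thesis
      unfolding J_def power2_diff by (simp add: algebra_simps)
  qed
  have bdd: "bdd_below (range J)"
    using J_ge by (auto intro!: bdd_belowI2[of _ "- K\<^sup>2"])
  define m where "m = (INF x. J x)"
  have m_le: "m \<le> J x" for x
    unfolding m_def using bdd by (intro cINF_lower) auto
  have "\<exists>x. J x < m + 1 / real (Suc n)" for n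
    using cINF_less_iff[OF UNIV_not_empty bdd, of "m + 1 / real (Suc n)"] unfolding m_def by auto
  then obtain X where X: "\<And>n. J (X n) < m + 1 / real (Suc n)"
    using choice[of "\<lambda>n x. J x < m + 1 / real (Suc n)"] by blast
  have par: "(norm (x - y))\<^sup>2 \<le> 2 * (J x - m) + 2 * (J y - m)" for x y
  proof -
    define z where "z = (1/2) *\<^sub>R (x + y)"
    have z: "4 * (norm z)\<^sup>2 = (norm (x + y))\<^sup>2" "2 * Re (f z) = Re (f x) + Re (f y)"
      by (simp_all add: z_def power_divide scaleR add)
    have "4 * J z = (norm (x + y))\<^sup>2 - 4 * (Re (f x) + Re (f y))"
      unfolding J_def z(1)[symmetric] z(2)[symmetric] by (simp add: algebra_simps)
    then have "(norm (x - y))\<^sup>2 = 2 * J x + 2 * J y - 4 * J z"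
      unfolding J_def norm_add_square norm_diff_square by (simp add: algebra_simps)
    then show ?thesis
      using m_le[of z] by argo
  qed
  have "Cauchy X"
  proof (rule CauchyI)
    fix e :: real
    assume "0 < e"
    then obtain M where M: "1 / real (Suc M) < e\<^sup>2 / 4"
      using nat_approx_posE[of "e\<^sup>2 / 4"] by auto
    have J_less: "J (X n) - m < e\<^sup>2 / 4" if "M \<le> n" for n
    proof -
      have "1 / real (Suc n) \<le> 1 / real (Suc M)"
        using that by (simp add: frac_le)
      then show ?thesis
        using X[of n] M by linarith
    qed
    have "norm (X n - X k) < e" if "M \<le> n" "M \<le> k" for n k
    proof (rule power_less_imp_less_base)
      show "(norm (X n - X k))\<^sup>2 < e\<^sup>2"
        using par[of "X n" "X k"] J_less[OF that(1)] J_less[OF that(2)] by argo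
    qed (use \<open>0 < e\<close> in simp)
    then show "\<exists>M. \<forall>n\<ge>M. \<forall>k\<ge>M. norm (X n - X k) < e"
      by blast
  qed
  then obtain y where y: "X \<longlonglongrightarrow> y"
    using Cauchy_convergent convergent_def by blast
  have "(\<lambda>n. J (X n)) \<longlonglongrightarrow> J y"
    unfolding J_def by (intro tendsto_intros y tendsto)
  moreover have "(\<lambda>n. m + 1 / real (Suc n)) \<longlonglongrightarrow> m + 0"
    using LIMSEQ_inverse_real_of_nat by (intro tendsto_intros) (simp add: inverse_eq_divide)
  ultimately have "J y \<le> m"
    using X by (intro LIMSEQ_le) (auto intro: less_imp_le)
  then have min: "J y \<le> J x" for x
    using m_le[of x] by linarith
  have Re_eq: "Re (f x) = Re (cinner x y)" for x
  proof -
    define c where "c = Re (cinner x y) - Re (f x)"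
    have t: "0 \<le> 2 * t * c + t\<^sup>2 * (norm x)\<^sup>2" for t
    proof -
      have "Re (cinner (t *\<^sub>R x) y) = t * Re (cinner x y)"
        by (simp add: scaleC_of_real[symmetric] cinner_scaleC_left)
      moreover have "Re (cinner y (t *\<^sub>R x)) = Re (cinner (t *\<^sub>R x) y)"
        by (subst cinner_commute) simp
      moreover have "(norm (t *\<^sub>R x))\<^sup>2 = t\<^sup>2 * (norm x)\<^sup>2"
        by (simp add: power_mult_distrib)
      ultimately show ?thesis
        using min[of "y + t *\<^sub>R x"] norm_add_square[of y "t *\<^sub>R x"]
        unfolding J_def c_def by (simp add: add scaleR algebra_simps)
    qed
    have "c = 0"
    proof (rule ccontr)
      assume "c \<noteq> 0"
      define N where "N = (norm x)\<^sup>2 + 1"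
      have N: "0 < N" "(norm x)\<^sup>2 < N"
        by (simp_all add: N_def add_nonneg_pos)
      have "0 \<le> 2 * (- c / N) * c + (- c / N)\<^sup>2 * (norm x)\<^sup>2"
        by (rule t)
      also have "\<dots> \<le> 2 * (- c / N) * c + (- c / N)\<^sup>2 * N"
        using N by (intro add_left_mono mult_left_mono) auto
      also have "\<dots> = - (c\<^sup>2 / N)"
        using N by (simp add: power2_eq_square field_simps)
      also have "\<dots> < 0"
        using N \<open>c \<noteq> 0\<close> by simp
      finally show False
        by simp
    qed
    then show ?thesis
      by (simp add: c_def)
  qed
  have "f x = cinner x y" for x
  proof (rule complex_eqI)
    have "f (\<i> *\<^sub>C x) = \<i> * f x"
      using bounded_clinear_scaleC[OF assms] by (simp add: scaleC_complex_def)
    then show "Im (f x) = Im (cinner x y)"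
      using Re_eq[of "\<i> *\<^sub>C x"] by (simp add: cinner_scaleC_left)
  qed (rule Re_eq)
  then show ?thesis
    by blast
qed

lemma adjoint_exists:
  fixes T :: "'h::complex_hilbert_space \<Rightarrow> 'h"
  assumes "bounded_clinear T"
  shows "\<exists>S. bounded_clinear S \<and> (\<forall>x y. cinner (T x) y = cinner x (S y))"
proof -
  interpret bounded_linear T
    using assms by (rule bounded_clinear_bounded_linear)
  obtain K where K: "0 \<le> K" "\<And>x. norm (T x) \<le> norm x * K"
    using nonneg_bounded by blast
  have "\<exists>z. \<forall>x. cinner (T x) y = cinner x z" for y
  proof (rule riesz_representation, rule bounded_clinearI)
    fix x x' a
    show "cinner (T (x + x')) y = cinner (T x) y + cinner (T x') y"
      by (simp add: add cinner_add_left)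
    show "cinner (T (a *\<^sub>C x)) y = a *\<^sub>C cinner (T x) y"
      by (simp add: bounded_clinear_scaleC[OF assms] cinner_scaleC_left scaleC_complex_def)
    have "norm (T x) * norm y \<le> norm x * K * norm y"
      by (rule mult_right_mono[OF K(2)]) simp
    then show "cmod (cinner (T x) y) \<le> norm x * (K * norm y)"
      using norm_cinner_le[of "T x" y] by (simp add: mult.assoc)
  qed
  then obtain S where S: "\<And>y x. cinner (T x) y = cinner x (S y)"
    using choice[of "\<lambda>y z. \<forall>x. cinner (T x) y = cinner x z"] by blast
  have "bounded_clinear S"
  proof (rule bounded_clinearI)
    fix y z a
    show "S (y + z) = S y + S z"
      by (rule cinner_eqI) (simp add: S[symmetric] cinner_add_right)
    show "S (a *\<^sub>C y) = a *\<^sub>C S y"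
      by (rule cinner_eqI) (simp add: S[symmetric] cinner_scaleC_right)
    have "complex_of_real ((norm (S y))\<^sup>2) = cinner (T (S y)) y"
      by (simp only: S cinner_self)
    then have "(norm (S y))\<^sup>2 = cmod (cinner (T (S y)) y)"
      by (metis norm_of_real abs_of_nonneg zero_le_power2)
    also have "\<dots> \<le> norm (T (S y)) * norm y"
      by (rule norm_cinner_le)
    also have "\<dots> \<le> norm (S y) * K * norm y"
      by (rule mult_right_mono[OF K(2)]) simp
    finally have "norm (S y) * norm (S y) \<le> norm (S y) * (norm y * K)"
      by (simp add: power2_eq_square algebra_simps)
    then show "norm (S y) \<le> norm y * K"
      using K(1) by (cases "norm (S y) = 0") (auto simp: mult_le_cancel_left)
  qed
  then show ?thesis
    using S by blast
qed

typedef (overloaded) 'h bounded_op = "{T :: 'h::complex_hilbert_space \<Rightarrow> 'h. bounded_clinear T}"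
  morphisms op_apply Abs_bounded_op
  by (rule exI[of _ "\<lambda>_. 0"]) (auto intro: bounded_clinearI[where K = 0] simp: complex_vector.scale_zero_right)

setup_lifting type_definition_bounded_op

lemma op_eqI: "(\<And>x. op_apply S x = op_apply T x) \<Longrightarrow> S = T"
  by transfer auto

lemma bounded_clinear_op_apply: "bounded_clinear (op_apply T)"
  using op_apply[of T] by simp

lemmas bounded_linear_op_apply = bounded_clinear_bounded_linear[OF bounded_clinear_op_apply]

lemmas op_apply_add = bounded_clinear_add[OF bounded_clinear_op_apply]
  and op_apply_scaleC = bounded_clinear_scaleC[OF bounded_clinear_op_apply]

instantiation bounded_op :: (complex_hilbert_space) complex_normed_vector
begin

lift_definition zero_bounded_op :: "'a bounded_op" is "\<lambda>_. 0"
  by (rule bounded_clinearI[where K = 0]) (auto simp: complex_vector.scale_zero_right)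

lift_definition plus_bounded_op :: "'a bounded_op \<Rightarrow> 'a bounded_op \<Rightarrow> 'a bounded_op"
  is "\<lambda>S T x. S x + T x"
  unfolding bounded_clinear_def by (simp add: bounded_linear_add scaleC_add_right)

lift_definition uminus_bounded_op :: "'a bounded_op \<Rightarrow> 'a bounded_op" is "\<lambda>T x. - T x"
  unfolding bounded_clinear_def
  by (simp add: bounded_linear_minus complex_vector.scale_minus_right)

lift_definition minus_bounded_op :: "'a bounded_op \<Rightarrow> 'a bounded_op \<Rightarrow> 'a bounded_op"
  is "\<lambda>S T x. S x - T x"
  unfolding bounded_clinear_def
  by (simp add: bounded_linear_sub complex_vector.scale_right_diff_distrib)

lift_definition scaleC_bounded_op :: "complex \<Rightarrow> 'a bounded_op \<Rightarrow> 'a bounded_op"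
  is "\<lambda>a T x. a *\<^sub>C T x"
proof -
  fix a and T :: "'a \<Rightarrow> 'a"
  assume T: "bounded_clinear T"
  obtain K where K: "\<And>x. norm (T x) \<le> norm x * K"
    using bounded_linear.bounded[OF bounded_clinear_bounded_linear[OF T]] by blast
  show "bounded_clinear (\<lambda>x. a *\<^sub>C T x)"
  proof (rule bounded_clinearI)
    fix x y b
    show "a *\<^sub>C T (x + y) = a *\<^sub>C T x + a *\<^sub>C T y"
      by (simp add: bounded_clinear_add[OF T] scaleC_add_right)
    show "a *\<^sub>C T (b *\<^sub>C x) = b *\<^sub>C a *\<^sub>C T x"
      by (simp add: bounded_clinear_scaleC[OF T] scaleC_scaleC mult.commute)
    show "norm (a *\<^sub>C T x) \<le> norm x * (K * cmod a)"
      using mult_left_mono[OF K[of x], of "cmod a"] by (simp add: norm_scaleC algebra_simps)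
  qed
qed

definition scaleR_bounded_op :: "real \<Rightarrow> 'a bounded_op \<Rightarrow> 'a bounded_op"
  where "scaleR_bounded_op r T = complex_of_real r *\<^sub>C T"

lift_definition norm_bounded_op :: "'a bounded_op \<Rightarrow> real" is onorm .

definition dist_bounded_op :: "'a bounded_op \<Rightarrow> 'a bounded_op \<Rightarrow> real"
  where "dist_bounded_op S T = norm (S - T)"

definition sgn_bounded_op :: "'a bounded_op \<Rightarrow> 'a bounded_op"
  where "sgn_bounded_op T = inverse (norm T) *\<^sub>R T"

definition uniformity_bounded_op :: "('a bounded_op \<times> 'a bounded_op) filter"
  where "uniformity_bounded_op = (INF e\<in>{0 <..}. principal {(x, y). dist x y < e})"

definition open_bounded_op :: "'a bounded_op set \<Rightarrow> bool"
  where "open_bounded_op S = (\<forall>x\<in>S. \<forall>\<^sub>F (x', y) in uniformity. x' = x \<longrightarrow> y \<in> S)"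

lemma scaleR_bounded_op_apply: "op_apply (r *\<^sub>R T) x = r *\<^sub>R op_apply T x"
  by (simp add: scaleR_bounded_op_def scaleC_bounded_op.rep_eq scaleC_of_real)

instance
proof
  fix R S T :: "'a bounded_op" and r s :: real and a b :: complex
  show "R + S + T = R + (S + T)" "R + S = S + R" "0 + R = R" "- R + R = 0" "R - S = R + - S"
    "a *\<^sub>C (R + S) = a *\<^sub>C R + a *\<^sub>C S" "(a + b) *\<^sub>C R = a *\<^sub>C R + b *\<^sub>C R"
    "a *\<^sub>C b *\<^sub>C R = (a * b) *\<^sub>C R"
    by (transfer; simp add: fun_eq_iff add_ac scaleC_add_right scaleC_add_left scaleC_scaleC)+
  show "r *\<^sub>R (R + S) = r *\<^sub>R R + r *\<^sub>R S" "(r + s) *\<^sub>R R = r *\<^sub>R R + s *\<^sub>R R"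
    "r *\<^sub>R s *\<^sub>R R = (r * s) *\<^sub>R R" "1 *\<^sub>R R = R"
    by (rule op_eqI; simp add: scaleR_bounded_op_apply plus_bounded_op.rep_eq scaleR_add_right
        scaleR_add_left)+
  show "complex_of_real r *\<^sub>C R = r *\<^sub>R R" "dist R S = norm (R - S)" "sgn R = inverse (norm R) *\<^sub>R R"
    "uniformity = (INF e\<in>{0 <..}. principal {(x, y::'a bounded_op). dist x y < e})"
    "open A = (\<forall>x\<in>A. \<forall>\<^sub>F (x', y) in uniformity. x' = x \<longrightarrow> y \<in> A)" for A :: "'a bounded_op set"
    by (simp_all add: scaleR_bounded_op_def dist_bounded_op_def sgn_bounded_op_def
        uniformity_bounded_op_def open_bounded_op_def)
  show "norm R = 0 \<longleftrightarrow> R = 0"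
    by transfer (simp add: onorm_eq_0 bounded_clinear_bounded_linear fun_eq_iff)
  show "norm (R + S) \<le> norm R + norm S"
    by transfer (simp add: onorm_triangle bounded_clinear_bounded_linear)
  have C: "norm (a *\<^sub>C R) = cmod a * norm R" for a
  proof (cases "a = 0")
    case True
    then show ?thesis
      by (transfer; simp add: complex_vector.scale_zero_left onorm_zero)
  next
    case False
    have le: "norm (a *\<^sub>C R) \<le> cmod a * norm R" for a and R :: "'a bounded_op"
    proof transfer
      fix a and R :: "'a \<Rightarrow> 'a"
      assume R: "bounded_clinear R"
      show "onorm (\<lambda>x. a *\<^sub>C R x) \<le> cmod a * onorm R"
        using onorm[OF bounded_clinear_bounded_linear[OF R]]
          onorm_pos_le[OF bounded_clinear_bounded_linear[OF R]]
        by (intro onorm_bound) (auto simp: norm_scaleC mult.assoc mult_left_mono)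
    qed
    have "inverse a *\<^sub>C a *\<^sub>C R = R"
      using False by transfer (simp add: scaleC_scaleC scaleC_of_real[of 1, simplified])
    then have "norm R \<le> inverse (cmod a) * norm (a *\<^sub>C R)"
      using le[of "inverse a" "a *\<^sub>C R"] by (simp add: norm_inverse)
    then have "cmod a * norm R \<le> norm (a *\<^sub>C R)"
      using False by (simp add: field_simps)
    then show ?thesis
      using le[of a R] by simp
  qed
  then show "norm (a *\<^sub>C R) = cmod a * norm R" .
  show "norm (r *\<^sub>R R) = \<bar>r\<bar> * norm R"
    by (simp add: scaleR_bounded_op_def C)
qed

end

lemma norm_op_apply_le: "norm (op_apply T x) \<le> norm T * norm x"
  by transfer (rule onorm, rule bounded_clinear_bounded_linear)

lemma norm_op_le: "0 \<le> b \<Longrightarrow> (\<And>x. norm (op_apply T x) \<le> b * norm x) \<Longrightarrow> norm T \<le> b"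
  by transfer (rule onorm_bound)

instantiation bounded_op :: (complex_hilbert_space) cstar_algebra
begin

lift_definition times_bounded_op :: "'a bounded_op \<Rightarrow> 'a bounded_op \<Rightarrow> 'a bounded_op"
  is "\<lambda>S T x. S (T x)"
  unfolding bounded_clinear_def by (auto intro: bounded_linear_compose)

definition star_bounded_op :: "'a bounded_op \<Rightarrow> 'a bounded_op"
  where "star_bounded_op T = (THE S. \<forall>x y. cinner (op_apply T x) y = cinner x (op_apply S y))"

lemma cinner_star: "cinner (op_apply T x) y = cinner x (op_apply (star T) y)"
  for T :: "'a bounded_op"
proof -
  let ?P = "\<lambda>S. \<forall>x y. cinner (op_apply T x) y = cinner x (op_apply S y)"
  obtain S where "bounded_clinear S" "\<forall>x y. cinner (op_apply T x) y = cinner x (S y)"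
    using adjoint_exists[OF bounded_clinear_op_apply] by blast
  then have P: "?P (Abs_bounded_op S)"
    by (simp add: Abs_bounded_op_inverse)
  have "S' = Abs_bounded_op S" if "?P S'" for S'
  proof (rule op_eqI, rule cinner_eqI)
    fix x y
    show "cinner x (op_apply S' y) = cinner x (op_apply (Abs_bounded_op S) y)"
      using that[rule_format, of x y] P[rule_format, of x y] by simp
  qed
  with P have "?P (star T)"
    unfolding star_bounded_op_def by (rule theI)
  then show ?thesis
    by blast
qed

lemma star_eqI: "(\<And>x y. cinner (op_apply T x) y = cinner x (op_apply S y)) \<Longrightarrow> star T = S"
  for T :: "'a bounded_op"
  by (rule op_eqI, rule cinner_eqI) (simp add: cinner_star[symmetric])

instance
proof
  fix R S T :: "'a bounded_op" and r :: real and a :: complex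
  show "R * S * T = R * (S * T)" "(R + S) * T = R * T + S * T"
    by (transfer; simp)+
  show "R * (S + T) = R * S + R * T"
    by transfer (simp add: bounded_clinear_add)
  show "a *\<^sub>C R * S = a *\<^sub>C (R * S)"
    by transfer simp
  show *: "R * a *\<^sub>C S = a *\<^sub>C (R * S)" for a
    by transfer (simp add: bounded_clinear_scaleC)
  show "r *\<^sub>R R * S = r *\<^sub>R (R * S)"
    by (rule op_eqI) (simp add: times_bounded_op.rep_eq scaleR_bounded_op_apply)
  show "R * r *\<^sub>R S = r *\<^sub>R (R * S)"
    unfolding scaleR_bounded_op_def by (rule *)
  show mult: "norm (R * S) \<le> norm R * norm S" for R S :: "'a bounded_op"
  proof (rule norm_op_le)
    fix x
    have "norm (op_apply R (op_apply S x)) \<le> norm R * (norm S * norm x)"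
      by (rule order_trans[OF norm_op_apply_le]) (simp add: mult_left_mono norm_op_apply_le)
    then show "norm (op_apply (R * S) x) \<le> norm R * norm S * norm x"
      by (simp add: times_bounded_op.rep_eq mult.assoc)
  qed simp
  show "star (R + S) = star R + star S"
    by (rule star_eqI)
      (simp add: plus_bounded_op.rep_eq cinner_add_left cinner_add_right cinner_star)
  show "star (a *\<^sub>C R) = cnj a *\<^sub>C star R"
    by (rule star_eqI)
      (simp add: scaleC_bounded_op.rep_eq cinner_scaleC_left cinner_scaleC_right cinner_star)
  show "star (R * S) = star S * star R"
    by (rule star_eqI) (simp add: times_bounded_op.rep_eq cinner_star)
  show star2: "star (star R) = R" for R :: "'a bounded_op"
  proof (rule star_eqI)
    fix x y
    have "cinner (op_apply (star R) x) y = cnj (cinner (op_apply R y) x)"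
      by (subst cinner_commute) (simp add: cinner_star)
    then show "cinner (op_apply (star R) x) y = cinner x (op_apply R y)"
      by (simp only: cinner_commute[symmetric])
  qed
  have square: "(norm (op_apply R x))\<^sup>2 \<le> norm (star R * R) * (norm x)\<^sup>2"
    for R :: "'a bounded_op" and x
  proof -
    have "complex_of_real ((norm (op_apply R x))\<^sup>2) = cinner x (op_apply (star R * R) x)"
      by (simp only: cinner_self[symmetric] cinner_star[of R] times_bounded_op.rep_eq)
    then have "(norm (op_apply R x))\<^sup>2 = cmod (cinner x (op_apply (star R * R) x))"
      by (metis norm_of_real abs_of_nonneg zero_le_power2)
    also have "\<dots> \<le> norm x * norm (op_apply (star R * R) x)"
      by (rule norm_cinner_le)
    also have "\<dots> \<le> norm x * (norm (star R * R) * norm x)"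
      by (intro mult_left_mono norm_op_apply_le) simp
    finally show ?thesis
      by (simp add: power2_eq_square algebra_simps)
  qed
  have ge: "(norm R)\<^sup>2 \<le> norm (star R * R)" for R :: "'a bounded_op"
  proof -
    have "norm R \<le> sqrt (norm (star R * R))"
    proof (rule norm_op_le)
      fix x
      show "norm (op_apply R x) \<le> sqrt (norm (star R * R)) * norm x"
        by (rule power2_le_imp_le) (use square[of R x] in \<open>simp_all add: power_mult_distrib\<close>)
    qed simp
    then show ?thesis
      by (metis norm_ge_zero power_mono real_sqrt_pow2)
  qed
  have le: "norm R \<le> norm (star R)" for R :: "'a bounded_op"
  proof -
    have "norm R * norm R \<le> norm (star R) * norm R"
      using ge[of R] mult[of "star R" R] by (simp add: power2_eq_square)
    then show ?thesis
      by (cases "norm R = 0") (auto simp: mult_le_cancel_right)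
  qed
  have "norm (star R) = norm R"
    using le[of R] le[of "star R"] by (simp add: star2)
  then show "norm (star R * R) = (norm R)\<^sup>2"
    using ge[of R] mult[of "star R" R] by (simp add: power2_eq_square)
next
  fix X :: "nat \<Rightarrow> 'a bounded_op"
  assume X: "Cauchy X"
  define Y where "Y n = Blinfun (op_apply (X n))" for n
  have Y: "blinfun_apply (Y n) = op_apply (X n)" for n
    unfolding Y_def by (rule bounded_linear_Blinfun_apply[OF bounded_linear_op_apply])
  have norm_Y: "norm (Y n - B) \<le> e \<longleftrightarrow> (\<forall>x. norm (op_apply (X n) x - blinfun_apply B x) \<le> e * norm x)"
    if "0 \<le> e" for n B e
  proof
    assume "norm (Y n - B) \<le> e"
    then have "norm (blinfun_apply (Y n - B) x) \<le> e * norm x" for x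
      by (intro order_trans[OF norm_blinfun] mult_right_mono) auto
    then show "\<forall>x. norm (op_apply (X n) x - blinfun_apply B x) \<le> e * norm x"
      by (simp add: blinfun.diff_left Y)
  next
    assume "\<forall>x. norm (op_apply (X n) x - blinfun_apply B x) \<le> e * norm x"
    then show "norm (Y n - B) \<le> e"
      using that by (intro norm_blinfun_bound) (auto simp: blinfun.diff_left Y)
  qed
  have "norm (Y n - Y k) \<le> norm (X n - X k)" for n k
    using norm_op_apply_le[of "X n - X k"] by (simp add: norm_Y Y minus_bounded_op.rep_eq)
  then have "Cauchy Y"
    using X unfolding Cauchy_def dist_norm by (meson le_less_trans)
  then have "convergent Y"
    by (rule Cauchy_convergent)
  then obtain L where L: "Y \<longlonglongrightarrow> L"
    unfolding convergent_def by blast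
  have lim: "(\<lambda>n. op_apply (X n) x) \<longlonglongrightarrow> blinfun_apply L x" for x
    using blinfun.tendsto[OF L tendsto_const, of x] by (simp add: Y)
  have "blinfun_apply L (a *\<^sub>C x) = a *\<^sub>C blinfun_apply L x" for a x
  proof (rule LIMSEQ_unique)
    show "(\<lambda>n. op_apply (X n) (a *\<^sub>C x)) \<longlonglongrightarrow> blinfun_apply L (a *\<^sub>C x)"
      by (rule lim)
    have "bounded_linear ((*\<^sub>C) a :: 'a \<Rightarrow> 'a)"
      by (rule bounded_clinear_bounded_linear, rule bounded_clinearI[where K = "cmod a"])
        (auto simp: scaleC_add_right scaleC_scaleC norm_scaleC mult.commute)
    from bounded_linear.tendsto[OF this lim]
    show "(\<lambda>n. op_apply (X n) (a *\<^sub>C x)) \<longlonglongrightarrow> a *\<^sub>C blinfun_apply L x"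
      by (simp add: op_apply_scaleC)
  qed
  then have "bounded_clinear (blinfun_apply L)"
    by (simp add: bounded_clinear_def blinfun.bounded_linear_right)
  then have L': "op_apply (Abs_bounded_op (blinfun_apply L)) = blinfun_apply L"
    by (simp add: Abs_bounded_op_inverse)
  have "X \<longlonglongrightarrow> Abs_bounded_op (blinfun_apply L)"
  proof (rule LIMSEQ_I)
    fix e :: real
    assume e: "0 < e"
    then obtain M where M: "\<And>n. n \<ge> M \<Longrightarrow> norm (Y n - L) < e / 2"
      using LIMSEQ_D[OF L, of "e / 2"] by auto
    have "norm (X n - Abs_bounded_op (blinfun_apply L)) < e" if "n \<ge> M" for n
    proof -
      have "norm (op_apply (X n) x - blinfun_apply L x) \<le> e / 2 * norm x" for x
        using norm_Y[THEN iffD1, rule_format, OF _ less_imp_le[OF M[OF that]]] e by simp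
      then have "norm (X n - Abs_bounded_op (blinfun_apply L)) \<le> e / 2"
        using e by (intro norm_op_le) (simp_all add: minus_bounded_op.rep_eq L')
      then show ?thesis
        using e by simp
    qed
    then show "\<exists>M. \<forall>n\<ge>M. norm (X n - Abs_bounded_op (blinfun_apply L)) < e"
      by blast
  qed
  then show "convergent X"
    unfolding convergent_def by blast
qed

end

instantiation bounded_op :: (complex_hilbert_space) monoid_mult
begin

lift_definition one_bounded_op :: "'a bounded_op" is "\<lambda>x. x"
  by (simp add: bounded_clinear_def bounded_linear_ident)

instance
  by standard (rule op_eqI, simp add: times_bounded_op.rep_eq one_bounded_op.rep_eq)+

end


section \<open>Operators on square-summable families\<close>

text \<open>The block diagonal operator with blocks \<open>D i\<close>; only meaningful for bounded families.\<close>

definition diag_op :: "('i \<Rightarrow> 'h::complex_hilbert_space bounded_op) \<Rightarrow> ('i, 'h) ell2 bounded_op"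
  where "diag_op D = Abs_bounded_op (\<lambda>\<xi>. Abs_ell2 (\<lambda>i. op_apply (D i) (ell2_apply \<xi> i)))"

lift_definition ell2_single :: "'i \<Rightarrow> 'h::complex_hilbert_space \<Rightarrow> ('i, 'h) ell2"
  is "\<lambda>j h i. if i = j then h else 0"
proof -
  fix j and h :: 'h
  have "L2_set (\<lambda>i. norm (if i = j then h else 0)) F \<le> norm h" if "finite F" for F :: "'i set"
  proof -
    have "(norm (if i = j then h else 0))\<^sup>2 = (if i = j then (norm h)\<^sup>2 else 0)" for i
      by simp
    then show ?thesis
      using that by (simp add: L2_set_def)
  qed
  then show "(\<lambda>i. (norm (if i = j then h else 0))\<^sup>2) summable_on UNIV"
    by (rule ell2_iff_bounded)
qed

text \<open>The \<open>(i, j)\<close> entry of an operator, seen as an operator-valued matrix.\<close>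

definition block_op :: "'i \<Rightarrow> 'i \<Rightarrow> ('i, 'h::complex_hilbert_space) ell2 bounded_op \<Rightarrow> 'h bounded_op"
  where "block_op i j T = Abs_bounded_op (\<lambda>h. ell2_apply (op_apply T (ell2_single j h)) i)"

text \<open>Groups are written additively (but need not be commutative), so \<open>- s + t\<close> is
  \<open>s\<inverse>t\<close>. This is the canonical unitary \<open>\<lambda>(s)\<close>.\<close>

definition translation :: "'g::group_add \<Rightarrow> ('g, 'h::complex_hilbert_space) ell2 bounded_op"
  where "translation s = Abs_bounded_op (\<lambda>\<xi>. Abs_ell2 (\<lambda>t. ell2_apply \<xi> (- s + t)))"

lemma diag_op_apply:
  fixes D :: "'a \<Rightarrow> 'b::complex_hilbert_space bounded_op"
  assumes "bounded (range D)"
  shows "ell2_apply (op_apply (diag_op D) \<xi>) i = op_apply (D i) (ell2_apply \<xi> i)"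
proof -
  obtain K where K: "\<And>i. norm (D i) \<le> K" "0 \<le> K"
    using assms unfolding bounded_iff by (metis norm_ge_zero order_trans rangeI)
  have le: "norm (op_apply (D i) h) \<le> K * norm h" for i h
    by (rule order_trans[OF norm_op_apply_le mult_right_mono[OF K(1)]]) simp
  have ell2: "(\<lambda>i. (norm (op_apply (D i) (ell2_apply \<xi> i)))\<^sup>2) summable_on UNIV" for \<xi>
    using ell2_apply[of \<xi>] by (intro ell2_scaled(1)[OF _ K(2) le]) simp
  have Abs: "ell2_apply (Abs_ell2 (\<lambda>i. op_apply (D i) (ell2_apply \<xi> i))) =
      (\<lambda>i. op_apply (D i) (ell2_apply \<xi> i))" for \<xi>
    using ell2 by (simp add: Abs_ell2_inverse)
  have "bounded_clinear (\<lambda>\<xi>. Abs_ell2 (\<lambda>i. op_apply (D i) (ell2_apply \<xi> i)))"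
  proof (rule bounded_clinearI)
    fix \<xi> \<eta> :: "('a, 'b) ell2" and a
    show "Abs_ell2 (\<lambda>i. op_apply (D i) (ell2_apply (\<xi> + \<eta>) i)) =
        Abs_ell2 (\<lambda>i. op_apply (D i) (ell2_apply \<xi> i)) + Abs_ell2 (\<lambda>i. op_apply (D i) (ell2_apply \<eta> i))"
      by (rule ell2_eqI, simp only: Abs) (simp add: Abs plus_ell2.rep_eq op_apply_add)
    show "Abs_ell2 (\<lambda>i. op_apply (D i) (ell2_apply (a *\<^sub>C \<xi>) i)) =
        a *\<^sub>C Abs_ell2 (\<lambda>i. op_apply (D i) (ell2_apply \<xi> i))"
      by (rule ell2_eqI, simp only: Abs) (simp add: Abs scaleC_ell2.rep_eq op_apply_scaleC)
    have "norm (Abs_ell2 (\<lambda>i. op_apply (D i) (ell2_apply \<xi> i))) \<le> K * norm \<xi>"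
      unfolding norm_ell2.rep_eq Abs
      using ell2_apply[of \<xi>] by (intro ell2_scaled(2)[OF _ K(2) le]) simp
    then show "norm (Abs_ell2 (\<lambda>i. op_apply (D i) (ell2_apply \<xi> i))) \<le> norm \<xi> * K"
      by (simp add: mult.commute)
  qed
  then show ?thesis
    by (simp add: diag_op_def Abs_bounded_op_inverse Abs)
qed

lemma norm_ell2_single:
  fixes h :: "'b::complex_hilbert_space"
  shows "norm (ell2_single (j::'a) h) \<le> norm h"
proof (rule norm_ell2_le)
  fix F :: "'a set"
  assume "finite F"
  moreover have "(norm (ell2_apply (ell2_single j h) i))\<^sup>2 = (if i = j then (norm h)\<^sup>2 else 0)" for i
    by (simp add: ell2_single.rep_eq)
  ultimately show "L2_set (\<lambda>i. norm (ell2_apply (ell2_single j h) i)) F \<le> norm h"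
    by (simp add: L2_set_def)
qed

lemma block_op_apply:
  fixes T :: "('a, 'b::complex_hilbert_space) ell2 bounded_op"
  shows "op_apply (block_op i j T) h = ell2_apply (op_apply T (ell2_single j h)) i"
proof -
  have add: "ell2_single j (h + k) = ell2_single j h + ell2_single j k" for h k :: 'b
    by (rule ell2_eqI) (simp add: ell2_single.rep_eq plus_ell2.rep_eq)
  have scale: "ell2_single j (a *\<^sub>C h) = a *\<^sub>C ell2_single j h" for a and h :: 'b
    by (rule ell2_eqI) (simp add: ell2_single.rep_eq scaleC_ell2.rep_eq complex_vector.scale_zero_right)
  have "bounded_clinear (\<lambda>h. ell2_apply (op_apply T (ell2_single j h)) i)"
  proof (rule bounded_clinearI)
    fix h
    have "norm (op_apply T (ell2_single j h)) \<le> norm T * norm h"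
      by (rule order_trans[OF norm_op_apply_le mult_left_mono[OF norm_ell2_single]]) simp
    then show "norm (ell2_apply (op_apply T (ell2_single j h)) i) \<le> norm h * norm T"
      using norm_ell2_apply_le[of "op_apply T (ell2_single j h)" i] by (simp add: mult.commute)
  qed (simp_all add: add scale op_apply_add op_apply_scaleC plus_ell2.rep_eq scaleC_ell2.rep_eq)
  then show ?thesis
    by (simp add: block_op_def Abs_bounded_op_inverse)
qed

lemma translation_apply:
  fixes \<xi> :: "('a::group_add, 'b::complex_hilbert_space) ell2"
  shows "ell2_apply (op_apply (translation s) \<xi>) t = ell2_apply \<xi> (- s + t)"
proof -
  have bound: "L2_set (\<lambda>t. norm (ell2_apply \<xi> (- s + t))) F \<le> norm \<xi>"
    if "finite F" for F and \<xi> :: "('a, 'b) ell2"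
  proof -
    have "(\<Sum>t\<in>F. (norm (ell2_apply \<xi> (- s + t)))\<^sup>2) =
        (\<Sum>u\<in>(+) (- s) ` F. (norm (ell2_apply \<xi> u))\<^sup>2)"
      by (subst sum.reindex) (auto simp: inj_on_def)
    then show ?thesis
      using L2_set_le_norm_ell2[of "(+) (- s) ` F" \<xi>] that by (simp add: L2_set_def)
  qed
  have Abs: "ell2_apply (Abs_ell2 (\<lambda>t. ell2_apply \<xi> (- s + t))) = (\<lambda>t. ell2_apply \<xi> (- s + t))"
    for \<xi> :: "('a, 'b) ell2"
    using ell2_iff_bounded(1)[OF bound] by (simp add: Abs_ell2_inverse)
  have "bounded_clinear (\<lambda>\<xi>::('a, 'b) ell2. Abs_ell2 (\<lambda>t. ell2_apply \<xi> (- s + t)))"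
  proof (rule bounded_clinearI)
    fix \<xi> \<eta> :: "('a, 'b) ell2" and a
    show "Abs_ell2 (\<lambda>t. ell2_apply (\<xi> + \<eta>) (- s + t)) =
        Abs_ell2 (\<lambda>t. ell2_apply \<xi> (- s + t)) + Abs_ell2 (\<lambda>t. ell2_apply \<eta> (- s + t))"
      by (rule ell2_eqI, simp only: Abs) (simp add: Abs plus_ell2.rep_eq)
    show "Abs_ell2 (\<lambda>t. ell2_apply (a *\<^sub>C \<xi>) (- s + t)) =
        a *\<^sub>C Abs_ell2 (\<lambda>t. ell2_apply \<xi> (- s + t))"
      by (rule ell2_eqI, simp only: Abs) (simp add: Abs scaleC_ell2.rep_eq)
    show "norm (Abs_ell2 (\<lambda>t. ell2_apply \<xi> (- s + t))) \<le> norm \<xi> * 1"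
      using bound by (intro norm_ell2_le) (simp add: Abs)
  qed
  then show ?thesis
    by (simp add: translation_def Abs_bounded_op_inverse Abs)
qed

lemma block_op_diag_op: "bounded (range D) \<Longrightarrow> block_op i i (diag_op D) = D i"
  by (rule op_eqI) (simp add: block_op_apply diag_op_apply ell2_single.rep_eq)

section \<open>Group actions and reduced crossed products\<close>

definition group_action :: "('g::group_add \<Rightarrow> 'a \<Rightarrow> 'a) \<Rightarrow> bool"
  where "group_action \<alpha> \<longleftrightarrow> \<alpha> 0 = id \<and> (\<forall>s t. \<alpha> (s + t) = \<alpha> s \<circ> \<alpha> t)"

definition compact_space_action :: "('g::group_add \<Rightarrow> 'x::t2_space \<Rightarrow> 'x) \<Rightarrow> bool"
  where "compact_space_action \<tau> \<longleftrightarrow>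
    compact (UNIV :: 'x set) \<and> group_action \<tau> \<and> (\<forall>s. continuous_on UNIV (\<tau> s))"

definition cstar_action :: "('g::group_add \<Rightarrow> 'b::cstar_algebra \<Rightarrow> 'b) \<Rightarrow> bool"
  where "cstar_action \<beta> \<longleftrightarrow> group_action \<beta> \<and> (\<forall>s. star_hom (\<beta> s))"

definition action_kernel :: "('g \<Rightarrow> 'b \<Rightarrow> 'b) \<Rightarrow> 'g set"
  where "action_kernel \<beta> = {s. \<forall>b. \<beta> s b = b}"

definition minimal_on :: "'g set \<Rightarrow> ('g \<Rightarrow> 'x::topological_space \<Rightarrow> 'x) \<Rightarrow> bool"
  where "minimal_on H \<tau> \<longleftrightarrow> (\<forall>x. closure {\<tau> s x | s. s \<in> H} = UNIV)"

text \<open>\<open>C(X)\<close> as a set of functions, and the induced action \<open>(s f)(x) = f(s\<inverse>x)\<close> on it.\<close>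

definition cont_funs :: "('x::topological_space \<Rightarrow> complex) set"
  where "cont_funs = {f. continuous_on UNIV f}"

definition fun_action :: "('g::group_add \<Rightarrow> 'x \<Rightarrow> 'x) \<Rightarrow> 'g \<Rightarrow> ('x \<Rightarrow> complex) \<Rightarrow> 'x \<Rightarrow> complex"
  where "fun_action \<tau> s f = f \<circ> \<tau> (- s)"

text \<open>Let a C*-algebra with carrier \<open>C\<close> and action \<open>\<alpha>\<close> be represented faithfully by \<open>\<rho>\<close> on a
  Hilbert space \<open>H\<close>. The regular representation on \<open>\<ell>\<^sup>2(\<Gamma>, H)\<close> is
  \<open>(\<pi>(c)\<xi>)(t) = \<rho>(\<alpha>\<^bsub>t\<inverse>\<^esub>(c)) \<xi>(t)\<close>, and the reduced crossed product is the
  closed span of the operators \<open>\<pi>(c) \<lambda>(s)\<close>. As an abstract C*-algebra it does not depend on \<open>\<rho>\<close>.\<close>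

definition regular_rep ::
    "('c \<Rightarrow> 'h::complex_hilbert_space bounded_op) \<Rightarrow> ('g::group_add \<Rightarrow> 'c \<Rightarrow> 'c) \<Rightarrow> 'c \<Rightarrow>
      ('g, 'h) ell2 bounded_op"
  where "regular_rep \<rho> \<alpha> c = diag_op (\<lambda>t. \<rho> (\<alpha> (- t) c))"

definition reduced_crossed_product ::
    "('c \<Rightarrow> 'h::complex_hilbert_space bounded_op) \<Rightarrow> ('g::group_add \<Rightarrow> 'c \<Rightarrow> 'c) \<Rightarrow> 'c set \<Rightarrow>
      ('g, 'h) ell2 bounded_op set"
  where "reduced_crossed_product \<rho> \<alpha> C =
    closure (cspan {regular_rep \<rho> \<alpha> c * translation s | c s. c \<in> C})"

text \<open>The canonical conditional expectation, compression to the block diagonal; it takes values in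
  the copy \<open>regular_rep \<rho> \<alpha> ` C\<close> of the coefficient algebra.\<close>

definition conditional_expectation ::
    "('g, 'h::complex_hilbert_space) ell2 bounded_op \<Rightarrow> ('g, 'h) ell2 bounded_op"
  where "conditional_expectation T = diag_op (\<lambda>t. block_op t t T)"

lemma conditional_expectation_regular_rep:
  fixes \<rho> :: "'c \<Rightarrow> 'h::complex_hilbert_space bounded_op" and \<alpha> :: "'g::group_add \<Rightarrow> 'c \<Rightarrow> 'c"
  assumes "bounded (range (\<lambda>t. \<rho> (\<alpha> (- t) c)))"
  shows "conditional_expectation (regular_rep \<rho> \<alpha> c * translation s) =
    (if s = 0 then regular_rep \<rho> \<alpha> c else 0)"
proof -
  have "block_op t t (regular_rep \<rho> \<alpha> c * translation s) = (if s = 0 then \<rho> (\<alpha> (- t) c) else 0)"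
    for t
  proof (rule op_eqI)
    fix h
    have "- s + t = t \<longleftrightarrow> s = 0"
      by (metis add.left_neutral add_right_cancel neg_equal_0_iff_equal)
    then show "op_apply (block_op t t (regular_rep \<rho> \<alpha> c * translation s)) h =
        op_apply (if s = 0 then \<rho> (\<alpha> (- t) c) else 0) h"
      using op_apply_scaleC[of "\<rho> (\<alpha> (- t) c)" 0 0]
      by (simp add: block_op_apply regular_rep_def times_bounded_op.rep_eq diag_op_apply[OF assms]
          translation_apply ell2_single.rep_eq zero_bounded_op.rep_eq
          complex_vector.scale_zero_left)
  qed
  moreover have "diag_op (\<lambda>_::'g. 0 :: 'h bounded_op) = 0"
    by (intro op_eqI ell2_eqI)
      (simp add: diag_op_apply zero_bounded_op.rep_eq zero_ell2.rep_eq)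
  ultimately show ?thesis
    by (simp add: conditional_expectation_def regular_rep_def)
qed

section \<open>The minimal tensor product with the diagonal action\<close>

text \<open>Since a *-homomorphism of C*-algebras is injective iff it is isometric, these are the faithful
  unital representations.\<close>

definition faithful_rep ::
    "('b::{cstar_algebra, real_normed_algebra_1} \<Rightarrow> 'k::complex_hilbert_space bounded_op) \<Rightarrow> bool"
  where "faithful_rep \<sigma> \<longleftrightarrow> star_hom \<sigma> \<and> \<sigma> 1 = 1 \<and> (\<forall>b. norm (\<sigma> b) = norm b)"

text \<open>\<open>C(X)\<close> acts faithfully on \<open>\<ell>\<^sup>2(X)\<close> by multiplication operators, and
  \<open>\<ell>\<^sup>2(X) \<otimes> K = \<ell>\<^sup>2(X, K)\<close>; the following is the operator \<open>f \<otimes> T\<close> on that space.\<close>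

definition tensor_op ::
    "('x \<Rightarrow> complex) \<Rightarrow> 'k::complex_hilbert_space bounded_op \<Rightarrow> ('x, 'k) ell2 bounded_op"
  where "tensor_op f T = diag_op (\<lambda>x. f x *\<^sub>C T)"

abbreviation mult_op :: "('x \<Rightarrow> complex) \<Rightarrow> ('x, complex) ell2 bounded_op"
  where "mult_op f \<equiv> tensor_op f 1"

text \<open>The spatial tensor product of \<open>C(X)\<close> with the subalgebra \<open>S\<close> of the represented algebra.\<close>

definition min_tensor ::
    "('b \<Rightarrow> 'k::complex_hilbert_space bounded_op) \<Rightarrow> 'b set \<Rightarrow> ('x::topological_space, 'k) ell2 bounded_op set"
  where "min_tensor \<sigma> S = closure (cspan {tensor_op f (\<sigma> b) | f b. f \<in> cont_funs \<and> b \<in> S})"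

text \<open>Every operator in the tensor product is block diagonal with blocks in the range of \<open>\<sigma>\<close>; the
  diagonal action moves the blocks along \<open>X\<close> and applies \<open>\<beta>\<close> to each of them.\<close>

definition diagonal_action ::
    "('g::group_add \<Rightarrow> 'x \<Rightarrow> 'x) \<Rightarrow> ('g \<Rightarrow> 'b \<Rightarrow> 'b) \<Rightarrow> ('b \<Rightarrow> 'k::complex_hilbert_space bounded_op) \<Rightarrow>
      'g \<Rightarrow> ('x, 'k) ell2 bounded_op \<Rightarrow> ('x, 'k) ell2 bounded_op"
  where "diagonal_action \<tau> \<beta> \<sigma> s T =
    diag_op (\<lambda>x. \<sigma> (\<beta> s (inv \<sigma> (block_op (\<tau> (- s) x) (\<tau> (- s) x) T))))"

lemma diagonal_action_tensor_op:
  assumes "compact_space_action \<tau>" "cstar_action \<beta>" "faithful_rep \<sigma>" "f \<in> cont_funs"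
  shows "diagonal_action \<tau> \<beta> \<sigma> s (tensor_op f (\<sigma> b)) = tensor_op (fun_action \<tau> s f) (\<sigma> (\<beta> s b))"
proof -
  have hom: "star_hom \<sigma>" "star_hom (\<beta> s)"
    using assms by (auto simp: faithful_rep_def cstar_action_def)
  have "\<sigma> x = \<sigma> y \<Longrightarrow> x = y" for x y
  proof -
    assume "\<sigma> x = \<sigma> y"
    moreover have "\<sigma> (x - y + y) = \<sigma> (x - y) + \<sigma> y"
      using hom(1) unfolding star_hom_def by blast
    ultimately have "\<sigma> (x - y) = 0"
      by simp
    then show "x = y"
      using assms(3) by (metis faithful_rep_def norm_eq_zero right_minus_eq)
  qed
  then have "inj \<sigma>"
    by (rule injI)
  have "bounded (range f)"
    using assms(1,4) unfolding compact_space_action_def cont_funs_def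
    by (auto intro: compact_imp_bounded compact_continuous_image)
  then obtain K where "\<And>x. cmod (f x) \<le> K"
    unfolding bounded_iff by auto
  then have "norm (f x *\<^sub>C \<sigma> b) \<le> K * norm (\<sigma> b)" for x
    by (simp add: norm_scaleC mult_right_mono)
  then have "bounded (range (\<lambda>x. f x *\<^sub>C \<sigma> b))"
    unfolding bounded_iff by auto
  then have block: "block_op x x (tensor_op f (\<sigma> b)) = \<sigma> (f x *\<^sub>C b)" for x
    using hom by (simp add: tensor_op_def block_op_diag_op star_hom_def)
  show ?thesis
    unfolding diagonal_action_def block inv_f_f[OF \<open>inj \<sigma>\<close>]
    using hom by (simp add: tensor_op_def fun_action_def star_hom_def)
qed

section \<open>Plump subgroups\<close>

definition plump :: "('g::group_add \<Rightarrow> 'x::t2_space \<Rightarrow> 'x) \<Rightarrow> 'g set \<Rightarrow> bool"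
  where "plump \<tau> H \<longleftrightarrow>
    (\<forall>\<epsilon>>0. \<forall>a \<in> reduced_crossed_product mult_op (fun_action \<tau>) cont_funs.
      \<exists>(m::nat) (s :: nat \<Rightarrow> 'g) (g :: nat \<Rightarrow> 'x \<Rightarrow> real).
        (\<forall>j<m. s j \<in> H \<and> continuous_on UNIV (g j) \<and> (\<forall>x. 0 \<le> g j x)) \<and>
        (\<forall>x. (\<Sum>j<m. (g j x)\<^sup>2) = 1) \<and>
        (let G = \<lambda>j. regular_rep mult_op (fun_action \<tau>) (\<lambda>x. complex_of_real (g j x)) in
          norm ((\<Sum>j<m. G j * translation (s j) * a * star (translation (s j)) * G j)
            - conditional_expectation a) < \<epsilon>))"

section \<open>The approximation property of Haagerup and Kraus\<close>

definition coefficient :: "('g::group_add, complex) ell2 \<Rightarrow> ('g, complex) ell2 \<Rightarrow> 'g \<Rightarrow> complex"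
  where "coefficient \<xi> \<eta> s = cinner (op_apply (translation s) \<xi>) \<eta>"

definition fourier_algebra :: "('g::group_add \<Rightarrow> complex) set"
  where "fourier_algebra = {coefficient \<xi> \<eta> | \<xi> \<eta>. True}"

text \<open>The group von Neumann algebra, as the bicommutant of the left regular representation.\<close>

definition group_vn :: "('g::group_add, complex) ell2 bounded_op set"
  where "group_vn = {T. \<forall>S. (\<forall>s. S * translation s = translation s * S) \<longrightarrow> T * S = S * T}"

text \<open>The norm of the \<open>n \<times> n\<close> operator matrix \<open>x\<close>, acting on \<open>H\<^sup>n\<close>.\<close>

definition matrix_norm :: "nat \<Rightarrow> (nat \<Rightarrow> nat \<Rightarrow> 'h::complex_hilbert_space bounded_op) \<Rightarrow> real"
  where "matrix_norm n x =
    (SUP \<xi> \<in> {\<xi>. L2_set (\<lambda>j. norm (\<xi> j)) {..<n} \<le> 1}.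
      L2_set (\<lambda>i. norm (\<Sum>j<n. op_apply (x i j) (\<xi> j))) {..<n})"

text \<open>\<open>M\<close> is the transpose of multiplication by \<open>u\<close> on the Fourier algebra, where \<open>T\<close> in the group
  von Neumann algebra pairs with \<open>coefficient \<xi> \<eta>\<close> to \<open>cinner (op_apply T \<xi>) \<eta>\<close>.\<close>

definition multiplier_transpose ::
    "('g::group_add \<Rightarrow> complex) \<Rightarrow>
      (('g, complex) ell2 bounded_op \<Rightarrow> ('g, complex) ell2 bounded_op) \<Rightarrow> bool"
  where "multiplier_transpose u M \<longleftrightarrow> (\<forall>T\<in>group_vn. M T \<in> group_vn \<and>
    (\<forall>\<xi> \<eta> \<xi>' \<eta>'. (\<forall>s. u s * coefficient \<xi> \<eta> s = coefficient \<xi>' \<eta>' s) \<longrightarrow>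
      cinner (op_apply (M T) \<xi>) \<eta> = cinner (op_apply T \<xi>') \<eta>'))"

definition cb_multiplier_bound :: "('g::group_add \<Rightarrow> complex) \<Rightarrow> real \<Rightarrow> bool"
  where "cb_multiplier_bound u K \<longleftrightarrow> 0 \<le> K \<and>
    (\<forall>v\<in>fourier_algebra. (\<lambda>s. u s * v s) \<in> fourier_algebra) \<and>
    (\<exists>M. multiplier_transpose u M \<and>
      (\<forall>n x. (\<forall>i<n. \<forall>j<n. x i j \<in> group_vn) \<longrightarrow>
        matrix_norm n (\<lambda>i j. M (x i j)) \<le> K * matrix_norm n x))"

text \<open>The completely bounded multipliers \<open>M\<^sub>0A(\<Gamma>)\<close> with their norm.\<close>

definition cb_multipliers :: "('g::group_add \<Rightarrow> complex) set"
  where "cb_multipliers = {u. \<exists>K. cb_multiplier_bound u K}"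

definition cb_multiplier_norm :: "('g::group_add \<Rightarrow> complex) \<Rightarrow> real"
  where "cb_multiplier_norm u = Inf {K. cb_multiplier_bound u K}"

text \<open>The predual \<open>Q(\<Gamma>)\<close>: the functionals on \<open>M\<^sub>0A(\<Gamma>)\<close> in the norm closure of
  \<open>\<ell>\<^sup>1(\<Gamma>)\<close>. Their values outside \<open>M\<^sub>0A(\<Gamma>)\<close> are irrelevant.\<close>

definition cb_multiplier_predual :: "(('g::group_add \<Rightarrow> complex) \<Rightarrow> complex) set"
  where "cb_multiplier_predual = {q. \<forall>\<epsilon>>0. \<exists>f. (\<lambda>s. norm (f s)) summable_on UNIV \<and>
    (\<forall>u\<in>cb_multipliers. cmod (q u - (\<Sum>\<^sub>\<infinity>s. f s * u s)) \<le> \<epsilon> * cb_multiplier_norm u)}"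

text \<open>A net in the Fourier algebra is rendered as a proper filter with the Fourier algebra as a member.\<close>

definition approximation_property :: "'g::group_add itself \<Rightarrow> bool"
  where "approximation_property _ \<longleftrightarrow>
    (\<exists>F :: ('g \<Rightarrow> complex) filter. F \<noteq> bot \<and> (\<forall>\<^sub>F u in F. u \<in> fourier_algebra) \<and>
      (\<forall>q\<in>cb_multiplier_predual. (q \<longlongrightarrow> q (\<lambda>_. 1)) F))"

end

theory Submission
  imports Defs
begin

text \<open>Let \<open>E a\<close> be given by \<open>F : X \<rightarrow> B\<close>. Averaging \<open>a\<close> over the kernel \<open>N\<close> with weights
  from a partition of unity, minimality of \<open>N\<close> on \<open>X\<close> moves \<open>E a\<close> close to the constant \<open>F x\<^sub>0\<close>. Constants in
  \<open>B\<close> are fixed by all averages over \<open>N\<close>, while plumpness provides a further average that is small on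
  the remaining Fourier coefficients; the coefficients of the averages of \<open>\<lambda>(s)\<close> are nonnegative
  functions, so that norm estimates in \<open>C(X) \<rtimes> \<Gamma>\<close> carry over to \<open>B\<close>-valued coefficients. Hence
  \<open>1 \<otimes> F x\<^sub>0 \<in> A\<close> for every \<open>x\<^sub>0\<close>, and a partition of unity gives \<open>E a \<in> A\<close>.

  All Fourier coefficients of \<open>a\<close> therefore take values in \<open>B' = {b. 1 \<otimes> b \<in> A}\<close>. If a functional \<open>\<phi>\<close>
  vanishes on the crossed product by \<open>B'\<close>, then \<open>u \<mapsto> \<phi>(M\<^sub>u a)\<close>, with \<open>M\<^sub>u\<close> the Schur multiplier
  of \<open>u(t - r)\<close>, is an element of the predual of the completely bounded multipliers that vanishes on the Fourier algebra,
  and the approximation property forces \<open>\<phi> a = 0\<close>.\<close>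

section \<open>Separation by functionals\<close>

text \<open>Plumpness controls averages only inside the crossed product of \<open>C(X)\<close>,
  while elements of \<open>A\<close> have coefficients in \<open>B\<close>. The way out is to pass
  to a finite sum of terms \<open>Pop (H r) * translation r\<close>: the scalar element that sums
  \<open>translation r\<close> over the support without \<open>0\<close> then serves as test element
  for plumpness, whatever the coefficients are. The order of the two averages matters. Averages over
  the kernel act on a coefficient function by moving points of \<open>X\<close> only, so they fix
  constants but not general functions; the expectation has to be nearly constant before plumpness is
  used. Every average is contractive, so approximation errors only add up.

  In the second half, the Fourier series of \<open>a\<close> need not converge in norm, so that its
  components alone do not recover \<open>a\<close>. Completely bounded norms are defined through the
  group von Neumann algebra and have to be turned into Schur bounds for operator matrices with
  blocks on any Hilbert space before they apply to the crossed product.\<close>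

definition sublinear :: "('a::real_vector \<Rightarrow> real) \<Rightarrow> bool"
  where "sublinear p \<longleftrightarrow> (\<forall>x y. p (x + y) \<le> p x + p y) \<and> (\<forall>r x. 0 \<le> r \<longrightarrow> p (r *\<^sub>R x) = r * p x)"

lemma sublinear_add: "sublinear p \<Longrightarrow> p (x + y) \<le> p x + p y"
  by (simp add: sublinear_def)

lemma sublinear_scaleR: "sublinear p \<Longrightarrow> 0 \<le> r \<Longrightarrow> p (r *\<^sub>R x) = r * p x"
  by (simp add: sublinear_def)

lemma sublinear_zero: "sublinear p \<Longrightarrow> p 0 = 0"
  using sublinear_scaleR[of p 0 0] by simp

lemma sublinear_minus: "sublinear p \<Longrightarrow> - p (- x) \<le> p x"
  using sublinear_add[of p x "- x"] sublinear_zero[of p] by simp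

text \<open>The inequality for positive \<open>r\<close>, applied also to \<open>inverse r\<close>,
  already gives equality.\<close>

lemma sublinearI:
  assumes add: "\<And>x y. p (x + y) \<le> p x + p y" and zero: "p 0 = 0"
    and scale: "\<And>r x. 0 < r \<Longrightarrow> p (r *\<^sub>R x) \<le> r * p x"
  shows "sublinear p"
proof -
  have "p (r *\<^sub>R x) = r * p x" if "0 \<le> r" for r x
  proof (cases "r = 0")
    case False
    then have r: "0 < r" using that by simp
    have "p (inverse r *\<^sub>R r *\<^sub>R x) \<le> inverse r * p (r *\<^sub>R x)"
      by (rule scale) (use r in simp)
    then have "r * p x \<le> p (r *\<^sub>R x)"
      using r by (simp add: field_simps)
    then show ?thesis
      using scale[OF r, of x] by simp
  qed (simp add: zero)
  then show ?thesis
    using add by (simp add: sublinear_def)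
qed

text \<open>The sublinear functional obtained by forcing linearity in the direction \<open>y\<close>; a minimal
  sublinear functional is unchanged by it and hence linear.\<close>

definition linearize_at :: "'a::real_vector \<Rightarrow> ('a \<Rightarrow> real) \<Rightarrow> 'a \<Rightarrow> real"
  where "linearize_at y p x = (INF t\<in>{0..}. p (x + t *\<^sub>R y) - t * p y)"

context
  fixes p :: "'a::real_vector \<Rightarrow> real"
  assumes p: "sublinear p"
begin

lemma linearize_at_lower: "0 \<le> t \<Longrightarrow> linearize_at y p x \<le> p (x + t *\<^sub>R y) - t * p y"
  unfolding linearize_at_def
proof (rule cINF_lower)
  \<comment> \<open>Subadditivity on \<open>t *\<^sub>R y = - x + (x + t *\<^sub>R y)\<close> bounds
    the infimum from below.\<close>
  have "- p (- x) \<le> p (x + t *\<^sub>R y) - t * p y" if "0 \<le> t" for t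
    using sublinear_add[OF p, of "- x" "x + t *\<^sub>R y"] sublinear_scaleR[OF p that, of y] by simp
  then show "bdd_below ((\<lambda>t. p (x + t *\<^sub>R y) - t * p y) ` {0..})"
    by (intro bdd_belowI2[of _ "- p (- x)"]) auto
qed simp

lemma linearize_at_greatest:
  "(\<And>t. 0 \<le> t \<Longrightarrow> c \<le> p (x + t *\<^sub>R y) - t * p y) \<Longrightarrow> c \<le> linearize_at y p x"
  unfolding linearize_at_def by (rule cINF_greatest) auto

lemma linearize_at_le: "linearize_at y p x \<le> p x"
  using linearize_at_lower[of 0] by simp

text \<open>Parameters add: \<open>t\<close> for \<open>x\<close> and \<open>s\<close> for
  \<open>x'\<close> give \<open>t + s\<close> for \<open>x + x'\<close>. Scaling \<open>x\<close> by
  \<open>r\<close> scales the parameter by \<open>r\<close>.\<close>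

lemma sublinear_linearize_at: "sublinear (linearize_at y p)"
proof (rule sublinearI)
  fix x x'
  have "linearize_at y p (x + x') \<le> (p (x + t *\<^sub>R y) - t * p y) + (p (x' + s *\<^sub>R y) - s * p y)"
    if "0 \<le> t" "0 \<le> s" for t s
  proof -
    have "linearize_at y p (x + x') \<le> p (x + x' + (t + s) *\<^sub>R y) - (t + s) * p y"
      by (rule linearize_at_lower) (use that in simp)
    also have "p (x + x' + (t + s) *\<^sub>R y) \<le> p (x + t *\<^sub>R y) + p (x' + s *\<^sub>R y)"
      using sublinear_add[OF p, of "x + t *\<^sub>R y" "x' + s *\<^sub>R y"] by (simp add: algebra_simps)
    finally show ?thesis
      by (simp add: algebra_simps)
  qed
  then have "linearize_at y p (x + x') - (p (x + t *\<^sub>R y) - t * p y) \<le> linearize_at y p x'"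
    if "0 \<le> t" for t
    using that by (intro linearize_at_greatest) (simp add: diff_le_eq add.commute)
  then have "linearize_at y p (x + x') - linearize_at y p x' \<le> linearize_at y p x"
    using linearize_at_greatest[of "linearize_at y p (x + x') - linearize_at y p x'" x y]
    by (auto simp: algebra_simps)
  then show "linearize_at y p (x + x') \<le> linearize_at y p x + linearize_at y p x'"
    by simp
next
  have "0 \<le> linearize_at y p 0"
    by (rule linearize_at_greatest) (simp add: sublinear_scaleR[OF p])
  then show "linearize_at y p 0 = 0"
    using linearize_at_le[of y 0] by (simp add: sublinear_zero[OF p])
next
  fix r :: real and x
  assume r: "0 < r"
  have "inverse r * linearize_at y p (r *\<^sub>R x) \<le> p (x + t *\<^sub>R y) - t * p y" if "0 \<le> t" for t
  proof -
    have "linearize_at y p (r *\<^sub>R x) \<le> p (r *\<^sub>R x + (r * t) *\<^sub>R y) - (r * t) * p y"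
      by (rule linearize_at_lower) (use r that in simp)
    also have "p (r *\<^sub>R x + (r * t) *\<^sub>R y) = r * p (x + t *\<^sub>R y)"
      using sublinear_scaleR[OF p, of r "x + t *\<^sub>R y"] r by (simp add: algebra_simps)
    finally show ?thesis
      using r by (simp add: field_simps)
  qed
  then have "inverse r * linearize_at y p (r *\<^sub>R x) \<le> linearize_at y p x"
    by (rule linearize_at_greatest)
  then show "linearize_at y p (r *\<^sub>R x) \<le> r * linearize_at y p x"
    using r by (simp add: field_simps)
qed

text \<open>Minimality identifies \<open>linearize_at y p\<close> with \<open>p\<close>, and the
  parameter \<open>t = 1\<close> in its infimum gives
  \<open>p x + p y \<le> p (x + y)\<close>.\<close>

lemma linear_minimal_sublinear:
  assumes min: "\<And>q. sublinear q \<Longrightarrow> (\<And>x. q x \<le> p x) \<Longrightarrow> q = p"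
  shows "linear p"
proof -
  have eq: "linearize_at y p = p" for y
    by (rule min[OF sublinear_linearize_at linearize_at_le])
  have add: "p (x + y) = p x + p y" for x y
    using linearize_at_lower[of 1 y x] sublinear_add[OF p, of x y] by (simp add: eq)
  have minus: "p (- x) = - p x" for x
    using add[of x "- x"] sublinear_zero[OF p] by simp
  show ?thesis
  proof
    show "p (r *\<^sub>R x) = r *\<^sub>R p x" for r x
      using sublinear_scaleR[OF p, of r x] sublinear_scaleR[OF p, of "- r" x] minus[of "r *\<^sub>R x"]
      by (cases "0 \<le> r") auto
  qed (rule add)
qed

text \<open>Zorn's lemma is applied to sublinear functionals below \<open>p\<close> instead of
  partial linear extensions. It yields maximal elements, so \<open>R m q\<close> says that
  \<open>q\<close> lies below \<open>m\<close>, and a chain is bounded by its pointwise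
  infimum.\<close>

lemma minimal_sublinear_exists:
  "\<exists>m. sublinear m \<and> (\<forall>x. m x \<le> p x) \<and> (\<forall>q. sublinear q \<longrightarrow> (\<forall>x. q x \<le> m x) \<longrightarrow> q = m)"
proof -
  define A where "A = {q. sublinear q \<and> (\<forall>x. q x \<le> p x)}"
  define R where "R m q \<longleftrightarrow> (\<forall>x. (q x :: real) \<le> m x)" for m q :: "'a \<Rightarrow> real"
  have "\<exists>m\<in>A. \<forall>q\<in>A. R m q \<longrightarrow> q = m"
  proof (rule predicate_Zorn)
    show "partial_order_on A (relation_of R A)"
      by (rule partial_order_on_relation_ofI) (auto simp: R_def fun_eq_iff intro: order_trans antisym)
    fix C
    assume C: "C \<in> Chains (relation_of R A)"
    have CA: "C \<subseteq> A"
      by (rule Chains_relation_of[OF C])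
    have ch: "R q r \<or> R r q" if "q \<in> C" "r \<in> C" for q r
      using C that unfolding Chains_def relation_of_def by auto
    show "\<exists>u\<in>A. \<forall>a\<in>C. R a u"
    proof (cases "C = {}")
      case True
      then show ?thesis
        using p by (auto simp: A_def)
    next
      case False
      define u where "u x = (INF q\<in>C. q x)" for x
      have low: "- p (- x) \<le> q x" if "q \<in> C" for q x
      proof -
        have "sublinear q" "q (- x) \<le> p (- x)"
          using CA that by (auto simp: A_def)
        then show ?thesis
          using sublinear_minus[of q x] by linarith
      qed
      have bdd: "bdd_below ((\<lambda>q. q x) ` C)" for x
        by (rule bdd_belowI2[of _ "- p (- x)"]) (rule low)
      have u_le: "u x \<le> q x" if "q \<in> C" for q x
        unfolding u_def by (rule cINF_lower[OF bdd that])
      have u_ge: "c \<le> u x" if "\<And>q. q \<in> C \<Longrightarrow> c \<le> q x" for c x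
        unfolding u_def by (rule cINF_greatest[OF False that])
      have sub: "sublinear q" if "q \<in> C" for q
        using that CA by (auto simp: A_def)
      have "sublinear u"
      proof (rule sublinearI)
        fix x y
        \<comment> \<open>Totality of the chain enters here: the smaller of \<open>q\<close> and
          \<open>r\<close> bounds both terms at once.\<close>
        have 1: "u (x + y) \<le> q x + r y" if qr: "q \<in> C" "r \<in> C" for q r
        proof -
          obtain z where z: "z \<in> C" "z x \<le> q x" "z y \<le> r y"
            using ch[OF qr] qr by (auto simp: R_def)
          then show ?thesis
            using u_le[OF z(1), of "x + y"] sublinear_add[OF sub[OF z(1)], of x y] by linarith
        qed
        then have "u (x + y) - q x \<le> u y" if "q \<in> C" for q
          using that by (intro u_ge) (metis add.commute diff_le_eq)
        then have "u (x + y) - u y \<le> u x"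
          by (intro u_ge) (metis add.commute diff_le_eq)
        then show "u (x + y) \<le> u x + u y"
          by simp
      next
        show "u 0 = 0"
          using False sub by (simp add: u_def sublinear_zero cong: INF_cong_simp)
      next
        fix r :: real and x
        assume r: "0 < r"
        have "inverse r * u (r *\<^sub>R x) \<le> u x"
          using r u_le[of _ "r *\<^sub>R x"]
          by (intro u_ge) (auto simp: field_simps sublinear_scaleR[OF sub])
        then show "u (r *\<^sub>R x) \<le> r * u x"
          using r by (simp add: field_simps)
      qed
      moreover have "u x \<le> p x" for x
      proof -
        obtain q where "q \<in> C"
          using False by blast
        moreover have "q x \<le> p x"
          using \<open>q \<in> C\<close> CA by (auto simp: A_def)
        ultimately show ?thesis
          using u_le[of q x] by linarith
      qed
      ultimately show ?thesis
        using u_le by (auto simp: A_def R_def)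
    qed
  qed
  then obtain m where m: "m \<in> A" "\<And>q. q \<in> A \<Longrightarrow> R m q \<Longrightarrow> q = m"
    by blast
  have "q = m" if "sublinear q" "\<forall>x. q x \<le> m x" for q
    using m that by (intro m(2)) (auto simp: A_def R_def intro: order_trans)
  then show ?thesis
    using m(1) by (auto simp: A_def)
qed

end

text \<open>The minimal functional is taken below \<open>linearize_at a p\<close>, not merely below
  \<open>p\<close>: the parameter \<open>t = 1\<close> at \<open>- a\<close> yields
  \<open>m (- a) \<le> - p a\<close>, which is the required value at \<open>a\<close>.\<close>

lemma hahn_banach_sublinear:
  assumes p: "sublinear p"
  shows "\<exists>f. linear f \<and> (\<forall>x. f x \<le> p x) \<and> p a \<le> f a"
proof -
  obtain m where m: "sublinear m" "\<And>x. m x \<le> linearize_at a p x"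
    "\<And>q. sublinear q \<Longrightarrow> (\<And>x. q x \<le> m x) \<Longrightarrow> q = m"
    using minimal_sublinear_exists[OF sublinear_linearize_at[OF p]] by metis
  have lin: "linear m"
    by (rule linear_minimal_sublinear[OF m(1) m(3)])
  have "m (- a) \<le> - p a"
    using m(2)[of "- a"] linearize_at_lower[OF p, of 1 a "- a"] by (simp add: sublinear_zero[OF p])
  then have "p a \<le> m a"
    by (simp add: linear_neg[OF lin])
  moreover have "m x \<le> p x" for x
    using m(2)[of x] linearize_at_le[OF p, of a x] by linarith
  ultimately show ?thesis
    using lin by blast
qed

text \<open>The distance to \<open>S\<close> is sublinear, vanishes on \<open>S\<close> and is
  positive at \<open>a\<close> because \<open>S\<close> is closed. The real functional
  \<open>f\<close> below it is the real part of \<open>f x - \<i> f (\<i> x)\<close>, and the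
  imaginary part vanishes on \<open>S\<close> too because \<open>S\<close> is a complex
  subspace.\<close>

lemma complex_functional_separating:
  fixes S :: "'a::complex_normed_vector set"
  assumes S: "csubspace S" "closed S" and a: "a \<notin> S"
  shows "\<exists>\<phi>::'a \<Rightarrow> complex. bounded_clinear \<phi> \<and> (\<forall>x\<in>S. \<phi> x = 0) \<and> \<phi> a \<noteq> 0"
proof -
  have S0: "0 \<in> S" and S_add: "\<And>x y. x \<in> S \<Longrightarrow> y \<in> S \<Longrightarrow> x + y \<in> S"
    and S_scale: "\<And>c x. x \<in> S \<Longrightarrow> c *\<^sub>C x \<in> S"
    using S(1) by (auto simp: complex_vector.subspace_0 complex_vector.subspace_add
        complex_vector.subspace_scale)
  have ne: "S \<noteq> {}"
    using S0 by blast
  define p where "p x = infdist x S" for x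
  have p_le: "p x \<le> norm (x - s)" if "s \<in> S" for x s
    unfolding p_def dist_norm[symmetric] by (rule infdist_le[OF that])
  have p_ge: "c \<le> p x" if "\<And>s. s \<in> S \<Longrightarrow> c \<le> norm (x - s)" for c x
    unfolding p_def infdist_notempty[OF ne] dist_norm by (rule cINF_greatest[OF ne that])
  have p_norm: "p x \<le> norm x" for x
    using p_le[OF S0, of x] by simp
  have "sublinear p"
  proof (rule sublinearI)
    fix x y
    have "p (x + y) \<le> norm (x - s) + norm (y - t)" if "s \<in> S" "t \<in> S" for s t
      using p_le[OF S_add[OF that], of "x + y"] norm_triangle_ineq[of "x - s" "y - t"]
      by (simp add: algebra_simps)
    then have "p (x + y) - norm (x - s) \<le> p y" if "s \<in> S" for s
      using that by (intro p_ge) (simp add: algebra_simps)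
    then have "p (x + y) - p y \<le> p x"
      by (intro p_ge) (simp add: algebra_simps)
    then show "p (x + y) \<le> p x + p y"
      by simp
  next
    show "p 0 = 0"
      unfolding p_def using S0 by simp
  next
    fix r :: real and x
    assume r: "0 < r"
    have "inverse r * p (r *\<^sub>R x) \<le> norm (x - s)" if "s \<in> S" for s
    proof -
      have "p (r *\<^sub>R x) \<le> norm (r *\<^sub>R x - r *\<^sub>R s)"
        by (rule p_le) (use S_scale[OF that, of "complex_of_real r"] in \<open>simp add: scaleC_of_real\<close>)
      also have "\<dots> = r * norm (x - s)"
        using r by (simp add: scaleR_diff_right[symmetric])
      finally show ?thesis
        using r by (simp add: field_simps)
    qed
    then have "inverse r * p (r *\<^sub>R x) \<le> p x"
      by (rule p_ge)
    then show "p (r *\<^sub>R x) \<le> r * p x"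
      using r by (simp add: field_simps)
  qed
  then obtain f where f: "linear f" "\<And>x. f x \<le> p x" "p a \<le> f a"
    using hahn_banach_sublinear[of p a] by blast
  have f_abs: "\<bar>f x\<bar> \<le> norm x" for x
    using f(2)[of x] f(2)[of "- x"] p_norm[of x] p_norm[of "- x"] linear_neg[OF f(1), of x] by simp
  have f_S: "f x = 0" if "x \<in> S" for x
  proof -
    have "p x = 0" "p (- x) = 0"
      using that S_scale[OF that, of "- 1"] unfolding p_def by auto
    then show ?thesis
      using f(2)[of x] f(2)[of "- x"] linear_neg[OF f(1), of x] by simp
  qed
  have "0 < p a"
    unfolding p_def using a S(2) ne by (metis in_closed_iff_infdist_zero infdist_nonneg order_le_less)
  with f(3) have fa: "f a \<noteq> 0"
    by simp
  define \<phi> where "\<phi> x = Complex (f x) (- f (\<i> *\<^sub>C x))" for x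
  have f_add: "f (x + y) = f x + f y" and f_scaleR: "f (r *\<^sub>R x) = r * f x" for x y r
    using f(1) by (auto simp: linear_add linear_scale)
  have f_diff: "f (x - y) = f x - f y" for x y
    by (rule linear_diff[OF f(1)])
  have "bounded_clinear \<phi>"
  proof (rule bounded_clinearI)
    fix x y :: 'a and c
    show "\<phi> (x + y) = \<phi> x + \<phi> y"
      by (simp add: \<phi>_def complex_eq_iff scaleC_add_right f_add)
    have c: "d *\<^sub>C x = Re d *\<^sub>R x + Im d *\<^sub>R \<i> *\<^sub>C x" for d and x :: 'a
      by (subst complex_eq[of d])
        (simp only: scaleC_add_left scaleC_scaleC scaleC_of_real[symmetric] mult.commute[of \<i>])
    show "\<phi> (c *\<^sub>C x) = c *\<^sub>C \<phi> x"
      using arg_cong[OF c[of c], of f] arg_cong[OF c[of "\<i> * c"], of f]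
      by (simp add: \<phi>_def complex_eq_iff scaleC_complex_def scaleC_scaleC f_add f_scaleR f_diff algebra_simps)
    have "cmod (\<phi> x) \<le> \<bar>f x\<bar> + \<bar>f (\<i> *\<^sub>C x)\<bar>"
      using cmod_le[of "\<phi> x"] by (simp add: \<phi>_def)
    then show "cmod (\<phi> x) \<le> norm x * 2"
      using f_abs[of x] f_abs[of "\<i> *\<^sub>C x"] by (simp add: norm_scaleC)
  qed
  moreover have "\<phi> x = 0" if "x \<in> S" for x
    using f_S[OF that] f_S[OF S_scale[OF that, of \<i>]] by (simp add: \<phi>_def complex_eq_iff)
  moreover have "\<phi> a \<noteq> 0"
    using fa by (simp add: \<phi>_def complex_eq_iff)
  ultimately show ?thesis
    by blast
qed

section \<open>Operators on square-summable families\<close>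

lemmas op_apply_simps = plus_bounded_op.rep_eq minus_bounded_op.rep_eq uminus_bounded_op.rep_eq
  zero_bounded_op.rep_eq times_bounded_op.rep_eq one_bounded_op.rep_eq scaleC_bounded_op.rep_eq

lemmas ell2_apply_simps = plus_ell2.rep_eq minus_ell2.rep_eq uminus_ell2.rep_eq zero_ell2.rep_eq
  scaleC_ell2.rep_eq

lemmas scaleC_zero_left [simp] = complex_vector.scale_zero_left
  and scaleC_zero_right [simp] = complex_vector.scale_zero_right
  and scaleC_one [simp] = complex_vector.scale_one

lemma op_apply_zero_right [simp]: "op_apply T 0 = 0"
  using op_apply_scaleC[of T 0 0] by simp

lemma op_apply_diff: "op_apply T (x - y) = op_apply T x - op_apply T y"
  using bounded_linear_op_apply[of T] by (simp add: bounded_linear.linear linear_diff)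

lemma op_apply_sum: "op_apply (\<Sum>i\<in>I. T i) x = (\<Sum>i\<in>I. op_apply (T i) x)"
  by (induction I rule: infinite_finite_induct) (simp_all add: op_apply_simps)

lemma op_apply_sum_right: "op_apply T (\<Sum>i\<in>I. x i) = (\<Sum>i\<in>I. op_apply T (x i))"
  by (induction I rule: infinite_finite_induct) (simp_all add: op_apply_add)

lemma ell2_apply_sum: "ell2_apply (\<Sum>i\<in>I. f i) t = (\<Sum>i\<in>I. ell2_apply (f i) t)"
  by (induction I rule: infinite_finite_induct) (simp_all add: ell2_apply_simps)

lemma cinner_sum_left: "cinner (\<Sum>i\<in>I. f i) y = (\<Sum>i\<in>I. cinner (f i) y)"
  by (induction I rule: infinite_finite_induct) (simp_all add: cinner_add_left)

lemma cinner_sum_right: "cinner y (\<Sum>i\<in>I. f i) = (\<Sum>i\<in>I. cinner y (f i))"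
  by (induction I rule: infinite_finite_induct) (simp_all add: cinner_add_right)

lemma norm_one_op: "norm (1 :: 'h::complex_hilbert_space bounded_op) \<le> 1"
  by (rule norm_op_le) (simp_all add: op_apply_simps)

lemma norm_star: "norm (star x) = norm (x::'a::cstar_algebra)"
proof -
  have le: "norm x \<le> norm (star x)" for x :: 'a
  proof -
    have "norm x * norm x \<le> norm (star x) * norm x"
      using norm_mult_ineq[of "star x" x] by (simp add: cstar_identity power2_eq_square)
    then show ?thesis
      by (cases "norm x = 0") (auto simp: mult_le_cancel_right)
  qed
  show ?thesis
    using le[of x] le[of "star x"] by (simp add: star_star)
qed

lemma star_hom_add: "star_hom \<pi> \<Longrightarrow> \<pi> (x + y) = \<pi> x + \<pi> y"
  and star_hom_scaleC: "star_hom \<pi> \<Longrightarrow> \<pi> (a *\<^sub>C x) = a *\<^sub>C \<pi> x"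
  and star_hom_mult: "star_hom \<pi> \<Longrightarrow> \<pi> (x * y) = \<pi> x * \<pi> y"
  and star_hom_star: "star_hom \<pi> \<Longrightarrow> \<pi> (star x) = star (\<pi> x)"
  by (simp_all add: star_hom_def)

lemma star_hom_zero: "star_hom \<pi> \<Longrightarrow> \<pi> 0 = 0"
  using star_hom_scaleC[of \<pi> 0 0] by simp

lemma star_hom_diff: "star_hom \<pi> \<Longrightarrow> \<pi> (x - y) = \<pi> x - \<pi> y"
  using star_hom_add[of \<pi> "x - y" y] by simp

lemma star_hom_sum: "star_hom \<pi> \<Longrightarrow> \<pi> (\<Sum>i\<in>I. f i) = (\<Sum>i\<in>I. \<pi> (f i))"
  by (induction I rule: infinite_finite_induct) (simp_all add: star_hom_zero star_hom_add)

lemma norm_op_le_cinner: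
  fixes T :: "'h::complex_hilbert_space bounded_op"
  assumes "0 \<le> C" "\<And>x y. cmod (cinner (op_apply T x) y) \<le> C * norm x * norm y"
  shows "norm T \<le> C"
proof (rule norm_op_le[OF assms(1)])
  fix x
  have "norm (op_apply T x) * norm (op_apply T x) = cmod (cinner (op_apply T x) (op_apply T x))"
    unfolding cinner_self norm_of_real by (simp add: power2_eq_square)
  also have "\<dots> \<le> (C * norm x) * norm (op_apply T x)"
    by (rule assms(2))
  finally show "norm (op_apply T x) \<le> C * norm x"
    using assms(1) by (cases "norm (op_apply T x) = 0") (auto simp: mult_le_cancel_right)
qed

text \<open>A row \<open>(V\<^sub>j)\<close> with \<open>\<Sum>V\<^sub>j\<^sup>* V\<^sub>j = 1\<close> is an isometry, so compressing by it is contractive.\<close>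

lemma norm_sum_star_mult_le:
  fixes V :: "'i \<Rightarrow> 'h::complex_hilbert_space bounded_op"
  assumes V: "(\<Sum>j\<in>J. star (V j) * V j) = 1"
  shows "norm (\<Sum>j\<in>J. star (V j) * a * V j) \<le> norm a"
proof (rule norm_op_le_cinner)
  fix x y
  have iso: "L2_set (\<lambda>j. norm (op_apply (V j) x)) J = norm x" for x
  proof -
    have "cinner (op_apply (star (V j)) z) w = cinner z (op_apply (V j) w)" for j z w
      using cinner_star[of "star (V j)" z w] by (simp add: star_star)
    then have "complex_of_real (\<Sum>j\<in>J. (norm (op_apply (V j) x))\<^sup>2) = cinner (op_apply (\<Sum>j\<in>J. star (V j) * V j) x) x"
      by (simp add: op_apply_sum op_apply_simps cinner_sum_left cinner_self del: of_real_power)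
    then have "complex_of_real (\<Sum>j\<in>J. (norm (op_apply (V j) x))\<^sup>2) = complex_of_real ((norm x)\<^sup>2)"
      unfolding V by (simp add: op_apply_simps cinner_self del: of_real_power)
    then have "(\<Sum>j\<in>J. (norm (op_apply (V j) x))\<^sup>2) = (norm x)\<^sup>2"
      by (simp only: of_real_eq_iff)
    then show ?thesis
      by (simp add: L2_set_def)
  qed
  have adj: "cinner (op_apply (star (V j)) z) w = cinner z (op_apply (V j) w)" for j z w
    using cinner_star[of "star (V j)" z w] by (simp add: star_star)
  have "cmod (cinner (op_apply (\<Sum>j\<in>J. star (V j) * a * V j) x) y)
      = cmod (\<Sum>j\<in>J. cinner (op_apply a (op_apply (V j) x)) (op_apply (V j) y))"
    by (simp add: op_apply_sum op_apply_simps cinner_sum_left adj)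
  also have "\<dots> \<le> (\<Sum>j\<in>J. norm a * (\<bar>norm (op_apply (V j) x)\<bar> * \<bar>norm (op_apply (V j) y)\<bar>))"
  proof (rule sum_norm_le)
    fix j
    show "cmod (cinner (op_apply a (op_apply (V j) x)) (op_apply (V j) y))
        \<le> norm a * (\<bar>norm (op_apply (V j) x)\<bar> * \<bar>norm (op_apply (V j) y)\<bar>)"
      using mult_right_mono[OF norm_op_apply_le[of a "op_apply (V j) x"], of "norm (op_apply (V j) y)"]
        norm_cinner_le[of "op_apply a (op_apply (V j) x)" "op_apply (V j) y"]
      by (simp add: mult.assoc)
  qed
  also have "\<dots> = norm a * (\<Sum>j\<in>J. \<bar>norm (op_apply (V j) x)\<bar> * \<bar>norm (op_apply (V j) y)\<bar>)"
    by (rule sum_distrib_left[symmetric])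
  also have "\<dots> \<le> norm a * (norm x * norm y)"
    using L2_set_mult_ineq[of "\<lambda>j. norm (op_apply (V j) x)" "\<lambda>j. norm (op_apply (V j) y)" J]
    by (intro mult_left_mono) (simp_all add: iso)
  finally show "cmod (cinner (op_apply (\<Sum>j\<in>J. star (V j) * a * V j) x) y) \<le> norm a * norm x * norm y"
    by (simp add: mult.assoc)
qed simp

section \<open>Single-coordinate vectors, operator matrices and the translation unitaries\<close>

lemma ell2_single_add: "ell2_single j (h + k) = ell2_single j h + ell2_single j k"
  by (rule ell2_eqI) (simp add: ell2_single.rep_eq plus_ell2.rep_eq)

lemma ell2_single_zero [simp]: "ell2_single j 0 = 0"
  by (rule ell2_eqI) (simp add: ell2_single.rep_eq zero_ell2.rep_eq)

lemma ell2_single_sum: "ell2_single j (\<Sum>i\<in>I. f i) = (\<Sum>i\<in>I. ell2_single j (f i))"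
  by (induction I rule: infinite_finite_induct) (simp_all add: ell2_single_add)

lemma cinner_ell2_single: "cinner \<xi> (ell2_single j h) = cinner (ell2_apply \<xi> j) h"
proof -
  have "((\<lambda>i. cinner (ell2_apply \<xi> i) (ell2_apply (ell2_single j h) i)) has_sum
      (\<Sum>i\<in>{j}. cinner (ell2_apply \<xi> i) (ell2_apply (ell2_single j h) i))) UNIV"
    by (rule has_sum_finite_neutralI[of "{j}"]) (auto simp: ell2_single.rep_eq)
  then show ?thesis
    by (simp add: cinner_ell2_def infsumI ell2_single.rep_eq)
qed

lemma norm_block_op_le: "norm (block_op i j T) \<le> norm T"
proof (rule norm_op_le)
  fix h
  have "norm (op_apply T (ell2_single j h)) \<le> norm T * norm h"
    by (rule order_trans[OF norm_op_apply_le mult_left_mono[OF norm_ell2_single]]) simp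
  then show "norm (op_apply (block_op i j T) h) \<le> norm T * norm h"
    unfolding block_op_apply using norm_ell2_apply_le[of "op_apply T (ell2_single j h)" i] by linarith
qed simp

lemma block_op_add: "block_op i j (S + T) = block_op i j S + block_op i j T"
  and block_op_diff: "block_op i j (S - T) = block_op i j S - block_op i j T"
  and block_op_scaleC: "block_op i j (a *\<^sub>C T) = a *\<^sub>C block_op i j T"
  and block_op_zero [simp]: "block_op i j 0 = 0"
  by (rule op_eqI, simp add: block_op_apply op_apply_simps ell2_apply_simps)+

lemma block_op_sum: "block_op i j (\<Sum>k\<in>I. T k) = (\<Sum>k\<in>I. block_op i j (T k))"
  by (induction I rule: infinite_finite_induct) (simp_all add: block_op_add)

lemma bounded_range_norm: "(\<And>i. norm (D i) \<le> C) \<Longrightarrow> bounded (range D)"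
  unfolding bounded_iff by blast

lemma norm_diag_op_le:
  assumes "\<And>i. norm (D i) \<le> C" "0 \<le> C"
  shows "norm (diag_op D) \<le> C"
proof (rule norm_op_le[OF assms(2)])
  fix \<xi>
  have "norm (op_apply (D i) h) \<le> C * norm h" for i h
    by (rule order_trans[OF norm_op_apply_le mult_right_mono[OF assms(1)]]) simp
  then show "norm (op_apply (diag_op D) \<xi>) \<le> C * norm \<xi>"
    unfolding norm_ell2.rep_eq using ell2_apply[of \<xi>] assms(2)
    by (intro ell2_scaled(2)) (auto simp: diag_op_apply[OF bounded_range_norm[of D, OF assms(1)]])
qed

lemma block_op_diag_op': "bounded (range D) \<Longrightarrow> block_op i j (diag_op D) = (if i = j then D i else 0)"
  by (rule op_eqI) (auto simp: block_op_apply diag_op_apply ell2_single.rep_eq op_apply_simps)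

lemma translation_single:
  "op_apply (translation s) (ell2_single j h) = ell2_single (s + j) (h::'h::complex_hilbert_space)"
proof (rule ell2_eqI)
  fix i
  have "- s + i = j \<longleftrightarrow> i = s + j"
    by (metis add.assoc add.left_inverse add.left_neutral add.right_inverse)
  then show "ell2_apply (op_apply (translation s) (ell2_single j h)) i = ell2_apply (ell2_single (s + j) h) i"
    by (simp add: translation_apply ell2_single.rep_eq)
qed

lemma translation_add: "translation (s + t) = translation s * translation t"
  by (rule op_eqI, rule ell2_eqI) (simp only: translation_apply times_bounded_op.rep_eq minus_add add.assoc)

lemma translation_zero: "translation 0 = 1"
  by (rule op_eqI, rule ell2_eqI) (simp add: translation_apply op_apply_simps)

lemma translation_inverse: "translation (- s) * translation s = 1" "translation s * translation (- s) = 1"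
  by (simp_all add: translation_add[symmetric] translation_zero)

lemma star_translation:
  "star (translation s :: ('g::group_add, 'h::complex_hilbert_space) ell2 bounded_op) = translation (- s)"
proof (rule star_eqI)
  fix \<xi> \<eta> :: "('g, 'h) ell2"
  have "bij_betw (\<lambda>t. s + t) UNIV UNIV"
    by (rule bij_betw_byWitness[of _ "\<lambda>t. - s + t"]) (auto simp: add.assoc[symmetric])
  from infsum_reindex_bij_betw[OF this, of "\<lambda>t. cinner (ell2_apply \<xi> (- s + t)) (ell2_apply \<eta> t)"]
  show "cinner (op_apply (translation s) \<xi>) \<eta> = cinner \<xi> (op_apply (translation (- s)) \<eta>)"
    by (simp add: cinner_ell2_def translation_apply add.assoc[symmetric])
qed

lemma norm_op_isometry:
  assumes "star U * U = (1 :: 'h::complex_hilbert_space bounded_op)"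
  shows "norm (op_apply U x) = norm x"
proof -
  have "complex_of_real ((norm (op_apply U x))\<^sup>2) = cinner x (op_apply (star U * U) x)"
    by (simp only: cinner_self[symmetric] cinner_star[of U] times_bounded_op.rep_eq)
  also have "\<dots> = complex_of_real ((norm x)\<^sup>2)"
    unfolding assms by (simp add: op_apply_simps cinner_self)
  finally show ?thesis
    by (simp only: of_real_eq_iff power2_eq_iff_nonneg norm_ge_zero)
qed

lemma norm_translation_apply: "norm (op_apply (translation s) \<xi>) = norm \<xi>"
  by (rule norm_op_isometry) (simp add: star_translation translation_inverse)

lemma block_op_mult_translation: "block_op i j (T * translation s) = block_op i (s + j) T"
  by (rule op_eqI) (simp add: block_op_apply op_apply_simps translation_single)

lemma bounded_block_op: "bounded (range (\<lambda>i. block_op (f i) (g i) T))"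
  by (rule bounded_range_norm) (rule norm_block_op_le)

section \<open>The conditional expectation as compression to the block diagonal\<close>

lemma conditional_expectation_apply:
  "ell2_apply (op_apply (conditional_expectation T) \<xi>) t = op_apply (block_op t t T) (ell2_apply \<xi> t)"
  unfolding conditional_expectation_def by (rule diag_op_apply[OF bounded_block_op])

lemma conditional_expectation_add:
    "conditional_expectation (S + T) = conditional_expectation S + conditional_expectation T"
  and conditional_expectation_diff:
    "conditional_expectation (S - T) = conditional_expectation S - conditional_expectation T"
  and conditional_expectation_zero: "conditional_expectation 0 = 0"
  by (rule op_eqI, rule ell2_eqI,
      simp add: conditional_expectation_apply block_op_add block_op_diff
        op_apply_simps ell2_apply_simps)+

lemma conditional_expectation_sum:
  "conditional_expectation (\<Sum>i\<in>I. T i) = (\<Sum>i\<in>I. conditional_expectation (T i))"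
  by (induction I rule: infinite_finite_induct)
    (simp_all add: conditional_expectation_add conditional_expectation_zero)

lemma norm_conditional_expectation_le: "norm (conditional_expectation T) \<le> norm T"
  unfolding conditional_expectation_def by (rule norm_diag_op_le) (simp_all add: norm_block_op_le)

lemma block_op_conditional_expectation:
  "block_op i j (conditional_expectation T) = (if i = j then block_op i i T else 0)"
  unfolding conditional_expectation_def by (simp add: block_op_diag_op'[OF bounded_block_op])

lemma csubspace_sum:
  "csubspace S \<Longrightarrow> (\<And>i. i \<in> I \<Longrightarrow> f i \<in> S) \<Longrightarrow> (\<Sum>i\<in>I. f i) \<in> S"
  by (rule complex_vector.subspace_sum)

lemma closed_memI:
  fixes S :: "'a::real_normed_vector set"
  assumes "closed S" "\<And>e. 0 < e \<Longrightarrow> \<exists>y\<in>S. norm (x - y) \<le> e"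
  shows "x \<in> S"
proof -
  have "\<exists>y\<in>S. dist y x < e" if "0 < e" for e
    using assms(2)[of "e / 2"] that by (force simp: dist_norm norm_minus_commute)
  then show ?thesis
    using closed_approachable[OF assms(1)] by blast
qed

lemma closure_normD:
  fixes S :: "'a::real_normed_vector set"
  assumes "x \<in> closure S" "0 < e"
  shows "\<exists>y\<in>S. norm (x - y) < e"
  using assms unfolding closure_approachable by (force simp: dist_norm norm_minus_commute)

section \<open>Schur multipliers\<close>

definition ell2_restrict :: "'i set \<Rightarrow> ('i, 'h::complex_hilbert_space) ell2 \<Rightarrow> ('i, 'h) ell2"
  where "ell2_restrict F \<xi> = (\<Sum>i\<in>F. ell2_single i (ell2_apply \<xi> i))"

lemma ell2_apply_sum_single:
  "finite F \<Longrightarrow> ell2_apply (\<Sum>i\<in>F. ell2_single i (h i)) j = (if j \<in> F then h j else 0)"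
  by (simp add: ell2_apply_sum ell2_single.rep_eq)

lemma norm_sum_single:
  assumes "finite F"
  shows "norm (\<Sum>i\<in>F. ell2_single i (h i)) = L2_set (\<lambda>i. norm (h i)) F"
proof -
  have "((\<lambda>j. (norm (if j \<in> F then h j else 0))\<^sup>2) has_sum
      (\<Sum>j\<in>F. (norm (if j \<in> F then h j else 0))\<^sup>2)) UNIV"
    by (rule has_sum_finite_neutralI[of F]) (use assms in auto)
  then show ?thesis
    by (simp add: norm_ell2.rep_eq ell2_apply_sum_single assms L2_set_def infsumI)
qed

lemma ell2_restrict_apply:
  "finite F \<Longrightarrow> ell2_apply (ell2_restrict F \<xi>) j = (if j \<in> F then ell2_apply \<xi> j else 0)"
  unfolding ell2_restrict_def by (rule ell2_apply_sum_single)

lemma norm_ell2_restrict_le: "finite F \<Longrightarrow> norm (ell2_restrict F \<xi>) \<le> norm \<xi>"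
  by (simp add: ell2_restrict_def norm_sum_single L2_set_le_norm_ell2)

lemma ell2_restrict_approx:
  assumes "0 < e"
  shows "\<exists>F. finite F \<and> norm (\<xi> - ell2_restrict F \<xi>) \<le> e"
proof -
  define f where "f i = (norm (ell2_apply \<xi> i))\<^sup>2" for i
  have f: "f summable_on UNIV"
    using ell2_apply[of \<xi>] by (simp add: f_def[abs_def])
  have "0 < e\<^sup>2"
    using assms by simp
  with infsum_finite_approximation[OF f, of "e\<^sup>2"] obtain F
    where F: "finite F" "dist (sum f F) (infsum f UNIV) \<le> e\<^sup>2"
    by auto
  have "norm (\<xi> - ell2_restrict F \<xi>) \<le> e"
  proof (rule norm_ell2_le)
    fix G :: "'a set"
    assume G: "finite G"
    have "(\<Sum>i\<in>G. (norm (ell2_apply (\<xi> - ell2_restrict F \<xi>) i))\<^sup>2) = (\<Sum>i\<in>G. if i \<in> F then 0 else f i)"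
      by (rule sum.cong) (auto simp: f_def ell2_apply_simps ell2_restrict_apply F)
    also have "\<dots> = sum f (G - F)"
      using G by (simp add: sum.If_cases Diff_eq)
    also have "\<dots> = sum f (F \<union> G) - sum f F"
      using F(1) G sum.union_disjoint[of F "G - F" f] by (simp add: Un_Diff_cancel)
    also have "\<dots> \<le> infsum f UNIV - sum f F"
      using finite_sum_le_infsum[OF f, of "F \<union> G"] F(1) G by (simp add: f_def)
    also have "\<dots> \<le> e\<^sup>2"
      using F(2) by (simp add: dist_real_def abs_le_iff)
    finally show "L2_set (\<lambda>i. norm (ell2_apply (\<xi> - ell2_restrict F \<xi>) i)) G \<le> e"
      unfolding L2_set_def using assms by (intro real_le_lsqrt) (auto intro: sum_nonneg)
  qed
  with F(1) show ?thesis
    by blast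
qed

lemma sum_block_op_cinner:
  "(\<Sum>t\<in>F. \<Sum>r\<in>F. cinner (op_apply (block_op t r x) (\<xi> r)) (\<eta> t)) =
    cinner (op_apply x (\<Sum>r\<in>F. ell2_single r (\<xi> r))) (\<Sum>t\<in>F. ell2_single t (\<eta> t))"
  by (simp add: block_op_apply cinner_sum_left cinner_sum_right op_apply_sum_right ell2_apply_sum cinner_ell2_single)

lemma sum_block_op_cinner_le:
  assumes "finite F"
  shows "cmod (\<Sum>t\<in>F. \<Sum>r\<in>F. cinner (op_apply (block_op t r x) (\<xi> r)) (\<eta> t)) \<le>
    norm x * L2_set (\<lambda>r. norm (\<xi> r)) F * L2_set (\<lambda>t. norm (\<eta> t)) F"
proof -
  have "cmod (cinner (op_apply x X) Y) \<le> norm x * norm X * norm Y" for X Y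
    using mult_right_mono[OF norm_op_apply_le[of x X] norm_ge_zero[of Y]]
      norm_cinner_le[of "op_apply x X" Y] by linarith
  then show ?thesis
    unfolding sum_block_op_cinner norm_sum_single[OF assms, symmetric] .
qed

text \<open>Swapping the sums over \<open>g\<close> and \<open>r\<close> leaves, for each
  \<open>r\<close>, finitely many coordinates of \<open>a r\<close>, which contribute at most its
  norm.\<close>

lemma L2_set_sum_ell2_le:
  fixes a :: "'j \<Rightarrow> ('i, 'h::complex_hilbert_space) ell2"
  assumes "finite G"
  shows "L2_set (\<lambda>g. L2_set (\<lambda>r. norm (ell2_apply (a r) g) * c r) F) G \<le> L2_set (\<lambda>r. norm (a r) * c r) F"
proof -
  have "(\<Sum>g\<in>G. \<Sum>r\<in>F. (norm (ell2_apply (a r) g) * c r)\<^sup>2) =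
      (\<Sum>r\<in>F. (\<Sum>g\<in>G. (norm (ell2_apply (a r) g))\<^sup>2) * (c r)\<^sup>2)"
    by (subst sum.swap) (simp add: power_mult_distrib sum_distrib_right)
  also have "\<dots> \<le> (\<Sum>r\<in>F. (norm (a r))\<^sup>2 * (c r)\<^sup>2)"
  proof (intro sum_mono mult_right_mono)
    fix r
    have "L2_set (\<lambda>g. norm (ell2_apply (a r) g)) G \<le> norm (a r)"
      by (rule L2_set_le_norm_ell2[OF assms])
    then show "(\<Sum>g\<in>G. (norm (ell2_apply (a r) g))\<^sup>2) \<le> (norm (a r))\<^sup>2"
      unfolding L2_set_def by (metis sqrt_le_D)
  qed simp
  finally show ?thesis
    unfolding L2_set_def by (simp add: sum_nonneg power_mult_distrib)
qed

text \<open>A Gram matrix acts as a Schur multiplier. Expanding \<open>cinner (a r) (b t)\<close> in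
  coordinates \<open>g\<close> gives a superposition of plain forms of \<open>x\<close> in the
  vectors \<open>\<xi> r\<close> and \<open>\<eta> t\<close> scaled by the coordinates of
  \<open>a r\<close> and \<open>b t\<close>; Cauchy-Schwarz in \<open>g\<close> reassembles the
  norms. These stay inside the sums because one application has vectors of varying norm.\<close>

lemma gram_schur_bound:
  fixes a b :: "'g \<Rightarrow> ('i, complex) ell2" and x :: "('g, 'h::complex_hilbert_space) ell2 bounded_op"
  assumes F: "finite F"
  shows "cmod (\<Sum>t\<in>F. \<Sum>r\<in>F. cinner (a r) (b t) * cinner (op_apply (block_op t r x) (\<xi> r)) (\<eta> t)) \<le>
    norm x * L2_set (\<lambda>r. norm (a r) * norm (\<xi> r)) F * L2_set (\<lambda>t. norm (b t) * norm (\<eta> t)) F"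
    (is "cmod ?S \<le> ?B")
proof (rule tendsto_upperbound)
  \<comment> \<open>Truncation of the inner products to the finite coordinate set \<open>G\<close>;
    the bound is uniform in \<open>G\<close> and passes to the limit.\<close>
  define S where "S G = (\<Sum>t\<in>F. \<Sum>r\<in>F. (\<Sum>g\<in>G. ell2_apply (a r) g * cnj (ell2_apply (b t) g)) *
    cinner (op_apply (block_op t r x) (\<xi> r)) (\<eta> t))" for G
  have "((\<lambda>g. ell2_apply (a r) g * cnj (ell2_apply (b t) g)) has_sum cinner (a r) (b t)) UNIV" for r t
  proof -
    have "(\<lambda>g. cinner (ell2_apply (a r) g) (ell2_apply (b t) g)) summable_on UNIV"
      using ell2_apply[of "a r"] ell2_apply[of "b t"] by (intro ell2_cinner_summable) auto
    then show ?thesis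
      unfolding cinner_ell2_def by (simp add: cinner_complex_def)
  qed
  then have "((\<lambda>G. S G) \<longlongrightarrow> ?S) (finite_subsets_at_top UNIV)"
    unfolding S_def has_sum_def by (intro tendsto_intros) auto
  then show "((\<lambda>G. cmod (S G)) \<longlongrightarrow> cmod ?S) (finite_subsets_at_top UNIV)"
    by (rule tendsto_norm)
  have "cmod (S G) \<le> ?B" if G: "finite G" for G
  proof -
    let ?A = "\<lambda>g. L2_set (\<lambda>r. norm (ell2_apply (a r) g) * norm (\<xi> r)) F"
    let ?B' = "\<lambda>g. L2_set (\<lambda>t. norm (ell2_apply (b t) g) * norm (\<eta> t)) F"
    have "S G = (\<Sum>t\<in>F. \<Sum>r\<in>F. \<Sum>g\<in>G. cinner (op_apply (block_op t r x) (ell2_apply (a r) g *\<^sub>C \<xi> r))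
        (ell2_apply (b t) g *\<^sub>C \<eta> t))"
      unfolding S_def sum_distrib_right
      by (simp add: op_apply_scaleC cinner_scaleC_left cinner_scaleC_right mult_ac)
    also have "\<dots> = (\<Sum>g\<in>G. \<Sum>t\<in>F. \<Sum>r\<in>F. cinner (op_apply (block_op t r x) (ell2_apply (a r) g *\<^sub>C \<xi> r))
        (ell2_apply (b t) g *\<^sub>C \<eta> t))"
      by (simp only: sum.swap[where A = F and B = G])
    also have "cmod \<dots> \<le> (\<Sum>g\<in>G. norm x * (\<bar>?A g\<bar> * \<bar>?B' g\<bar>))"
    proof (rule sum_norm_le)
      fix g
      show "cmod (\<Sum>t\<in>F. \<Sum>r\<in>F. cinner (op_apply (block_op t r x) (ell2_apply (a r) g *\<^sub>C \<xi> r))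
          (ell2_apply (b t) g *\<^sub>C \<eta> t)) \<le> norm x * (\<bar>?A g\<bar> * \<bar>?B' g\<bar>)"
        using sum_block_op_cinner_le[OF F, of x "\<lambda>r. ell2_apply (a r) g *\<^sub>C \<xi> r" "\<lambda>t. ell2_apply (b t) g *\<^sub>C \<eta> t"]
        by (simp add: norm_scaleC mult.assoc abs_of_nonneg L2_set_nonneg)
    qed
    also have "\<dots> = norm x * (\<Sum>g\<in>G. \<bar>?A g\<bar> * \<bar>?B' g\<bar>)"
      by (rule sum_distrib_left[symmetric])
    also have "\<dots> \<le> norm x * (L2_set ?A G * L2_set ?B' G)"
      by (intro mult_left_mono L2_set_mult_ineq) simp
    also have "\<dots> \<le> norm x * (L2_set (\<lambda>r. norm (a r) * norm (\<xi> r)) F * L2_set (\<lambda>t. norm (b t) * norm (\<eta> t)) F)"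
      by (intro mult_left_mono mult_mono L2_set_sum_ell2_le G L2_set_nonneg norm_ge_zero)
    finally show ?thesis
      by (simp add: mult.assoc)
  qed
  then show "\<forall>\<^sub>F G in finite_subsets_at_top UNIV. cmod (S G) \<le> ?B"
    by (intro eventually_finite_subsets_at_top_weakI) auto
qed simp

text \<open>A relation and not a function, because the product with an arbitrary \<open>u\<close>
  need not be a bounded operator.\<close>

definition schur_product ::
    "('g::group_add \<Rightarrow> complex) \<Rightarrow> ('g, 'h::complex_hilbert_space) ell2 bounded_op \<Rightarrow>
      ('g, 'h) ell2 bounded_op \<Rightarrow> bool"
  where "schur_product u x y \<longleftrightarrow> (\<forall>t r. block_op t r y = u (t - r) *\<^sub>C block_op t r x)"

text \<open>Stated on finite sections, so that it makes sense before the product is known to exist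
  as an operator. The type argument fixes the Hilbert space on which the blocks act.\<close>

definition schur_bound ::
    "'h::complex_hilbert_space itself \<Rightarrow> ('g::group_add \<Rightarrow> complex) \<Rightarrow> real \<Rightarrow> bool"
  where "schur_bound _ u K \<longleftrightarrow> (\<forall>(x :: ('g, 'h) ell2 bounded_op) F \<xi> \<eta>. finite F \<longrightarrow>
    cmod (\<Sum>t\<in>F. \<Sum>r\<in>F. u (t - r) * cinner (op_apply (block_op t r x) (\<xi> r)) (\<eta> t)) \<le>
      K * norm x * L2_set (\<lambda>r. norm (\<xi> r)) F * L2_set (\<lambda>t. norm (\<eta> t)) F)"

lemma schur_boundD:
  fixes x :: "('g::group_add, 'h::complex_hilbert_space) ell2 bounded_op"
  assumes "schur_bound TYPE('h) u K" "finite F"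
  shows "cmod (\<Sum>t\<in>F. \<Sum>r\<in>F. u (t - r) * cinner (op_apply (block_op t r x) (\<xi> r)) (\<eta> t)) \<le>
    K * norm x * L2_set (\<lambda>r. norm (\<xi> r)) F * L2_set (\<lambda>t. norm (\<eta> t)) F"
  using assms unfolding schur_bound_def by blast

text \<open>Testing the Schur form against the entries of the image vector itself turns it into a
  squared norm, and one factor cancels. Density of the finitely supported vectors does the
  rest.\<close>

lemma schur_product_norm_le:
  fixes x y :: "('g::group_add, 'h::complex_hilbert_space) ell2 bounded_op"
  assumes u: "schur_bound TYPE('h) u K" "0 \<le> K" and y: "schur_product u x y"
  shows "norm y \<le> K * norm x"
proof -
  define C where "C = K * norm x"
  have C: "0 \<le> C"
    using u(2) by (simp add: C_def)
  have fin: "norm (op_apply y (ell2_restrict F \<xi>)) \<le> C * norm (ell2_restrict F \<xi>)" if F: "finite F" for F \<xi>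
  proof (rule norm_ell2_le)
    fix G :: "'g set"
    assume G: "finite G"
    define \<zeta> where "\<zeta> = op_apply y (ell2_restrict F \<xi>)"
    \<comment> \<open>The index set has to contain \<open>F\<close> so that the restricted vector is
      recovered in full, and \<open>G\<close> so that all tested entries are present.\<close>
    let ?H = "F \<union> G"
    let ?l = "L2_set (\<lambda>t. norm (ell2_apply \<zeta> t)) ?H"
    have H: "finite ?H"
      using F G by simp
    have restr: "(\<Sum>r\<in>?H. ell2_single r (ell2_apply (ell2_restrict F \<xi>) r)) = ell2_restrict F \<xi>"
      by (rule ell2_eqI) (simp add: ell2_apply_sum_single[OF H] ell2_restrict_apply[OF F])
    have "complex_of_real (?l\<^sup>2) = (\<Sum>t\<in>?H. cinner (ell2_apply \<zeta> t) (ell2_apply \<zeta> t))"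
      by (simp add: L2_set_def sum_nonneg cinner_self)
    also have "\<dots> = cinner \<zeta> (\<Sum>t\<in>?H. ell2_single t (ell2_apply \<zeta> t))"
      by (simp add: cinner_sum_right cinner_ell2_single)
    also have "\<dots> = (\<Sum>t\<in>?H. \<Sum>r\<in>?H. cinner (op_apply (block_op t r y) (ell2_apply (ell2_restrict F \<xi>) r)) (ell2_apply \<zeta> t))"
      unfolding sum_block_op_cinner restr \<zeta>_def ..
    also have "\<dots> = (\<Sum>t\<in>?H. \<Sum>r\<in>?H. u (t - r) * cinner (op_apply (block_op t r x) (ell2_apply (ell2_restrict F \<xi>) r)) (ell2_apply \<zeta> t))"
      using y by (simp add: schur_product_def op_apply_simps cinner_scaleC_left)
    finally have "cmod (complex_of_real (?l\<^sup>2)) \<le> C * L2_set (\<lambda>r. norm (ell2_apply (ell2_restrict F \<xi>) r)) ?H * ?l"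
      using schur_boundD[OF u(1) H, of x "ell2_apply (ell2_restrict F \<xi>)" "ell2_apply \<zeta>"] by (simp add: C_def)
    then have "?l * ?l \<le> C * L2_set (\<lambda>r. norm (ell2_apply (ell2_restrict F \<xi>) r)) ?H * ?l"
      by (simp only: norm_of_real abs_of_nonneg zero_le_power2 power2_eq_square[symmetric])
    moreover have "0 \<le> C * L2_set (\<lambda>r. norm (ell2_apply (ell2_restrict F \<xi>) r)) ?H"
      using C by (simp add: L2_set_nonneg)
    ultimately have "?l \<le> C * L2_set (\<lambda>r. norm (ell2_apply (ell2_restrict F \<xi>) r)) ?H"
      using L2_set_nonneg[of "\<lambda>t. norm (ell2_apply \<zeta> t)" ?H]
      by (cases "?l = 0") (auto simp: mult_le_cancel_right)
    also have "\<dots> \<le> C * norm (ell2_restrict F \<xi>)"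
      by (intro mult_left_mono L2_set_le_norm_ell2 H C)
    also have "L2_set (\<lambda>t. norm (ell2_apply \<zeta> t)) G \<le> ?l"
      unfolding L2_set_def using F G by (intro real_sqrt_le_mono sum_mono2) auto
    finally show "L2_set (\<lambda>t. norm (ell2_apply (op_apply y (ell2_restrict F \<xi>)) t)) G \<le> C * norm (ell2_restrict F \<xi>)"
      by (simp add: \<zeta>_def)
  qed
  have "norm y \<le> C"
  proof (rule norm_op_le[OF C])
    fix \<xi>
    show "norm (op_apply y \<xi>) \<le> C * norm \<xi>"
    proof (rule field_le_epsilon)
      fix e :: real
      assume e: "0 < e"
      define d where "d = e / (norm y + 1)"
      have "0 < norm y + 1"
        by (simp add: add_nonneg_pos)
      then have d: "0 < d" "norm y * d \<le> e"
        using e by (auto simp: d_def pos_divide_le_eq algebra_simps)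
      obtain F where F: "finite F" "norm (\<xi> - ell2_restrict F \<xi>) \<le> d"
        using ell2_restrict_approx[OF d(1)] by blast
      have "norm (op_apply y \<xi>) \<le> norm (op_apply y (ell2_restrict F \<xi>)) + norm (op_apply y (\<xi> - ell2_restrict F \<xi>))"
        by (simp add: op_apply_diff norm_triangle_sub)
      also have "\<dots> \<le> C * norm \<xi> + norm y * d"
        using fin[OF F(1), of \<xi>] mult_left_mono[OF norm_ell2_restrict_le[OF F(1), of \<xi>] C]
          norm_op_apply_le[of y "\<xi> - ell2_restrict F \<xi>"] mult_left_mono[OF F(2) norm_ge_zero[of y]]
        by linarith
      finally show "norm (op_apply y \<xi>) \<le> C * norm \<xi> + e"
        using d(2) by linarith
    qed
  qed
  then show ?thesis
    by (simp add: C_def)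
qed

text \<open>Moving \<open>translation t\<close> to the other side of the inner product exhibits
  \<open>coefficient \<zeta> \<omega> (t - r)\<close> as a Gram matrix of translates of
  \<open>\<zeta>\<close> and \<open>\<omega>\<close>, which have constant norm.\<close>

lemma schur_bound_coefficient:
  "schur_bound TYPE('h::complex_hilbert_space) (coefficient \<zeta> \<omega>) (norm \<zeta> * norm \<omega>)"
  unfolding schur_bound_def
proof (intro allI impI)
  fix x :: "('a, 'h) ell2 bounded_op" and F :: "'a set" and \<xi> \<eta> :: "'a \<Rightarrow> 'h"
  assume F: "finite F"
  have coeff: "coefficient \<zeta> \<omega> (t - r) =
      cinner (op_apply (translation (- r)) \<zeta>) (op_apply (translation (- t)) \<omega>)" for t r
    unfolding star_translation[symmetric, of t] cinner_star[symmetric]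
    unfolding coefficient_def diff_conv_add_uminus translation_add times_bounded_op.rep_eq ..
  show "cmod (\<Sum>t\<in>F. \<Sum>r\<in>F. coefficient \<zeta> \<omega> (t - r) * cinner (op_apply (block_op t r x) (\<xi> r)) (\<eta> t))
    \<le> norm \<zeta> * norm \<omega> * norm x * L2_set (\<lambda>r. norm (\<xi> r)) F * L2_set (\<lambda>t. norm (\<eta> t)) F"
    using gram_schur_bound[OF F, of "\<lambda>r. op_apply (translation (- r)) \<zeta>" "\<lambda>t. op_apply (translation (- t)) \<omega>" x \<xi> \<eta>]
    by (simp add: coeff norm_translation_apply L2_set_right_distrib[symmetric] mult_ac)
qed

lemma schur_bound_add:
  assumes "schur_bound TYPE('h::complex_hilbert_space) u K" "schur_bound TYPE('h) v L"
  shows "schur_bound TYPE('h) (\<lambda>s. u s + v s) (K + L)"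
  unfolding schur_bound_def
proof (intro allI impI)
  fix x :: "('a, 'h) ell2 bounded_op" and F :: "'a set" and \<xi> \<eta> :: "'a \<Rightarrow> 'h"
  assume F: "finite F"
  show "cmod (\<Sum>t\<in>F. \<Sum>r\<in>F. (u (t - r) + v (t - r)) * cinner (op_apply (block_op t r x) (\<xi> r)) (\<eta> t))
    \<le> (K + L) * norm x * L2_set (\<lambda>r. norm (\<xi> r)) F * L2_set (\<lambda>t. norm (\<eta> t)) F"
    using schur_boundD[OF assms(1) F, of x \<xi> \<eta>] schur_boundD[OF assms(2) F, of x \<xi> \<eta>]
    by (simp add: distrib_right sum.distrib norm_triangle_le)
qed

section \<open>From completely bounded multipliers of the group von Neumann algebra to Schur
  bounds\<close>

lemma op_cinner_eqI:
  fixes S T :: "'h::complex_hilbert_space bounded_op"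
  assumes "\<And>x y. cinner (op_apply S x) y = cinner (op_apply T x) y"
  shows "S = T"
proof (rule op_eqI, rule cinner_eqI)
  show "cinner y (op_apply S x) = cinner y (op_apply T x)" for x y
    by (simp only: cinner_commute[of y] assms)
qed

lemma scaleC_translation_in_group_vn: "c *\<^sub>C translation s \<in> group_vn"
  by (simp add: group_vn_def scaleC_mult_left scaleC_mult_right)

text \<open>Pairing \<open>translation s\<close> with a coefficient function evaluates that function
  at \<open>s\<close>, so translations are eigenvectors of the transpose. The second hypothesis
  provides the vectors \<open>\<xi>'\<close> and \<open>\<eta>'\<close> that the definition of the
  transpose asks for.\<close>

lemma multiplier_transpose_translation:
  assumes M: "multiplier_transpose u M"
    and u: "\<And>v. v \<in> fourier_algebra \<Longrightarrow> (\<lambda>s. u s * v s) \<in> fourier_algebra"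
  shows "M (c *\<^sub>C translation s) = (c * u s) *\<^sub>C translation s"
proof (rule op_cinner_eqI)
  fix \<xi> \<eta>
  have "(\<lambda>s. u s * coefficient \<xi> \<eta> s) \<in> fourier_algebra"
    by (rule u) (auto simp: fourier_algebra_def)
  then obtain \<xi>' \<eta>' where eq: "(\<lambda>s. u s * coefficient \<xi> \<eta> s) = coefficient \<xi>' \<eta>'"
    unfolding fourier_algebra_def by blast
  then have "cinner (op_apply (M (c *\<^sub>C translation s)) \<xi>) \<eta> = cinner (op_apply (c *\<^sub>C translation s) \<xi>') \<eta>'"
    using M scaleC_translation_in_group_vn[of c s] unfolding multiplier_transpose_def
    by (metis (no_types, lifting))
  also have "\<dots> = c * coefficient \<xi>' \<eta>' s"
    by (simp add: op_apply_simps cinner_scaleC_left coefficient_def)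
  also have "\<dots> = c * (u s * coefficient \<xi> \<eta> s)"
    by (simp add: eq[symmetric])
  finally show "cinner (op_apply (M (c *\<^sub>C translation s)) \<xi>) \<eta> =
      cinner (op_apply ((c * u s) *\<^sub>C translation s) \<xi>) \<eta>"
    by (simp add: op_apply_simps cinner_scaleC_left coefficient_def)
qed

lemma L2_set_le_matrix_norm:
  fixes T :: "nat \<Rightarrow> nat \<Rightarrow> 'h::complex_hilbert_space bounded_op"
  shows "L2_set (\<lambda>i. norm (\<Sum>j<n. op_apply (T i j) (\<xi> j))) {..<n} \<le>
    matrix_norm n T * L2_set (\<lambda>j. norm (\<xi> j)) {..<n}"
proof -
  define B where "B \<xi> = L2_set (\<lambda>i. norm (\<Sum>j<n. op_apply (T i j) (\<xi> j))) {..<n}" for \<xi>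
  define p where "p = L2_set (\<lambda>j. norm (\<xi> j)) {..<n}"
  \<comment> \<open>The supremum in \<open>matrix_norm\<close> is only informative once the set is
    known to be bounded; the sum of the norms of all entries is bound enough.\<close>
  have bdd: "bdd_above (B ` {\<xi>. L2_set (\<lambda>j. norm (\<xi> j)) {..<n} \<le> 1})"
  proof (rule bdd_aboveI2)
    fix \<xi> :: "nat \<Rightarrow> 'h"
    assume "\<xi> \<in> {\<xi>. L2_set (\<lambda>j. norm (\<xi> j)) {..<n} \<le> 1}"
    then have le1: "norm (\<xi> j) \<le> 1" if "j < n" for j
      using member_le_L2_set[of "{..<n}" j "\<lambda>j. norm (\<xi> j)"] that by simp
    have "B \<xi> \<le> (\<Sum>i<n. norm (\<Sum>j<n. op_apply (T i j) (\<xi> j)))"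
      unfolding B_def by (rule L2_set_le_sum) simp
    also have "\<dots> \<le> (\<Sum>i<n. \<Sum>j<n. norm (T i j))"
    proof (intro sum_mono sum_norm_le)
      fix i j
      assume "j \<in> {..<n}"
      then show "norm (op_apply (T i j) (\<xi> j)) \<le> norm (T i j)"
        using norm_op_apply_le[of "T i j" "\<xi> j"] mult_left_mono[OF le1[of j] norm_ge_zero[of "T i j"]] by simp
    qed
    finally show "B \<xi> \<le> (\<Sum>i<n. \<Sum>j<n. norm (T i j))" .
  qed
  have B_le: "B \<zeta> \<le> matrix_norm n T" if "L2_set (\<lambda>j. norm (\<zeta> j)) {..<n} \<le> 1" for \<zeta>
    unfolding matrix_norm_def B_def[symmetric] by (rule cSUP_upper[OF _ bdd]) (use that in simp)
  have B_scale: "B (\<lambda>j. r *\<^sub>R \<xi> j) = r * B \<xi>" if "0 \<le> r" for r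
  proof -
    have "op_apply (T i j) (r *\<^sub>R \<xi> j) = r *\<^sub>R op_apply (T i j) (\<xi> j)" for i j
      by (simp add: scaleC_of_real[symmetric] op_apply_scaleC)
    then show ?thesis
      using that by (simp add: B_def scaleR_sum_right[symmetric] L2_set_right_distrib[OF that])
  qed
  have p_scale: "L2_set (\<lambda>j. norm (r *\<^sub>R \<xi> j)) {..<n} = r * p" if "0 \<le> r" for r
    using that by (simp add: p_def L2_set_right_distrib[OF that])
  have "B \<xi> \<le> matrix_norm n T * p"
  proof (cases "p = 0")
    case True
    then have "\<xi> j = 0" if "j < n" for j
      using that by (simp add: p_def L2_set_eq_0_iff)
    then show ?thesis
      by (simp add: B_def True L2_set_def)
  next
    case False
    then have "0 < p"
      using L2_set_nonneg[of "\<lambda>j. norm (\<xi> j)" "{..<n}"] by (simp add: p_def order_less_le)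
    then have "inverse p * B \<xi> \<le> matrix_norm n T"
      using B_le[of "\<lambda>j. inverse p *\<^sub>R \<xi> j"] B_scale[of "inverse p"] p_scale[of "inverse p"]
      by simp
    with \<open>0 < p\<close> show ?thesis
      by (simp add: field_simps)
  qed
  then show ?thesis
    by (simp add: B_def p_def)
qed

lemma L2_set_reindex: "bij_betw h A B \<Longrightarrow> L2_set (\<lambda>i. f (h i)) A = L2_set f B"
  unfolding L2_set_def by (simp add: sum.reindex_bij_betw[of h A B "\<lambda>b. (f b)\<^sup>2"])

text \<open>Compressing \<open>x\<close> to unit vectors in each coordinate gives a scalar matrix \<open>z\<close>, and the matrix
  \<open>z\<^sub>t\<^sub>r \<lambda>(t - r)\<close> over the group von Neumann algebra is unitarily equivalent to \<open>z \<otimes> 1\<close>; the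
  multiplier acts on the former as the Schur multiplier acts on \<open>z\<close>.\<close>

lemma cb_multiplier_bound_schur_bound:
  assumes "cb_multiplier_bound u K"
  shows "schur_bound TYPE('h::complex_hilbert_space) u K"
  unfolding schur_bound_def
proof (intro allI impI)
  fix x :: "('a, 'h) ell2 bounded_op" and F :: "'a set" and \<xi> \<eta> :: "'a \<Rightarrow> 'h"
  assume F: "finite F"
  obtain M where M: "multiplier_transpose u M"
    and cb: "\<And>n x. \<forall>i<n. \<forall>j<n. x i j \<in> group_vn \<Longrightarrow> matrix_norm n (\<lambda>i j. M (x i j)) \<le> K * matrix_norm n x"
    and K: "0 \<le> K" and A: "\<And>v. v \<in> fourier_algebra \<Longrightarrow> (\<lambda>s. u s * v s) \<in> fourier_algebra"
    using assms unfolding cb_multiplier_bound_def by metis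
  have M_trans: "M (c *\<^sub>C translation s) = (c * u s) *\<^sub>C translation s" for c s
    using M A by (rule multiplier_transpose_translation)
  define n where "n = card F"
  obtain h where h: "bij_betw h {..<n} F"
    using ex_bij_betw_nat_finite[OF F] by (auto simp: n_def atLeast0LessThan)
  define k where "k = inv_into {..<n} h"
  have k: "k (h i) = i" if "i < n" for i
    using h that by (simp add: k_def bij_betw_def)
  have norm_sgn: "norm (sgn v) \<le> 1" for v :: 'h
    by (simp add: norm_sgn)
  have sgn: "v = complex_of_real (norm v) *\<^sub>C sgn v" for v :: 'h
    by (cases "v = 0") (simp_all add: scaleC_of_real sgn_div_norm)
  \<comment> \<open>Only the directions of the vectors enter \<open>z\<close>. At a zero vector
    \<open>sgn\<close> is \<open>0\<close>, which is harmless because the norm factor vanishes as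
    well.\<close>
  define z where "z t r = cinner (op_apply (block_op t r x) (sgn (\<xi> r))) (sgn (\<eta> t))" for t r
  have z: "cinner (op_apply (block_op t r x) (\<xi> r)) (\<eta> t) = z t r * norm (\<xi> r) * norm (\<eta> t)" for t r
  proof -
    have "cinner (op_apply (block_op t r x) (\<xi> r)) (\<eta> t) =
        cinner (op_apply (block_op t r x) (norm (\<xi> r) *\<^sub>C sgn (\<xi> r))) (norm (\<eta> t) *\<^sub>C sgn (\<eta> t))"
      by (simp only: sgn[symmetric])
    then show ?thesis
      by (simp only: z_def op_apply_scaleC cinner_scaleC_left cinner_scaleC_right
          complex_cnj_complex_of_real mult_ac)
  qed
  define y :: "nat \<Rightarrow> nat \<Rightarrow> ('a, complex) ell2 bounded_op"
    where "y i j = z (h i) (h j) *\<^sub>C translation (h i - h j)" for i j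
  have "matrix_norm n y \<le> norm x"
    unfolding matrix_norm_def
  proof (rule cSUP_least)
    show "{\<zeta>. L2_set (\<lambda>j. norm (\<zeta> j :: ('a, complex) ell2)) {..<n} \<le> 1} \<noteq> {}"
      by (auto intro!: exI[of _ "\<lambda>_. 0"] simp: L2_set_def)
  next
    fix \<zeta> :: "nat \<Rightarrow> ('a, complex) ell2"
    assume "\<zeta> \<in> {\<zeta>. L2_set (\<lambda>j. norm (\<zeta> j)) {..<n} \<le> 1}"
    then have \<zeta>: "L2_set (\<lambda>j. norm (\<zeta> j)) {..<n} \<le> 1"
      by simp
    \<comment> \<open>The entry \<open>y i j\<close> contains
      \<open>translation (h i) * translation (- h j)\<close>. Absorbing the second factor into
      \<open>\<zeta>'\<close>, and the isometric first factor into the outcome, leaves the scalar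
      matrix \<open>z\<close>, which maps \<open>\<zeta>'\<close> to \<open>\<omega>\<close>;
      pairing \<open>\<omega>\<close> with itself gives a form covered by
      \<open>gram_schur_bound\<close>.\<close>
    define \<zeta>' where "\<zeta>' r = op_apply (translation (- r)) (\<zeta> (k r))" for r
    define \<omega> where "\<omega> t = (\<Sum>r\<in>F. z t r *\<^sub>C \<zeta>' r)" for t
    have \<zeta>': "L2_set (\<lambda>r. norm (\<zeta>' r)) F \<le> 1"
      using \<zeta> unfolding L2_set_reindex[OF h, symmetric]
      by (simp add: \<zeta>'_def norm_translation_apply k L2_set_def cong: sum.cong_simp)
    have row: "(\<Sum>j<n. op_apply (y i j) (\<zeta> j)) = op_apply (translation (h i)) (\<omega> (h i))" for i
      unfolding \<omega>_def sum.reindex_bij_betw[OF h, symmetric]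
      by (simp add: op_apply_sum_right y_def \<zeta>'_def k op_apply_simps op_apply_scaleC diff_conv_add_uminus
          translation_add del: add_uminus_conv_diff)
    let ?l = "L2_set (\<lambda>t. norm (\<omega> t)) F"
    have "complex_of_real (?l\<^sup>2) = (\<Sum>t\<in>F. cinner (\<omega> t) (\<omega> t))"
      by (simp add: L2_set_def sum_nonneg cinner_self)
    also have "\<dots> = (\<Sum>t\<in>F. \<Sum>r\<in>F. cinner (\<zeta>' r) (\<omega> t) * z t r)"
      by (subst \<omega>_def) (simp add: cinner_sum_left cinner_scaleC_left mult.commute)
    finally have sq: "complex_of_real (?l\<^sup>2) = (\<Sum>t\<in>F. \<Sum>r\<in>F. cinner (\<zeta>' r) (\<omega> t) * z t r)" .
    have "cmod (complex_of_real (?l\<^sup>2)) \<le>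
        norm x * L2_set (\<lambda>r. norm (\<zeta>' r) * norm (sgn (\<xi> r))) F * L2_set (\<lambda>t. norm (\<omega> t) * norm (sgn (\<eta> t))) F"
      unfolding sq z_def by (rule gram_schur_bound[OF F])
    also have "\<dots> \<le> norm x * L2_set (\<lambda>r. norm (\<zeta>' r)) F * ?l"
      by (intro mult_mono L2_set_mono mult_nonneg_nonneg L2_set_nonneg)
        (simp_all add: mult_left_le norm_sgn)
    also have "\<dots> \<le> norm x * 1 * ?l"
      by (intro mult_right_mono mult_left_mono \<zeta>') (simp_all add: L2_set_nonneg)
    finally have "?l * ?l \<le> norm x * ?l"
      by (simp only: norm_of_real abs_of_nonneg zero_le_power2 power2_eq_square[symmetric] mult_1_right)
    then have "?l \<le> norm x"
      using L2_set_nonneg[of "\<lambda>t. norm (\<omega> t)" F]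
      by (cases "?l = 0") (auto simp: mult_le_cancel_right)
    then show "L2_set (\<lambda>i. norm (\<Sum>j<n. op_apply (y i j) (\<zeta> j))) {..<n} \<le> norm x"
      unfolding row norm_translation_apply by (simp only: L2_set_reindex[OF h, of "\<lambda>t. norm (\<omega> t)"])
  qed
  moreover have "matrix_norm n (\<lambda>i j. M (y i j)) \<le> K * matrix_norm n y"
    by (rule cb) (simp add: y_def scaleC_translation_in_group_vn)
  ultimately have My: "matrix_norm n (\<lambda>i j. M (y i j)) \<le> K * norm x"
    using K by (meson mult_left_mono order_trans)
  define c where "c t = (\<Sum>r\<in>F. u (t - r) * z t r * norm (\<xi> r))" for t
  \<comment> \<open>\<open>translation (h i - h j)\<close> carries coordinate \<open>h j\<close> to
    \<open>h i\<close>, so for fixed \<open>i\<close> all terms land in one coordinate and their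
    coefficients add up to \<open>c (h i)\<close>.\<close>
  define \<delta> :: "nat \<Rightarrow> ('a, complex) ell2" where "\<delta> j = ell2_single (h j) (complex_of_real (norm (\<xi> (h j))))" for j
  have row: "(\<Sum>j<n. op_apply (M (y i j)) (\<delta> j)) = ell2_single (h i) (c (h i))" for i
  proof -
    have "op_apply (M (y i j)) (\<delta> j) = ell2_single (h i) (u (h i - h j) * z (h i) (h j) * norm (\<xi> (h j)))" for j
      unfolding y_def M_trans \<delta>_def
      by (rule ell2_eqI)
        (auto simp: op_apply_simps translation_single ell2_apply_simps ell2_single.rep_eq scaleC_complex_def)
    then show ?thesis
      by (simp add: c_def ell2_single_sum sum.reindex_bij_betw[OF h, symmetric])
  qed
  have "L2_set (\<lambda>t. cmod (c t)) F = L2_set (\<lambda>i. cmod (c (h i))) {..<n}"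
    by (rule L2_set_reindex[OF h, symmetric])
  also have "\<dots> \<le> L2_set (\<lambda>i. norm (\<Sum>j<n. op_apply (M (y i j)) (\<delta> j))) {..<n}"
  proof (rule L2_set_mono)
    fix i
    show "cmod (c (h i)) \<le> norm (\<Sum>j<n. op_apply (M (y i j)) (\<delta> j))"
      unfolding row using norm_ell2_apply_le[of "ell2_single (h i) (c (h i))" "h i"]
      by (simp add: ell2_single.rep_eq)
  qed simp
  also have "\<dots> \<le> matrix_norm n (\<lambda>i j. M (y i j)) * L2_set (\<lambda>j. norm (\<delta> j)) {..<n}"
    by (rule L2_set_le_matrix_norm)
  also have "\<dots> \<le> (K * norm x) * L2_set (\<lambda>r. norm (\<xi> r)) F"
  proof (intro mult_mono My)
    have "L2_set (\<lambda>j. norm (\<delta> j)) {..<n} \<le> L2_set (\<lambda>j. norm (\<xi> (h j))) {..<n}"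
      using norm_ell2_single[of _ "complex_of_real _"]
      by (intro L2_set_mono) (auto simp: \<delta>_def intro: order_trans[OF norm_ell2_single])
    then show "L2_set (\<lambda>j. norm (\<delta> j)) {..<n} \<le> L2_set (\<lambda>r. norm (\<xi> r)) F"
      by (simp only: L2_set_reindex[OF h, of "\<lambda>r. norm (\<xi> r)"])
  qed (simp_all add: K L2_set_nonneg)
  finally have c: "L2_set (\<lambda>t. cmod (c t)) F \<le> K * norm x * L2_set (\<lambda>r. norm (\<xi> r)) F" .
  have "(\<Sum>t\<in>F. \<Sum>r\<in>F. u (t - r) * cinner (op_apply (block_op t r x) (\<xi> r)) (\<eta> t)) = (\<Sum>t\<in>F. c t * norm (\<eta> t))"
    by (simp add: z c_def sum_distrib_right mult.assoc)
  also have "cmod \<dots> \<le> (\<Sum>t\<in>F. \<bar>cmod (c t)\<bar> * \<bar>norm (\<eta> t)\<bar>)"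
    by (rule sum_norm_le) (simp add: norm_mult)
  also have "\<dots> \<le> L2_set (\<lambda>t. cmod (c t)) F * L2_set (\<lambda>t. norm (\<eta> t)) F"
    by (rule L2_set_mult_ineq)
  also have "\<dots> \<le> K * norm x * L2_set (\<lambda>r. norm (\<xi> r)) F * L2_set (\<lambda>t. norm (\<eta> t)) F"
    by (intro mult_right_mono c L2_set_nonneg)
  finally show "cmod (\<Sum>t\<in>F. \<Sum>r\<in>F. u (t - r) * cinner (op_apply (block_op t r x) (\<xi> r)) (\<eta> t))
    \<le> K * norm x * L2_set (\<lambda>r. norm (\<xi> r)) F * L2_set (\<lambda>t. norm (\<eta> t)) F" .
qed

section \<open>Fourier components and the approximation property\<close>

text \<open>The diagonal \<open>t - r = s\<close> of the operator matrix, that is, the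
  \<open>s\<close>-th term of the formal Fourier series.\<close>

definition fourier_component ::
    "'g::group_add \<Rightarrow> ('g, 'h::complex_hilbert_space) ell2 bounded_op \<Rightarrow> ('g, 'h) ell2 bounded_op"
  where "fourier_component s a = conditional_expectation (a * translation (- s)) * translation s"

lemma block_op_fourier_component:
  "block_op t r (fourier_component s a) = (if t - r = s then block_op t r a else 0)"
proof -
  have "t = s + r \<longleftrightarrow> t - r = s" "t - r = s \<Longrightarrow> - s + t = r"
    by (auto simp: diff_eq_eq minus_diff_eq)
  then show ?thesis
    by (auto simp: fourier_component_def block_op_mult_translation block_op_conditional_expectation)
qed

text \<open>The finite sums \<open>\<Sum>d\<^sub>s \<lambda>(s)\<close> with diagonal \<open>d\<^sub>s\<close>.\<close>

definition finite_propagation ::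
    "('g::group_add, 'h::complex_hilbert_space) ell2 bounded_op set"
  where "finite_propagation = {x. \<exists>S. finite S \<and> x = (\<Sum>s\<in>S. fourier_component s x)}"

text \<open>The hypothesis on \<open>S\<close> is met in two ways later on: by \<open>x\<close> of
  finite propagation with arbitrary \<open>u\<close>, and by \<open>u\<close> of finite support with
  arbitrary \<open>x\<close>.\<close>

lemma schur_product_fourier_component:
  assumes "finite S" "\<And>t r. t - r \<notin> S \<Longrightarrow> u (t - r) *\<^sub>C block_op t r x = 0"
  shows "schur_product u x (\<Sum>s\<in>S. u s *\<^sub>C fourier_component s x)"
  unfolding schur_product_def
proof (intro allI)
  fix t r
  have "block_op t r (\<Sum>s\<in>S. u s *\<^sub>C fourier_component s x) =
      (\<Sum>s\<in>S. if t - r = s then u s *\<^sub>C block_op t r x else 0)"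
    by (auto simp: block_op_sum block_op_scaleC block_op_fourier_component intro!: sum.cong)
  then show "block_op t r (\<Sum>s\<in>S. u s *\<^sub>C fourier_component s x) = u (t - r) *\<^sub>C block_op t r x"
    using assms by simp
qed

lemma schur_product_diff:
  "schur_product u x y \<Longrightarrow> schur_product u x' y' \<Longrightarrow> schur_product u (x - x') (y - y')"
  by (simp add: schur_product_def block_op_diff complex_vector.scale_right_diff_distrib)

lemma schur_product_diff_left:
  "schur_product u x y \<Longrightarrow> schur_product v x y' \<Longrightarrow> schur_product (\<lambda>s. u s - v s) x (y - y')"
  by (simp add: schur_product_def block_op_diff complex_vector.scale_left_diff_distrib)

text \<open>The difference is a Schur product of \<open>0\<close> by the zero function, so the norm
  estimate with \<open>K = 0\<close> kills it.\<close>

lemma block_op_eqI: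
  fixes y y' :: "('g::group_add, 'h::complex_hilbert_space) ell2 bounded_op"
  assumes "\<And>t r. block_op t r y = block_op t r y'"
  shows "y = y'"
proof -
  have "schur_bound TYPE('h) (\<lambda>_::'g. 0) 0"
    by (simp add: schur_bound_def)
  moreover have "schur_product (\<lambda>_. 0) 0 (y - y')"
    using assms by (simp add: schur_product_def block_op_diff)
  ultimately have "norm (y - y') \<le> 0 * norm (0 :: ('g, 'h) ell2 bounded_op)"
    by (intro schur_product_norm_le) simp_all
  then show ?thesis
    by simp
qed

lemma schur_product_unique: "schur_product u x y \<Longrightarrow> schur_product u x y' \<Longrightarrow> y = y'"
  by (rule block_op_eqI) (simp add: schur_product_def)

lemma finite_propagation_schur_product:
  assumes "x \<in> finite_propagation"
  obtains S where "finite S" "\<And>u. schur_product u x (\<Sum>s\<in>S. u s *\<^sub>C fourier_component s x)"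
proof -
  obtain S where S: "finite S" "x = (\<Sum>s\<in>S. fourier_component s x)"
    using assms unfolding finite_propagation_def by blast
  have "block_op t r x = 0" if "t - r \<notin> S" for t r
    by (subst S(2)) (use that in \<open>auto simp: block_op_sum block_op_fourier_component intro!: sum.neutral\<close>)
  then show ?thesis
    using S(1) by (intro that[of S] schur_product_fourier_component) simp_all
qed

text \<open>Products with elements of finite propagation exist as finite sums, and the Schur bound
  makes them a Cauchy sequence when these elements converge to \<open>a\<close>.\<close>

lemma schur_product_exists:
  fixes a :: "('g::group_add, 'h::complex_hilbert_space) ell2 bounded_op"
  assumes u: "schur_bound TYPE('h) u K" "0 \<le> K" and a: "a \<in> closure finite_propagation"
  shows "\<exists>y. schur_product u a y"
proof -
  obtain x where x: "\<And>n::nat. x n \<in> finite_propagation" "x \<longlonglongrightarrow> a"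
    using a unfolding closure_sequential by blast
  have "\<exists>y. schur_product u (x n) y" for n
    using finite_propagation_schur_product[OF x(1)] by metis
  then obtain y where y: "\<And>n. schur_product u (x n) (y n)"
    by metis
  have le: "norm (y m - y n) \<le> K * norm (x m - x n)" for m n
    by (rule schur_product_norm_le[OF u schur_product_diff[OF y y]])
  have "Cauchy y"
  proof (rule CauchyI)
    fix e :: real
    assume e: "0 < e"
    define d where "d = e / (K + 1)"
    have "0 < K + 1"
      using u(2) by simp
    then have d: "0 < d" "K * d < e"
      using e by (auto simp: d_def pos_divide_less_eq algebra_simps)
    obtain M where "\<And>m n. m \<ge> M \<Longrightarrow> n \<ge> M \<Longrightarrow> norm (x m - x n) < d"
      using CauchyD[OF LIMSEQ_imp_Cauchy[OF x(2)] d(1)] by blast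
    then show "\<exists>M. \<forall>m\<ge>M. \<forall>n\<ge>M. norm (y m - y n) < e"
      using le d(2) mult_left_mono[OF less_imp_le u(2)] by (meson le_less_trans order_trans)
  qed
  then obtain y' where y': "y \<longlonglongrightarrow> y'"
    using Cauchy_convergent convergent_def by blast
  have "block_op t r y' = u (t - r) *\<^sub>C block_op t r a" for t r
  proof (rule LIMSEQ_unique)
    have block: "(\<lambda>n. block_op t r (z n)) \<longlonglongrightarrow> block_op t r z'"
      if "z \<longlonglongrightarrow> z'" for z :: "nat \<Rightarrow> ('g, 'h) ell2 bounded_op" and z'
      using that unfolding tendsto_iff dist_norm
      by (auto elim!: eventually_mono simp: block_op_diff[symmetric] intro: le_less_trans[OF norm_block_op_le])
    show "(\<lambda>n. block_op t r (y n)) \<longlonglongrightarrow> block_op t r y'"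
      by (rule block[OF y'])
    have "(\<lambda>n. u (t - r) *\<^sub>C block_op t r (x n)) \<longlonglongrightarrow> u (t - r) *\<^sub>C block_op t r a"
    proof (rule bounded_linear.tendsto[OF _ block[OF x(2)]])
      show "bounded_linear ((*\<^sub>C) c :: 'h bounded_op \<Rightarrow> _)" for c
        by (rule bounded_clinear_bounded_linear, rule bounded_clinearI[where K = "cmod c"])
          (auto simp: scaleC_add_right scaleC_scaleC norm_scaleC mult.commute)
    qed
    then show "(\<lambda>n. block_op t r (y n)) \<longlonglongrightarrow> u (t - r) *\<^sub>C block_op t r a"
      using y by (simp add: schur_product_def)
  qed
  then show ?thesis
    by (auto simp: schur_product_def)
qed

section \<open>Schur multipliers with symbol in the Fourier algebra\<close>

lemma coefficient_restrict_support:
  assumes "finite F" "finite G"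
    and "coefficient (ell2_restrict F \<xi>) (ell2_restrict G \<eta>) s \<noteq> 0"
  shows "s \<in> (\<lambda>(t, r). t - r) ` (G \<times> F)"
proof (rule ccontr)
  assume s: "\<not> ?thesis"
  have "- s + t \<notin> F" if "t \<in> G" for t
  proof
    assume "- s + t \<in> F"
    with that s show False
      by (force simp: diff_conv_add_uminus minus_add simp del: add_uminus_conv_diff)
  qed
  then have "cinner (ell2_apply (op_apply (translation s) (ell2_restrict F \<xi>)) t) (ell2_apply (ell2_restrict G \<eta>) t) = 0" for t
    using assms(1,2) by (simp add: translation_apply ell2_restrict_apply)
  then show False
    using assms(3) by (simp add: coefficient_def cinner_ell2_def)
qed

lemma coefficient_diff_left: "coefficient (\<xi> - \<xi>') \<eta> s = coefficient \<xi> \<eta> s - coefficient \<xi>' \<eta> s"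
  and coefficient_diff_right: "coefficient \<xi> (\<eta> - \<eta>') s = coefficient \<xi> \<eta> s - coefficient \<xi> \<eta>' s"
  by (simp_all add: coefficient_def op_apply_diff cinner_diff_left cinner_diff_right)

text \<open>Truncating both vectors of a coefficient function makes its support finite, so the
  truncated product is a finite combination of Fourier components of \<open>a\<close>. The error is
  controlled because the Schur bound of a coefficient function is the product of the norms of its
  vectors.\<close>

lemma fourier_algebra_schur_product_mem:
  fixes a y :: "('g::group_add, 'h::complex_hilbert_space) ell2 bounded_op"
  assumes D: "csubspace D" "closed D" "\<And>s. fourier_component s a \<in> D"
    and u: "u \<in> fourier_algebra" and y: "schur_product u a y"
  shows "y \<in> D"
proof (rule closed_memI[OF D(2)])
  fix e :: real
  assume e: "0 < e"
  obtain \<xi> \<eta> where u_eq: "u = coefficient \<xi> \<eta>"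
    using u unfolding fourier_algebra_def by blast
  \<comment> \<open>The two truncations cost \<open>d * norm \<eta>\<close> and
    \<open>norm \<xi> * d\<close>, each times \<open>norm a\<close>; the summand \<open>1\<close>
    keeps the denominator positive.\<close>
  define d where "d = e / ((norm \<xi> + norm \<eta>) * norm a + 1)"
  have pos: "0 < (norm \<xi> + norm \<eta>) * norm a + 1"
    by (intro add_nonneg_pos) simp_all
  then have d: "0 < d" "d * ((norm \<xi> + norm \<eta>) * norm a) \<le> e"
    using e by (auto simp: d_def pos_divide_le_eq algebra_simps)
  obtain F where F: "finite F" "norm (\<xi> - ell2_restrict F \<xi>) \<le> d"
    using ell2_restrict_approx[OF d(1)] by blast
  obtain G where G: "finite G" "norm (\<eta> - ell2_restrict G \<eta>) \<le> d"
    using ell2_restrict_approx[OF d(1)] by blast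
  define v where "v = coefficient (ell2_restrict F \<xi>) (ell2_restrict G \<eta>)"
  define S where "S = (\<lambda>(t, r). t - r) ` (G \<times> F)"
  define y' where "y' = (\<Sum>s\<in>S. v s *\<^sub>C fourier_component s a)"
  have "schur_product v a y'"
    unfolding y'_def
  proof (rule schur_product_fourier_component)
    show "finite S"
      using F(1) G(1) by (simp add: S_def)
    have "v s = 0" if "s \<notin> S" for s
      using that coefficient_restrict_support[OF F(1) G(1)] unfolding v_def S_def by blast
    then show "t - r \<notin> S \<Longrightarrow> v (t - r) *\<^sub>C block_op t r a = 0" for t r
      by simp
  qed
  then have "schur_product (\<lambda>s. u s - v s) a (y - y')"
    by (rule schur_product_diff_left[OF y])
  moreover have "(\<lambda>s. u s - v s) = (\<lambda>s. coefficient (\<xi> - ell2_restrict F \<xi>) \<eta> s +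
      coefficient (ell2_restrict F \<xi>) (\<eta> - ell2_restrict G \<eta>) s)"
    by (simp add: u_eq v_def coefficient_diff_left coefficient_diff_right)
  ultimately have "norm (y - y') \<le> (norm (\<xi> - ell2_restrict F \<xi>) * norm \<eta> +
      norm (ell2_restrict F \<xi>) * norm (\<eta> - ell2_restrict G \<eta>)) * norm a"
    by (intro schur_product_norm_le[of "\<lambda>s. u s - v s"])
      (auto intro: schur_bound_add schur_bound_coefficient)
  also have "\<dots> \<le> (d * norm \<eta> + norm \<xi> * d) * norm a"
    by (intro mult_right_mono add_mono mult_mono F(2) G(2) norm_ell2_restrict_le[OF F(1)])
      (use d in simp_all)
  also have "\<dots> \<le> e"
    using d(2) by (simp add: algebra_simps)
  finally have "norm (y - y') \<le> e" .
  moreover have "y' \<in> D"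
    unfolding y'_def using D(1,3)
    by (intro csubspace_sum complex_vector.subspace_scale) auto
  ultimately show "\<exists>y'\<in>D. norm (y - y') \<le> e"
    by blast
qed

text \<open>The functional \<open>u \<mapsto> \<phi>(M\<^sub>u a)\<close> lies in the predual, being a norm limit of
  finitely supported functions, and it vanishes on the Fourier algebra when \<open>\<phi>\<close> annihilates \<open>D\<close>.\<close>

theorem approximation_property_mem:
  fixes a :: "('g::group_add, 'h::complex_hilbert_space) ell2 bounded_op"
  assumes AP: "approximation_property TYPE('g)"
    and D: "csubspace D" "closed D" "\<And>s. fourier_component s a \<in> D"
    and a: "a \<in> closure finite_propagation"
  shows "a \<in> D"
proof (rule ccontr)
  assume "a \<notin> D"
  then obtain \<phi> :: "_ \<Rightarrow> complex" where \<phi>: "bounded_clinear \<phi>" "\<And>x. x \<in> D \<Longrightarrow> \<phi> x = 0" "\<phi> a \<noteq> 0"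
    using complex_functional_separating[OF D(1,2)] by blast
  interpret \<phi>: bounded_linear \<phi>
    by (rule bounded_clinear_bounded_linear[OF \<phi>(1)])
  obtain L where L: "0 < L" "\<And>x. norm (\<phi> x) \<le> norm x * L"
    using \<phi>.pos_bounded by blast
  \<comment> \<open>The default \<open>0\<close> is compatible with both demands on
    \<open>q\<close>: membership in the predual tests only completely bounded multipliers, for which
    the product exists, and on the Fourier algebra \<open>q\<close> is supposed to vanish
    anyway.\<close>
  define q where "q u = (if \<exists>y. schur_product u a y then \<phi> (THE y. schur_product u a y) else 0)" for u
  have q: "q u = \<phi> y" if "schur_product u a y" for u y
  proof -
    have "(THE y. schur_product u a y) = y"
      using that by (rule the_equality) (rule schur_product_unique[OF _ that])
    with that show ?thesis
      by (auto simp: q_def)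
  qed
  have "q \<in> cb_multiplier_predual"
    unfolding cb_multiplier_predual_def
  proof (intro CollectI allI impI)
    fix e :: real
    assume e: "0 < e"
    obtain x where x: "x \<in> finite_propagation" "norm (a - x) < e / L"
      using closure_normD[OF a, of "e / L"] e L(1) by auto
    obtain S where S: "finite S" "\<And>u. schur_product u x (\<Sum>s\<in>S. u s *\<^sub>C fourier_component s x)"
      using finite_propagation_schur_product[OF x(1)] by blast
    \<comment> \<open>On the approximant \<open>x\<close> the functional is a finite combination of
      point evaluations of \<open>u\<close>, hence given by a summable function.\<close>
    define f where "f s = (if s \<in> S then \<phi> (fourier_component s x) else 0)" for s
    have "(\<lambda>s. norm (f s)) summable_on UNIV"
      by (rule summable_on_cong_neutral[THEN iffD1, OF _ _ _ summable_on_finite[OF S(1)]])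
        (auto simp: f_def)
    moreover have "cmod (q u - (\<Sum>\<^sub>\<infinity>s. f s * u s)) \<le> e * cb_multiplier_norm u" if u: "u \<in> cb_multipliers" for u
    proof -
      have "((\<lambda>s. f s * u s) has_sum (\<Sum>s\<in>S. f s * u s)) UNIV"
        by (rule has_sum_finite_neutralI[OF S(1)]) (auto simp: f_def)
      then have inf: "(\<Sum>\<^sub>\<infinity>s. f s * u s) = \<phi> (\<Sum>s\<in>S. u s *\<^sub>C fourier_component s x)"
        by (simp add: infsumI \<phi>.sum bounded_clinear_scaleC[OF \<phi>(1)] f_def scaleC_complex_def mult.commute)
      have le: "cmod (q u - (\<Sum>\<^sub>\<infinity>s. f s * u s)) \<le> e * K" if K: "cb_multiplier_bound u K" for K
      proof -
        have K0: "0 \<le> K"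
          using K by (simp add: cb_multiplier_bound_def)
        note bound = cb_multiplier_bound_schur_bound[OF K, where 'h = 'h]
        obtain y where y: "schur_product u a y"
          using schur_product_exists[OF bound K0 a] by blast
        have "norm (y - (\<Sum>s\<in>S. u s *\<^sub>C fourier_component s x)) \<le> K * norm (a - x)"
          by (rule schur_product_norm_le[OF bound K0 schur_product_diff[OF y S(2)]])
        also have "\<dots> \<le> K * (e / L)"
          using x(2) K0 by (intro mult_left_mono) simp_all
        finally have "norm (y - (\<Sum>s\<in>S. u s *\<^sub>C fourier_component s x)) * L \<le> e * K"
          using L(1) by (simp add: field_simps)
        then show ?thesis
          unfolding inf q[OF y] \<phi>.diff[symmetric] using L(2) order_trans by blast
      qed
      \<comment> \<open>The estimate holds for every admissible \<open>K\<close>, and there is one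
        because \<open>u\<close> is a completely bounded multiplier, so it passes to the
        infimum.\<close>
      have "cmod (q u - (\<Sum>\<^sub>\<infinity>s. f s * u s)) / e \<le> cb_multiplier_norm u"
        unfolding cb_multiplier_norm_def
        using u e le by (intro cInf_greatest) (auto simp: cb_multipliers_def field_simps)
      then show ?thesis
        using e by (simp add: field_simps)
    qed
    ultimately show "\<exists>f. (\<lambda>s. norm (f s)) summable_on UNIV \<and> (\<forall>u\<in>cb_multipliers.
        cmod (q u - (\<Sum>\<^sub>\<infinity>s. f s * u s)) \<le> e * cb_multiplier_norm u)"
      by blast
  qed
  moreover obtain F :: "('g \<Rightarrow> complex) filter" where F: "F \<noteq> bot"
    "\<forall>\<^sub>F u in F. u \<in> fourier_algebra" "\<And>q. q \<in> cb_multiplier_predual \<Longrightarrow> (q \<longlongrightarrow> q (\<lambda>_. 1)) F"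
    using AP unfolding approximation_property_def by blast
  ultimately have lim: "(q \<longlongrightarrow> q (\<lambda>_. 1)) F"
    by blast
  have "q u = 0" if "u \<in> fourier_algebra" for u
    using that fourier_algebra_schur_product_mem[OF D that] \<phi>(2) q by (metis q_def)
  then have "\<forall>\<^sub>F u in F. q u = 0"
    by (rule eventually_mono[OF F(2)])
  then have "(q \<longlongrightarrow> 0) F"
    by (rule tendsto_eventually)
  then have "q (\<lambda>_. 1) = 0"
    using lim F(1) tendsto_unique by blast
  moreover have "q (\<lambda>_. 1) = \<phi> a"
    by (rule q) (simp add: schur_product_def)
  ultimately show False
    using \<phi>(3) by simp
qed

section \<open>Partitions of unity and contractivity of *-homomorphisms\<close>

text \<open>Urysohn functions with value \<open>1\<close> at \<open>x\<close> and zero off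
  \<open>U x\<close> are positive near \<open>x\<close>; by compactness finitely many have a
  positive sum, by which they are divided. Indexing by points lets the index \<open>p\<close> serve
  as sample point for the member \<open>g p\<close>.\<close>

lemma partition_of_unity:
  fixes U :: "'x::t2_space \<Rightarrow> 'x set"
  assumes X: "compact (UNIV :: 'x set)" and U: "\<And>x. open (U x)" "\<And>x. x \<in> U x"
  obtains P :: "'x set" and g :: "'x \<Rightarrow> 'x \<Rightarrow> real"
  where "finite P" "\<And>p. continuous_on UNIV (g p)" "\<And>p x. 0 \<le> g p x"
    "\<And>x. (\<Sum>p\<in>P. g p x) = 1" "\<And>p x. g p x \<noteq> 0 \<Longrightarrow> x \<in> U p"
proof -
  have "Hausdorff_space (euclidean :: 'x topology)"
    unfolding Hausdorff_space_def by (auto simp: disjnt_def) (metis hausdorff)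
  moreover have "compact_space (euclidean :: 'x topology)"
    using X by (simp add: compact_space_def)
  ultimately have normal: "normal_space (euclidean :: 'x topology)"
    using compact_Hausdorff_or_regular_imp_normal_space by blast
  have "\<exists>h. continuous_on UNIV h \<and> (\<forall>y. 0 \<le> h y) \<and> h x = (1::real) \<and> (\<forall>y. h y \<noteq> 0 \<longrightarrow> y \<in> U x)" for x
  proof -
    have "closedin euclidean (- U x)" "closedin euclidean {x}" "disjnt (- U x) {x}"
      using U by (auto simp: disjnt_def)
    then obtain h where h: "continuous_map euclidean (top_of_set {0..1::real}) h"
      "h ` (- U x) \<subseteq> {0}" "h ` {x} \<subseteq> {1}"
      using Urysohn_lemma[OF normal, of "- U x" "{x}" 0 1] by auto
    then have "continuous_on UNIV h" "range h \<subseteq> {0..1}"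
      by (auto simp: continuous_map_in_subtopology)
    then show ?thesis
      using h(2,3) by (intro exI[of _ h] conjI allI) (auto simp: image_subset_iff)
  qed
  then obtain h where h: "\<And>x. continuous_on UNIV (h x)" "\<And>x y. 0 \<le> h x y" "\<And>x. h x x = (1::real)"
    "\<And>x y. h x y \<noteq> 0 \<Longrightarrow> y \<in> U x"
    by metis
  have "open {y. 0 < h x y}" for x
    using h(1)[of x] by (intro open_Collect_less) auto
  moreover have "y \<in> (\<Union>p\<in>UNIV. {y. 0 < h p y})" for y
    by (rule UN_I[of y]) (simp_all add: h(3))
  ultimately obtain P where P: "finite P" "UNIV \<subseteq> (\<Union>p\<in>P. {y. 0 < h p y})"
    using compactE_image[OF X, of UNIV "\<lambda>p. {y. 0 < h p y}"] by (metis subsetI)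
  have pos: "0 < (\<Sum>p\<in>P. h p y)" for y
  proof -
    obtain p where "p \<in> P" "0 < h p y"
      using P(2) by auto
    then show ?thesis
      using P(1) h(2) by (intro sum_pos2) auto
  qed
  show ?thesis
  proof (rule that[OF P(1)])
    show "continuous_on UNIV (\<lambda>y. h p y / (\<Sum>p\<in>P. h p y))" for p
      using h(1) pos by (intro continuous_intros) (auto simp: less_imp_neq[THEN not_sym])
    show "(\<Sum>p\<in>P. h p y / (\<Sum>p\<in>P. h p y)) = 1" for y
      using pos[of y] by (simp add: sum_divide_distrib[symmetric])
    show "0 \<le> h p y / (\<Sum>p\<in>P. h p y)" for p y
      using h(2) pos[of y] by simp
    show "h p y / (\<Sum>p\<in>P. h p y) \<noteq> 0 \<Longrightarrow> y \<in> U p" for p y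
      using h(4) by auto
  qed
qed

lemma convex_combination_norm_diff_le:
  fixes f :: "'i \<Rightarrow> 'a::real_normed_vector"
  assumes "finite P" "\<And>p. 0 \<le> c p" "(\<Sum>p\<in>P. c p) = 1" "\<And>p. c p \<noteq> 0 \<Longrightarrow> norm (f p - z) \<le> e"
  shows "norm ((\<Sum>p\<in>P. c p *\<^sub>R f p) - z) \<le> e"
proof -
  have "(\<Sum>p\<in>P. c p *\<^sub>R f p) - z = (\<Sum>p\<in>P. c p *\<^sub>R (f p - z))"
    using assms(3) by (simp add: scaleR_diff_right sum_subtractf scaleR_left.sum[symmetric])
  also have "norm \<dots> \<le> (\<Sum>p\<in>P. c p * e)"
  proof (rule sum_norm_le)
    fix p
    show "norm (c p *\<^sub>R (f p - z)) \<le> c p * e"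
      using assms(2)[of p] assms(4)[of p] by (cases "c p = 0") (auto intro: mult_left_mono)
  qed
  also have "\<dots> = e"
    using assms(3) by (simp add: sum_distrib_right[symmetric])
  finally show ?thesis .
qed

section \<open>Contractivity of unital *-homomorphisms into bounded operators\<close>

lemma geometric_inverse:
  fixes x :: "'a::{real_normed_algebra_1, banach}"
  assumes "norm x < 1"
  shows "(\<Sum>n. x ^ n) * (1 - x) = 1"
proof -
  have s: "summable (\<lambda>n. x ^ n)"
    by (rule complete_algebra_summable_geometric[OF assms])
  have "(\<Sum>n. x ^ n) * (1 - x) = (\<Sum>n. x ^ n * (1 - x))"
    by (rule suminf_mult2[OF s])
  also have "\<dots> = (\<Sum>n. x ^ n - x ^ Suc n)"
    by (simp add: right_diff_distrib power_commutes)
  also have "\<dots> = x ^ 0 - 0"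
    by (rule sums_unique[symmetric], rule telescope_sums') (rule summable_LIMSEQ_zero[OF s])
  finally show ?thesis
    by simp
qed

text \<open>If \<open>\<parallel>b\<parallel>\<^sup>2 < M = \<parallel>\<pi> b\<parallel>\<^sup>2\<close>, then \<open>M - b\<^sup>*b\<close> is invertible and so is \<open>M - \<pi>(b)\<^sup>*\<pi>(b)\<close>, although
  vectors almost attaining the norm of \<open>\<pi> b\<close> are approximate eigenvectors of the latter.\<close>

lemma star_hom_norm_le:
  fixes \<pi> :: "'b::{cstar_algebra, real_normed_algebra_1} \<Rightarrow> 'k::complex_hilbert_space bounded_op"
  assumes \<pi>: "star_hom \<pi>" "\<pi> 1 = 1"
  shows "norm (\<pi> b) \<le> norm b"
proof (rule ccontr)
  assume "\<not> ?thesis"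
  then have lt: "norm b < norm (\<pi> b)"
    by simp
  define M where "M = (norm (\<pi> b))\<^sup>2"
  have M: "(norm b)\<^sup>2 < M" "0 < M"
    using lt by (auto simp: M_def intro: power_strict_mono le_less_trans[OF norm_ge_zero])
  define x where "x = complex_of_real (inverse M) *\<^sub>C (star b * b)"
  have "norm x < 1"
    unfolding x_def norm_scaleC cstar_identity norm_of_real using M by (simp add: field_simps)
  define w where "w = \<pi> (\<Sum>n. x ^ n)"
  define k where "k = \<pi> b"
  have \<pi>x: "\<pi> x = complex_of_real (inverse M) *\<^sub>C (star k * k)"
    using \<pi>(1) by (simp add: x_def k_def star_hom_def)
  have "w * (1 - \<pi> x) = \<pi> ((\<Sum>n. x ^ n) * (1 - x))"
    by (simp only: w_def star_hom_mult[OF \<pi>(1)] star_hom_diff[OF \<pi>(1)] \<pi>(2))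
  then have w: "w * (1 - \<pi> x) = 1"
    by (simp only: geometric_inverse[OF \<open>norm x < 1\<close>] \<pi>(2))
  define c where "c = (norm w)\<^sup>2 + 1"
  have c: "0 < c" "(norm w)\<^sup>2 < c"
    by (auto simp: c_def add_nonneg_pos)
  \<comment> \<open>With \<open>y\<close> the image of \<open>v\<close> under
    \<open>star k * k\<close>, the left inverse \<open>w\<close> bounds \<open>norm v\<close> by
    \<open>norm w * norm (v - y / M)\<close>. On expanding the square, the cross term is
    \<open>- 2 / M\<close> times, and the last term at most \<open>1 / M\<close> times, the square
    of \<open>norm (op_apply k v)\<close>.\<close>
  have bound: "c * (norm (op_apply k v))\<^sup>2 \<le> M * (c - 1) * (norm v)\<^sup>2" for v
  proof -
    define y where "y = op_apply (star k * k) v"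
    have "cinner v y = complex_of_real ((norm (op_apply k v))\<^sup>2)"
      unfolding y_def times_bounded_op.rep_eq cinner_star[symmetric] cinner_self ..
    have "norm y \<le> norm k * norm (op_apply k v)"
      unfolding y_def times_bounded_op.rep_eq
      using norm_op_apply_le[of "star k"] by (simp add: norm_star)
    then have y2: "(norm y)\<^sup>2 \<le> M * (norm (op_apply k v))\<^sup>2"
      unfolding M_def k_def[symmetric] power_mult_distrib[symmetric] by (rule power_mono) simp
    have "op_apply (1 - \<pi> x) v = v - inverse M *\<^sub>R y"
      unfolding \<pi>x y_def by (simp add: op_apply_simps scaleC_of_real scaleR_bounded_op_apply del: of_real_inverse)
    moreover have "v = op_apply w (op_apply (1 - \<pi> x) v)"
      using w by (metis one_bounded_op.rep_eq times_bounded_op.rep_eq)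
    ultimately have "norm v \<le> norm w * norm (v - inverse M *\<^sub>R y)"
      using norm_op_apply_le by metis
    then have "(norm v)\<^sup>2 \<le> (norm w)\<^sup>2 * (norm (v - inverse M *\<^sub>R y))\<^sup>2"
      unfolding power_mult_distrib[symmetric] by (rule power_mono) simp
    also have "\<dots> \<le> c * (norm (v - inverse M *\<^sub>R y))\<^sup>2"
      using c by (intro mult_right_mono) auto
    also have "(norm (v - inverse M *\<^sub>R y))\<^sup>2 =
        (norm v)\<^sup>2 - 2 * inverse M * (norm (op_apply k v))\<^sup>2 + (inverse M)\<^sup>2 * (norm y)\<^sup>2"
    proof -
      have "cinner v (inverse M *\<^sub>R y) = complex_of_real (inverse M * (norm (op_apply k v))\<^sup>2)"
        by (simp only: scaleC_of_real[symmetric] cinner_scaleC_right complex_cnj_complex_of_real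
            \<open>cinner v y = _\<close> of_real_mult)
      then show ?thesis
        by (simp only: norm_diff_square Re_complex_of_real norm_scaleR power_mult_distrib power2_abs mult.assoc)
    qed
    also have "c * \<dots> \<le> c * ((norm v)\<^sup>2 - inverse M * (norm (op_apply k v))\<^sup>2)"
    proof (intro mult_left_mono)
      have "(inverse M)\<^sup>2 * (norm y)\<^sup>2 \<le> (inverse M)\<^sup>2 * (M * (norm (op_apply k v))\<^sup>2)"
        by (rule mult_left_mono[OF y2]) simp
      also have "\<dots> = inverse M * (norm (op_apply k v))\<^sup>2"
        using M(2) by (simp add: power2_eq_square)
      finally show "(norm v)\<^sup>2 - 2 * inverse M * (norm (op_apply k v))\<^sup>2 + (inverse M)\<^sup>2 * (norm y)\<^sup>2 \<le>
          (norm v)\<^sup>2 - inverse M * (norm (op_apply k v))\<^sup>2"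
        by simp
    qed (use c in simp)
    finally show ?thesis
      using M(2) by (simp add: field_simps)
  qed
  \<comment> \<open>Since \<open>c - 1\<close> is the square of \<open>norm w\<close>,
    \<open>r\<close> lies in \<open>[0, 1)\<close>. The previous estimate bounds the square of the
    norm of \<open>k\<close> by \<open>M * r\<close>, although it equals \<open>M\<close>.\<close>
  define r where "r = (c - 1) / c"
  have r: "0 \<le> r" "r < 1"
    using c(1) by (auto simp: r_def c_def)
  have Mr: "(sqrt (M * r))\<^sup>2 = M * r"
    using M(2) r(1) by simp
  have "norm k \<le> sqrt (M * r)"
  proof (rule norm_op_le)
    show nonneg: "0 \<le> sqrt (M * r)"
      using M(2) r(1) by simp
    fix v
    have "(norm (op_apply k v))\<^sup>2 \<le> M * r * (norm v)\<^sup>2"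
    proof -
      have "M * r * (norm v)\<^sup>2 = M * (c - 1) * (norm v)\<^sup>2 / c"
        by (simp add: r_def)
      then show ?thesis
        using bound[of v] c(1) by (simp only: pos_le_divide_eq mult.commute)
    qed
    then have "(norm (op_apply k v))\<^sup>2 \<le> (sqrt (M * r) * norm v)\<^sup>2"
      by (simp only: power_mult_distrib Mr)
    then show "norm (op_apply k v) \<le> sqrt (M * r) * norm v"
      by (rule power2_le_imp_le) (rule mult_nonneg_nonneg[OF nonneg norm_ge_zero])
  qed
  then have "(norm k)\<^sup>2 \<le> (sqrt (M * r))\<^sup>2"
    by (rule power_mono) simp
  then have "M \<le> M * r"
    unfolding Mr by (simp only: M_def k_def)
  then show False
    using mult_strict_left_mono[OF r(2) M(2)] by simp
qed

section \<open>Averaging operators\<close>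

lemma norm_ell2_mono:
  fixes f :: "('i, 'h::complex_hilbert_space) ell2" and g :: "('i, 'k::complex_hilbert_space) ell2"
  assumes "\<And>i. norm (ell2_apply f i) \<le> C * norm (ell2_apply g i)" "0 \<le> C"
  shows "norm f \<le> C * norm g"
  unfolding norm_ell2.rep_eq using ell2_apply[of g] assms by (intro ell2_scaled(2)) auto

lemma ell2_ell2_eqI:
  "(\<And>t x. ell2_apply (ell2_apply \<xi> t) x = ell2_apply (ell2_apply \<eta> t) x) \<Longrightarrow> \<xi> = \<eta>"
  by (intro ell2_eqI)

lemma pointwise_norm_ell2:
  fixes \<xi> :: "('g, ('x, 'k::complex_hilbert_space) ell2) ell2"
  obtains \<zeta> :: "('g, ('x, complex) ell2) ell2"
  where "\<And>t x. ell2_apply (ell2_apply \<zeta> t) x = complex_of_real (norm (ell2_apply (ell2_apply \<xi> t) x))"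
    "norm \<zeta> = norm \<xi>"
proof -
  define a :: "'g \<Rightarrow> ('x, complex) ell2"
    where "a t = Abs_ell2 (\<lambda>x. complex_of_real (norm (ell2_apply (ell2_apply \<xi> t) x)))" for t
  have a: "ell2_apply (a t) = (\<lambda>x. complex_of_real (norm (ell2_apply (ell2_apply \<xi> t) x)))" for t
    unfolding a_def using ell2_apply[of "ell2_apply \<xi> t"] by (intro Abs_ell2_inverse) simp
  have norm_a: "norm (a t) = norm (ell2_apply \<xi> t)" for t
    by (simp add: norm_ell2.rep_eq a)
  have A: "ell2_apply (Abs_ell2 a) = a"
    using ell2_apply[of \<xi>] by (intro Abs_ell2_inverse) (simp add: norm_a)
  show ?thesis
    by (rule that[of "Abs_ell2 a"]) (simp_all add: A a norm_ell2.rep_eq[of "Abs_ell2 a"] norm_a norm_ell2.rep_eq[of \<xi>])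
qed

text \<open>Replacing every entry of a vector by its norm does not change the norm of the vector, so
  an entrywise comparison with a scalar operator on such nonnegative vectors compares operator
  norms.\<close>

lemma norm_op_dominated:
  fixes T :: "('g, ('x, 'k::complex_hilbert_space) ell2) ell2 bounded_op"
    and S :: "('g, ('x, complex) ell2) ell2 bounded_op"
  assumes C: "0 \<le> C"
    and dom: "\<And>\<xi> \<zeta> t x. (\<And>t x. ell2_apply (ell2_apply \<zeta> t) x = complex_of_real (norm (ell2_apply (ell2_apply \<xi> t) x)))
      \<Longrightarrow> norm (ell2_apply (ell2_apply (op_apply T \<xi>) t) x) \<le> C * cmod (ell2_apply (ell2_apply (op_apply S \<zeta>) t) x)"
  shows "norm T \<le> C * norm S"
proof (rule norm_op_le)
  fix \<xi> :: "('g, ('x, 'k) ell2) ell2"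
  obtain \<zeta> :: "('g, ('x, complex) ell2) ell2"
    where \<zeta>: "\<And>t x. ell2_apply (ell2_apply \<zeta> t) x = complex_of_real (norm (ell2_apply (ell2_apply \<xi> t) x))"
    and norm: "norm \<zeta> = norm \<xi>"
    using pointwise_norm_ell2 by blast
  have "norm (op_apply T \<xi>) \<le> C * norm (op_apply S \<zeta>)"
    by (intro norm_ell2_mono C dom \<zeta>)
  also have "\<dots> \<le> C * (norm S * norm \<xi>)"
    unfolding norm[symmetric] by (intro mult_left_mono norm_op_apply_le C)
  finally show "norm (op_apply T \<xi>) \<le> C * norm S * norm \<xi>"
    by (simp add: mult.assoc)
qed (use C in simp)

text \<open>\<open>lower\<close> and \<open>upper\<close> say that \<open>L\<close> is isometric for
  the supremum norm, so a convergent sequence of images comes from a uniformly convergent sequence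
  of functions. Meant for the two embeddings of continuous functions, into the tensor product and
  into the crossed product.\<close>

lemma closed_image_continuous_functions:
  fixes L :: "('x::topological_space \<Rightarrow> 'b::banach) \<Rightarrow> 'c::real_normed_vector"
  assumes diff: "\<And>F G. continuous_on UNIV F \<Longrightarrow> continuous_on UNIV G \<Longrightarrow> L (\<lambda>x. F x - G x) = L F - L G"
    and lower: "\<And>F x. continuous_on UNIV F \<Longrightarrow> norm (F x) \<le> norm (L F)"
    and upper: "\<And>F C. continuous_on UNIV F \<Longrightarrow> (\<And>x. norm (F x) \<le> C) \<Longrightarrow> norm (L F) \<le> C"
    and S: "closed S"
  shows "closed {L F | F. continuous_on UNIV F \<and> range F \<subseteq> S}"
  unfolding closed_sequential_limits
proof (intro allI impI, elim conjE)
  fix X T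
  assume "\<forall>n. X n \<in> {L F | F. continuous_on UNIV F \<and> range F \<subseteq> S}" and lim: "X \<longlonglongrightarrow> T"
  then have "\<forall>n. \<exists>F. X n = L F \<and> continuous_on UNIV F \<and> (\<forall>x. F x \<in> S)"
    by (auto simp: image_subset_iff)
  from choice[OF this] obtain F
    where F: "\<And>n. X n = L (F n)" "\<And>n. continuous_on UNIV (F n)" "\<And>n x. F n x \<in> S"
    by blast
  have "uniformly_Cauchy_on UNIV F"
    unfolding uniformly_Cauchy_on_def
  proof (intro allI impI)
    fix e :: real
    assume "0 < e"
    then obtain M where M: "\<And>m n. m \<ge> M \<Longrightarrow> n \<ge> M \<Longrightarrow> norm (X m - X n) < e"
      using CauchyD[OF LIMSEQ_imp_Cauchy[OF lim]] by blast
    have "norm (F m x - F n x) \<le> norm (X m - X n)" for m n x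
      using lower[OF continuous_on_diff[OF F(2)[of m] F(2)[of n]], of x] by (simp add: diff F)
    then show "\<exists>M. \<forall>x\<in>UNIV. \<forall>m\<ge>M. \<forall>n\<ge>M. dist (F m x) (F n x) < e"
      unfolding dist_norm using M le_less_trans by blast
  qed
  then obtain G where G: "uniform_limit UNIV F G sequentially"
    using Cauchy_uniformly_convergent uniformly_convergent_on_def by blast
  have cont: "continuous_on UNIV G"
    by (rule uniform_limit_theorem[OF _ G]) (use F(2) in auto)
  have "G x \<in> S" for x
    by (rule closed_sequentially[OF S _ tendsto_uniform_limitI[OF G]]) (auto simp: F(3))
  moreover have "X \<longlonglongrightarrow> L G"
  proof (rule LIMSEQ_I)
    fix e :: real
    assume e: "0 < e"
    then obtain M where M: "\<And>n x. n \<ge> M \<Longrightarrow> dist (F n x) (G x) < e / 2"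
      using uniform_limitD[OF G, of "e / 2"] unfolding eventually_sequentially by auto
    have "norm (X n - L G) \<le> e / 2" if "n \<ge> M" for n
      unfolding F(1) diff[OF F(2) cont, symmetric]
      by (rule upper[OF continuous_on_diff[OF F(2) cont]])
        (use M[OF that] in \<open>auto simp: dist_norm less_imp_le\<close>)
    then show "\<exists>M. \<forall>n\<ge>M. norm (X n - L G) < e"
      using e by (smt (verit) field_sum_of_halves)
  qed
  ultimately show "T \<in> {L F | F. continuous_on UNIV F \<and> range F \<subseteq> S}"
    using cont LIMSEQ_unique[OF lim] by blast
qed

lemma continuous_compact_bounded:
  fixes f :: "'x::topological_space \<Rightarrow> 'a::real_normed_vector"
  assumes "compact (UNIV :: 'x set)" "continuous_on UNIV f"
  obtains C where "\<And>x. norm (f x) \<le> C" "0 \<le> C"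
proof -
  have "bounded (range f)"
    using assms by (intro compact_imp_bounded compact_continuous_image)
  then show ?thesis
    using that unfolding bounded_iff by (metis norm_ge_zero order_trans rangeI)
qed

text \<open>The coefficients are values of \<open>F\<close> itself, so the approximant stays in any
  linear subspace that contains the range of \<open>F\<close>.\<close>

lemma partition_of_unity_approx:
  fixes F :: "'x::t2_space \<Rightarrow> 'a::real_normed_vector"
  assumes "compact (UNIV :: 'x set)" "continuous_on UNIV F" "0 < e"
  obtains P :: "'x set" and g :: "'x \<Rightarrow> 'x \<Rightarrow> real"
  where "finite P" "\<And>p. continuous_on UNIV (g p)"
    "\<And>x. norm ((\<Sum>p\<in>P. g p x *\<^sub>R F p) - F x) \<le> e"
proof -
  define U where "U p = {x. norm (F p - F x) < e}" for p
  have "open (U p)" for p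
    unfolding U_def using assms(2) by (intro open_Collect_less continuous_intros)
  moreover have "x \<in> U x" for x
    using assms(3) by (simp add: U_def)
  ultimately obtain P and g :: "'x \<Rightarrow> 'x \<Rightarrow> real"
    where P: "finite P" "\<And>p. continuous_on UNIV (g p)" "\<And>p x. 0 \<le> g p x"
      "\<And>x. (\<Sum>p\<in>P. g p x) = 1" "\<And>p x. g p x \<noteq> 0 \<Longrightarrow> x \<in> U p"
    using partition_of_unity[OF assms(1)] by metis
  have "norm ((\<Sum>p\<in>P. g p x *\<^sub>R F p) - F x) \<le> e" for x
    by (rule convex_combination_norm_diff_le[OF P(1) P(3) P(4)])
      (use P(5) in \<open>force simp: U_def\<close>)
  with P show ?thesis
    using that by blast
qed

text \<open>The copy of \<open>C(X)\<close> in the crossed product, for any coefficient space. For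
  complex coefficients it is the representation used in \<open>plump\<close>, so one set of lemmas
  covers both situations.\<close>

abbreviation mult_rep ::
    "('g::group_add \<Rightarrow> 'x \<Rightarrow> 'x) \<Rightarrow> ('x \<Rightarrow> complex) \<Rightarrow> ('g, ('x, 'k::complex_hilbert_space) ell2) ell2 bounded_op"
  where "mult_rep \<tau> \<equiv> regular_rep (\<lambda>f. tensor_op f 1) (fun_action \<tau>)"

text \<open>The map from the definition of \<open>plump\<close> with free coefficient space: the
  same \<open>s\<close> and \<open>g\<close> can act on scalar and on operator-valued
  elements.\<close>

definition averaging ::
    "('g::group_add \<Rightarrow> 'x \<Rightarrow> 'x) \<Rightarrow> 'j set \<Rightarrow> ('j \<Rightarrow> 'g) \<Rightarrow> ('j \<Rightarrow> 'x \<Rightarrow> real) \<Rightarrow>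
      ('g, ('x, 'k::complex_hilbert_space) ell2) ell2 bounded_op \<Rightarrow> ('g, ('x, 'k) ell2) ell2 bounded_op"
  where "averaging \<tau> J s g a = (\<Sum>j\<in>J. mult_rep \<tau> (\<lambda>x. complex_of_real (g j x)) * translation (s j) * a *
    star (translation (s j)) * mult_rep \<tau> (\<lambda>x. complex_of_real (g j x)))"

lemma averaging_add: "averaging \<tau> J s g (a + b) = averaging \<tau> J s g a + averaging \<tau> J s g b"
  and averaging_diff: "averaging \<tau> J s g (a - b) = averaging \<tau> J s g a - averaging \<tau> J s g b"
  by (simp_all add: averaging_def algebra_simps sum.distrib sum_subtractf)

lemma averaging_zero: "averaging \<tau> J s g 0 = 0"
  by (simp add: averaging_def)

lemma averaging_sum: "averaging \<tau> J s g (\<Sum>i\<in>I. a i) = (\<Sum>i\<in>I. averaging \<tau> J s g (a i))"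
  by (induction I rule: infinite_finite_induct) (simp_all add: averaging_add averaging_zero)

section \<open>Averaging for an action on a compact space\<close>

context
  fixes \<tau> :: "'g::group_add \<Rightarrow> 'x::t2_space \<Rightarrow> 'x"
  assumes \<tau>: "compact_space_action \<tau>"
begin

lemma compact_space: "compact (UNIV :: 'x set)"
  and action_zero: "\<tau> 0 x = x"
  and action_add: "\<tau> (s + t) x = \<tau> s (\<tau> t x)"
  and continuous_action: "continuous_on UNIV (\<tau> s)"
  using \<tau> by (auto simp: compact_space_action_def group_action_def)

lemma mult_rep_diag:
  fixes f :: "'x \<Rightarrow> complex" and \<xi> :: "('g, ('x, 'k::complex_hilbert_space) ell2) ell2"
  assumes "continuous_on UNIV f"
  shows "ell2_apply (ell2_apply (op_apply (mult_rep \<tau> f) \<xi>) t) x = f (\<tau> t x) *\<^sub>C ell2_apply (ell2_apply \<xi> t) x"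
    and "ell2_apply (op_apply (mult_rep \<tau> f) \<xi>) t = op_apply (tensor_op (f \<circ> \<tau> t) 1) (ell2_apply \<xi> t)"
proof -
  obtain C where C: "\<And>x. cmod (f x) \<le> C" "0 \<le> C"
    using continuous_compact_bounded[OF compact_space assms] by blast
  have le: "norm (f x *\<^sub>C (1 :: 'k bounded_op)) \<le> C" for x
    using mult_mono[OF C(1)[of x] norm_one_op C(2)] by (simp add: norm_scaleC)
  have "norm (tensor_op (f \<circ> h) (1 :: 'k bounded_op)) \<le> C" for h :: "'x \<Rightarrow> 'x"
    unfolding tensor_op_def by (rule norm_diag_op_le) (simp_all add: le C(2))
  then have b: "bounded (range (\<lambda>t. tensor_op (f \<circ> \<tau> (- (- t))) (1 :: 'k bounded_op)))"
    by (intro bounded_range_norm)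
  show eq: "ell2_apply (op_apply (mult_rep \<tau> f) \<xi>) t = op_apply (tensor_op (f \<circ> \<tau> t) 1) (ell2_apply \<xi> t)"
    using diag_op_apply[OF b] by (simp add: regular_rep_def fun_action_def)
  have "bounded (range (\<lambda>x. (f \<circ> \<tau> t) x *\<^sub>C (1 :: 'k bounded_op)))"
    by (rule bounded_range_norm[where C = C]) (simp add: le)
  then show "ell2_apply (ell2_apply (op_apply (mult_rep \<tau> f) \<xi>) t) x = f (\<tau> t x) *\<^sub>C ell2_apply (ell2_apply \<xi> t) x"
    unfolding eq by (simp add: tensor_op_def diag_op_apply op_apply_simps)
qed

lemmas mult_rep_apply = mult_rep_diag(1)

lemma mult_rep_one: "mult_rep \<tau> (\<lambda>_. 1) = 1"
  by (intro op_eqI ell2_ell2_eqI) (simp add: mult_rep_apply op_apply_simps)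

lemma star_mult_rep_real:
  assumes "continuous_on UNIV g"
  shows "star (mult_rep \<tau> (\<lambda>x. complex_of_real (g x))) = mult_rep \<tau> (\<lambda>x. complex_of_real (g x))"
  using assms
  by (intro star_eqI)
    (simp add: cinner_ell2_def mult_rep_apply continuous_on_of_real cinner_scaleC_left cinner_scaleC_right)

text \<open>Averaging is compression by the column of the operators
  \<open>star (translation (s j)) * G j\<close>, which is isometric because the squares of the
  \<open>g j\<close> sum to one.\<close>

lemma norm_averaging_le:
  fixes a :: "('g, ('x, 'k::complex_hilbert_space) ell2) ell2 bounded_op"
  assumes g: "\<And>j. j \<in> J \<Longrightarrow> continuous_on UNIV (g j)" "\<And>x. (\<Sum>j\<in>J. (g j x)\<^sup>2) = 1"
  shows "norm (averaging \<tau> J s g a) \<le> norm a"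
proof -
  define G :: "_ \<Rightarrow> ('g, ('x, 'k) ell2) ell2 bounded_op" where "G j = mult_rep \<tau> (\<lambda>x. complex_of_real (g j x))" for j
  have starG: "star (G j) = G j" if "j \<in> J" for j
    using star_mult_rep_real[OF g(1)[OF that]] by (simp add: G_def)
  define V where "V j = star (translation (s j)) * G j" for j
  have starV: "star (V j) = G j * translation (s j)" if "j \<in> J" for j
    using starG[OF that] by (simp add: V_def star_mult star_star)
  have "star (V j) * V j = G j * G j" if "j \<in> J" for j
  proof -
    have "star (V j) * V j = G j * (translation (s j) * translation (- s j)) * G j"
      unfolding starV[OF that] by (simp only: V_def star_translation mult.assoc)
    then show ?thesis
      by (simp add: translation_inverse)
  qed
  then have "(\<Sum>j\<in>J. star (V j) * V j) = (\<Sum>j\<in>J. G j * G j)"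
    by simp
  also have "\<dots> = 1"
  proof (intro op_eqI ell2_ell2_eqI)
    fix \<xi> :: "('g, ('x, 'k) ell2) ell2" and t x
    have "ell2_apply (ell2_apply (op_apply (\<Sum>j\<in>J. G j * G j) \<xi>) t) x =
        (\<Sum>j\<in>J. complex_of_real ((g j (\<tau> t x))\<^sup>2) *\<^sub>C ell2_apply (ell2_apply \<xi> t) x)"
      by (simp add: op_apply_sum ell2_apply_sum op_apply_simps G_def mult_rep_apply g(1)
          continuous_on_of_real scaleC_scaleC power2_eq_square)
    also have "\<dots> = complex_of_real (\<Sum>j\<in>J. (g j (\<tau> t x))\<^sup>2) *\<^sub>C ell2_apply (ell2_apply \<xi> t) x"
      by (simp add: complex_vector.scale_sum_left)
    finally show "ell2_apply (ell2_apply (op_apply (\<Sum>j\<in>J. G j * G j) \<xi>) t) x = ell2_apply (ell2_apply (op_apply 1 \<xi>) t) x"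
      by (simp add: g(2) op_apply_simps del: of_real_sum of_real_power)
  qed
  finally have "norm (\<Sum>j\<in>J. star (V j) * a * V j) \<le> norm a"
    by (rule norm_sum_star_mult_le)
  also have "(\<Sum>j\<in>J. star (V j) * a * V j) = averaging \<tau> J s g a"
    unfolding averaging_def by (rule sum.cong) (simp_all add: V_def G_def star_mult star_star star_mult_rep_real g(1) mult.assoc)
  finally show ?thesis .
qed

lemma averaging_apply:
  assumes "\<And>j. j \<in> J \<Longrightarrow> continuous_on UNIV (g j)"
  shows "ell2_apply (ell2_apply (op_apply (averaging \<tau> J s g a) \<xi>) t) x =
    (\<Sum>j\<in>J. complex_of_real (g j (\<tau> t x)) *\<^sub>C ell2_apply (ell2_apply (op_apply a
      (op_apply (translation (- s j)) (op_apply (mult_rep \<tau> (\<lambda>x. complex_of_real (g j x))) \<xi>))) (- s j + t)) x)"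
  using assms
  by (simp add: averaging_def op_apply_sum ell2_apply_sum op_apply_simps mult_rep_apply translation_apply
      continuous_on_of_real star_translation)

text \<open>Each summand is a translation by the conjugate of \<open>r\<close> under
  \<open>s j\<close>, with weight a product of two values of \<open>g j\<close>; for nonnegative
  \<open>g j\<close> all weights are nonnegative.\<close>

lemma averaging_translation_apply:
  assumes "\<And>j. j \<in> J \<Longrightarrow> continuous_on UNIV (g j)"
  shows "ell2_apply (ell2_apply (op_apply (averaging \<tau> J s g (translation r)) \<xi>) t) x =
    (\<Sum>j\<in>J. complex_of_real (g j (\<tau> t x) * g j (\<tau> (s j + (- r + (- s j + t))) x)) *\<^sub>C
      ell2_apply (ell2_apply \<xi> (s j + (- r + (- s j + t)))) x)"
  using assms
  by (simp add: averaging_apply mult_rep_apply translation_apply continuous_on_of_real scaleC_scaleC)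

text \<open>Conjugation by translations permutes the diagonal blocks, and the multipliers are block
  diagonal, so averaging commutes with compression to the diagonal.\<close>

lemma conditional_expectation_averaging:
  fixes a :: "('g, ('x, 'k::complex_hilbert_space) ell2) ell2 bounded_op"
  assumes "\<And>j. j \<in> J \<Longrightarrow> continuous_on UNIV (g j)"
  shows "conditional_expectation (averaging \<tau> J s g a) = averaging \<tau> J s g (conditional_expectation a)"
proof (intro op_eqI ell2_ell2_eqI)
  fix \<xi> :: "('g, ('x, 'k) ell2) ell2" and t x
  define G :: "_ \<Rightarrow> ('g, ('x, 'k) ell2) ell2 bounded_op" where "G j = mult_rep \<tau> (\<lambda>x. complex_of_real (g j x))" for j
  have single: "op_apply (translation (- s j)) (op_apply (G j) (ell2_single t h)) =
      ell2_single (- s j + t) (ell2_apply (op_apply (G j) (ell2_single t h)) t)" if "j \<in> J" for j h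
    by (rule ell2_ell2_eqI)
      (use that assms in \<open>auto simp: G_def translation_apply mult_rep_apply continuous_on_of_real
        ell2_single.rep_eq zero_ell2.rep_eq\<close>)
  have avg: "ell2_apply (ell2_apply (op_apply (averaging \<tau> J s g b) \<zeta>) t) x =
    (\<Sum>j\<in>J. complex_of_real (g j (\<tau> t x)) *\<^sub>C ell2_apply (ell2_apply (op_apply b
      (op_apply (translation (- s j)) (op_apply (G j) \<zeta>))) (- s j + t)) x)"
    for b and \<zeta> :: "('g, ('x, 'k) ell2) ell2"
    unfolding G_def by (rule averaging_apply) (rule assms)
  show "ell2_apply (ell2_apply (op_apply (conditional_expectation (averaging \<tau> J s g a)) \<xi>) t) x =
      ell2_apply (ell2_apply (op_apply (averaging \<tau> J s g (conditional_expectation a)) \<xi>) t) x"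
    unfolding avg conditional_expectation_apply block_op_apply
  proof (rule sum.cong)
    fix j
    assume j: "j \<in> J"
    have "ell2_apply (op_apply (G j) (ell2_single t (ell2_apply \<xi> t))) t = ell2_apply (op_apply (G j) \<xi>) t"
      using assms[OF j] by (simp add: G_def mult_rep_diag(2) continuous_on_of_real ell2_single.rep_eq)
    then show "complex_of_real (g j (\<tau> t x)) *\<^sub>C ell2_apply (ell2_apply (op_apply a (op_apply (translation (- s j))
          (op_apply (G j) (ell2_single t (ell2_apply \<xi> t))))) (- s j + t)) x =
        complex_of_real (g j (\<tau> t x)) *\<^sub>C ell2_apply (ell2_apply (op_apply a (ell2_single (- s j + t)
          (ell2_apply (op_apply (translation (- s j)) (op_apply (G j) \<xi>)) (- s j + t)))) (- s j + t)) x"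
      using single[OF j, of "ell2_apply \<xi> t"] by (simp add: translation_apply add.assoc[symmetric])
  qed simp
qed

end

section \<open>Coordinates in the crossed product\<close>

locale crossed_system =
  fixes \<tau> :: "'g::group_add \<Rightarrow> 'x::t2_space \<Rightarrow> 'x"
    and \<beta> :: "'g \<Rightarrow> 'b::{cstar_algebra, real_normed_algebra_1} \<Rightarrow> 'b"
    and \<sigma> :: "'b \<Rightarrow> 'k::complex_hilbert_space bounded_op"
  assumes space_action: "compact_space_action \<tau>"
    and algebra_action: "cstar_action \<beta>"
    and representation: "faithful_rep \<sigma>"
begin

lemmas compact_X = compact_space[OF space_action]
  and \<tau>_zero = action_zero[OF space_action]
  and \<tau>_add = action_add[OF space_action]
  and continuous_\<tau> = continuous_action[OF space_action]

lemma star_hom_\<sigma>: "star_hom \<sigma>" and \<sigma>_one: "\<sigma> 1 = 1" and norm_\<sigma>: "norm (\<sigma> b) = norm b"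
  using representation by (auto simp: faithful_rep_def)

lemma star_hom_\<beta>: "star_hom (\<beta> s)" and \<beta>_zero: "\<beta> 0 b = b" and \<beta>_add: "\<beta> (s + t) b = \<beta> s (\<beta> t b)"
  using algebra_action by (auto simp: cstar_action_def group_action_def)

lemmas \<sigma>_simps = star_hom_add[OF star_hom_\<sigma>] star_hom_diff[OF star_hom_\<sigma>] star_hom_scaleC[OF star_hom_\<sigma>]
  star_hom_mult[OF star_hom_\<sigma>] star_hom_star[OF star_hom_\<sigma>] star_hom_zero[OF star_hom_\<sigma>]
  star_hom_sum[OF star_hom_\<sigma>]

lemmas \<beta>_simps = star_hom_add[OF star_hom_\<beta>] star_hom_diff[OF star_hom_\<beta>] star_hom_scaleC[OF star_hom_\<beta>]
  star_hom_mult[OF star_hom_\<beta>] star_hom_star[OF star_hom_\<beta>] star_hom_zero[OF star_hom_\<beta>]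
  star_hom_sum[OF star_hom_\<beta>]

lemma inj_\<sigma>: "inj \<sigma>"
proof (rule injI)
  fix a b
  assume "\<sigma> a = \<sigma> b"
  then have "norm (\<sigma> (a - b)) = 0"
    by (simp add: \<sigma>_simps)
  then show "a = b"
    by (simp add: norm_\<sigma>)
qed

lemma \<beta>_minus: "\<beta> s (\<beta> (- s) b) = b" "\<beta> (- s) (\<beta> s b) = b"
  by (simp_all add: \<beta>_add[symmetric] \<beta>_zero)

text \<open>\<open>star_hom\<close> does not include unitality; here it follows from surjectivity,
  as \<open>\<beta> s 1\<close> is a left unit for the range of \<open>\<beta> s\<close>.\<close>

lemma \<beta>_one: "\<beta> s 1 = 1"
proof -
  have "\<beta> s 1 = \<beta> s 1 * \<beta> s (\<beta> (- s) 1)"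
    by (simp add: \<beta>_minus)
  also have "\<dots> = \<beta> s (1 * \<beta> (- s) 1)"
    by (simp only: \<beta>_simps)
  finally show ?thesis
    by (simp add: \<beta>_minus)
qed

text \<open>Composing with the isometric \<open>\<sigma>\<close> gives a unital representation on a
  Hilbert space, which is contractive; the inverse automorphism gives the other inequality.\<close>

lemma norm_\<beta>: "norm (\<beta> s b) = norm b"
proof -
  have le: "norm (\<beta> s b) \<le> norm b" for s b
  proof -
    have "star_hom (\<lambda>b. \<sigma> (\<beta> s b))"
      by (simp add: star_hom_def \<sigma>_simps \<beta>_simps)
    then have "norm (\<sigma> (\<beta> s b)) \<le> norm b"
      by (rule star_hom_norm_le) (simp add: \<beta>_one \<sigma>_one)
    then show ?thesis
      by (simp add: norm_\<sigma>)
  qed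
  show ?thesis
    using le[of s b] le[of "- s" "\<beta> s b"] by (simp add: \<beta>_minus)
qed

lemma continuous_\<beta>: "continuous_on UNIV (\<beta> s)"
proof -
  have "bounded_clinear (\<beta> s)"
    by (rule bounded_clinearI[where K = 1]) (simp_all add: \<beta>_simps norm_\<beta>)
  then show ?thesis
    by (rule bounded_linear.continuous_on[OF bounded_clinear_bounded_linear continuous_on_id])
qed

lemma continuous_translate:
  assumes "continuous_on UNIV F"
  shows "continuous_on UNIV (\<lambda>x. \<beta> s (F (\<tau> t x)))"
proof -
  have "continuous_on UNIV (\<lambda>x. F (\<tau> t x))"
    by (rule continuous_on_compose2[OF assms continuous_\<tau>]) simp
  then show ?thesis
    by (rule continuous_on_compose2[OF continuous_\<beta>]) simp
qed

lemma continuous_scaleC: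
  fixes F :: "'x \<Rightarrow> 'a::complex_normed_vector"
  assumes "continuous_on UNIV f" "continuous_on UNIV F"
  shows "continuous_on UNIV (\<lambda>x. f x *\<^sub>C F x)"
proof -
  have eq: "c *\<^sub>C v = Re c *\<^sub>R v + Im c *\<^sub>R (\<i> *\<^sub>C v)" for c and v :: 'a
    by (subst complex_eq[of c])
      (simp only: scaleC_add_left scaleC_scaleC scaleC_of_real[symmetric] mult.commute[of \<i>])
  have "bounded_linear ((*\<^sub>C) \<i> :: 'a \<Rightarrow> 'a)"
    by (rule bounded_clinear_bounded_linear, rule bounded_clinearI[where K = 1])
      (auto simp: scaleC_add_right scaleC_scaleC norm_scaleC mult.commute)
  then have "continuous_on UNIV (\<lambda>x. \<i> *\<^sub>C F x)"
    using assms(2) by (rule bounded_linear.continuous_on)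
  then show ?thesis
    unfolding eq[of "f _"] using assms by (intro continuous_intros)
qed

section \<open>Continuous functions with values in \<open>B\<close> as block diagonal
  operators\<close>

lemma bounded_cont:
  assumes "continuous_on UNIV (F :: 'x \<Rightarrow> 'b)"
  obtains C where "\<And>x. norm (F x) \<le> C" "0 \<le> C"
  using continuous_compact_bounded[OF compact_X assms] by blast

definition Cop :: "('x \<Rightarrow> 'b) \<Rightarrow> ('x, 'k) ell2 bounded_op"
  where "Cop F = diag_op (\<lambda>x. \<sigma> (F x))"

lemma bounded_\<sigma>:
  fixes F :: "'x \<Rightarrow> 'b"
  assumes "continuous_on UNIV F"
  shows "bounded (range (\<lambda>x. \<sigma> (F x)))"
proof -
  obtain C where "\<And>x. norm (F x) \<le> C"
    using bounded_cont[OF assms] by blast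
  then show ?thesis
    by (intro bounded_range_norm[where C = C]) (simp add: norm_\<sigma>)
qed

lemma Cop_apply: "continuous_on UNIV F \<Longrightarrow> ell2_apply (op_apply (Cop F) \<zeta>) x = op_apply (\<sigma> (F x)) (ell2_apply \<zeta> x)"
  unfolding Cop_def by (rule diag_op_apply[OF bounded_\<sigma>])

lemma norm_Cop_le: "(\<And>x. norm (F x) \<le> C) \<Longrightarrow> norm (Cop F) \<le> C"
  unfolding Cop_def using order_trans[OF norm_ge_zero] by (intro norm_diag_op_le) (auto simp: norm_\<sigma>)

lemma block_op_Cop: "continuous_on UNIV F \<Longrightarrow> block_op x x (Cop F) = \<sigma> (F x)"
  unfolding Cop_def by (rule block_op_diag_op[OF bounded_\<sigma>])

lemma norm_le_Cop: "continuous_on UNIV F \<Longrightarrow> norm (F x) \<le> norm (Cop F)"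
  using norm_block_op_le[of x x "Cop F"] by (simp add: block_op_Cop norm_\<sigma>)

lemma diagonal_action_Cop:
  "continuous_on UNIV F \<Longrightarrow> diagonal_action \<tau> \<beta> \<sigma> s (Cop F) = Cop (\<lambda>x. \<beta> s (F (\<tau> (- s) x)))"
  by (simp add: diagonal_action_def block_op_Cop inv_f_f[OF inj_\<sigma>] Cop_def[of "\<lambda>x. \<beta> s (F (\<tau> (- s) x))"])

lemma Cop_diff:
  "continuous_on UNIV F \<Longrightarrow> continuous_on UNIV G \<Longrightarrow> Cop (\<lambda>x. F x - G x) = Cop F - Cop G"
  by (intro op_eqI ell2_eqI)
    (simp add: Cop_apply continuous_on_diff \<sigma>_simps op_apply_simps ell2_apply_simps)

lemma Cop_add:
  "continuous_on UNIV F \<Longrightarrow> continuous_on UNIV G \<Longrightarrow> Cop (\<lambda>x. F x + G x) = Cop F + Cop G"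
  by (intro op_eqI ell2_eqI)
    (simp add: Cop_apply continuous_on_add \<sigma>_simps op_apply_simps ell2_apply_simps)

lemma Cop_scaleC: "continuous_on UNIV F \<Longrightarrow> Cop (\<lambda>x. c *\<^sub>C F x) = c *\<^sub>C Cop F"
  by (intro op_eqI ell2_eqI)
    (simp add: Cop_apply continuous_scaleC \<sigma>_simps op_apply_simps ell2_apply_simps)

lemma tensor_op_Cop: "tensor_op f (\<sigma> b) = Cop (\<lambda>x. f x *\<^sub>C b)"
  by (simp add: tensor_op_def Cop_def \<sigma>_simps)

text \<open>The spatial tensor product of \<open>C(X)\<close> and \<open>S\<close> is the algebra of
  continuous functions from \<open>X\<close> to \<open>S\<close>. Isometry of \<open>Cop\<close>
  makes the right side closed, and partitions of unity approximate its elements by sums of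
  elementary tensors \<open>g \<otimes> F p\<close>.\<close>

lemma min_tensor_eq:
  assumes S: "csubspace S" "closed S"
  shows "min_tensor \<sigma> S = {Cop F | F. continuous_on UNIV F \<and> range F \<subseteq> S}" (is "_ = ?C")
proof
  have "closed ?C"
    by (rule closed_image_continuous_functions[OF Cop_diff norm_le_Cop norm_Cop_le S(2)])
  moreover have "csubspace ?C"
  proof (rule complex_vector.subspaceI)
    have "0 = Cop (\<lambda>_. 0)"
      by (intro op_eqI ell2_eqI) (simp add: Cop_apply \<sigma>_simps op_apply_simps ell2_apply_simps)
    then show "0 \<in> ?C"
      using complex_vector.subspace_0[OF S(1)] by (auto intro!: exI[of _ "\<lambda>_. 0"])
  next
    fix a b
    assume "a \<in> ?C" "b \<in> ?C"
    then obtain F G where "a = Cop F" "b = Cop G" "continuous_on UNIV F" "continuous_on UNIV G"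
      "range F \<subseteq> S" "range G \<subseteq> S"
      by blast
    then show "a + b \<in> ?C"
      using complex_vector.subspace_add[OF S(1)]
      by (auto simp: Cop_add[symmetric] intro!: exI[of _ "\<lambda>x. F x + G x"] continuous_on_add)
  next
    fix c a
    assume "a \<in> ?C"
    then obtain F where "a = Cop F" "continuous_on UNIV F" "range F \<subseteq> S"
      by blast
    then show "c *\<^sub>C a \<in> ?C"
      using complex_vector.subspace_scale[OF S(1)]
      by (auto simp: Cop_scaleC[symmetric] intro!: exI[of _ "\<lambda>x. c *\<^sub>C F x"] continuous_scaleC)
  qed
  moreover have "{tensor_op f (\<sigma> b) | f b. f \<in> cont_funs \<and> b \<in> S} \<subseteq> ?C"
    unfolding tensor_op_Cop cont_funs_def
    using complex_vector.subspace_scale[OF S(1)] by (auto intro!: continuous_scaleC)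
  ultimately show "min_tensor \<sigma> S \<subseteq> ?C"
    unfolding min_tensor_def by (intro closure_minimal complex_vector.span_minimal)
next
  show "?C \<subseteq> min_tensor \<sigma> S"
  proof
    fix a
    assume "a \<in> ?C"
    then obtain F where F: "a = Cop F" "continuous_on UNIV F" "range F \<subseteq> S"
      by blast
    show "a \<in> min_tensor \<sigma> S"
    proof (rule closed_memI)
      show "closed (min_tensor \<sigma> S :: ('x, 'k) ell2 bounded_op set)"
        unfolding min_tensor_def by (rule closed_closure)
      fix e :: real
      assume "0 < e"
      then obtain P and g :: "'x \<Rightarrow> 'x \<Rightarrow> real" where P: "finite P" "\<And>p. continuous_on UNIV (g p)"
        "\<And>x. norm ((\<Sum>p\<in>P. g p x *\<^sub>R F p) - F x) \<le> e"
        using partition_of_unity_approx[OF compact_X F(2)] by metis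
      define G where "G x = (\<Sum>p\<in>P. complex_of_real (g p x) *\<^sub>C F p)" for x
      have G: "continuous_on UNIV G"
        unfolding G_def by (intro continuous_on_sum continuous_scaleC continuous_on_of_real P(2)) simp
      have "Cop G = (\<Sum>p\<in>P. tensor_op (\<lambda>x. complex_of_real (g p x)) (\<sigma> (F p)))"
        by (intro op_eqI ell2_eqI)
          (simp add: Cop_apply[OF G] tensor_op_Cop op_apply_sum ell2_apply_sum Cop_apply continuous_scaleC
            continuous_on_of_real P(2) G_def \<sigma>_simps)
      also have "\<dots> \<in> cspan {tensor_op f (\<sigma> b) | f b. f \<in> cont_funs \<and> b \<in> S}"
      proof (intro complex_vector.span_sum complex_vector.span_base CollectI exI conjI)
        fix p
        show "(\<lambda>x. complex_of_real (g p x)) \<in> cont_funs"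
          using P(2) by (simp add: cont_funs_def continuous_on_of_real)
      qed (use F(3) in auto)
      finally have "Cop G \<in> min_tensor \<sigma> S"
        unfolding min_tensor_def using closure_subset by blast
      moreover have "norm (a - Cop G) \<le> e"
        unfolding F(1) Cop_diff[OF F(2) G, symmetric]
        by (rule norm_Cop_le) (use P(3) in \<open>simp add: G_def scaleC_of_real norm_minus_commute\<close>)
      ultimately show "\<exists>y\<in>min_tensor \<sigma> S. norm (a - y) \<le> e"
        by blast
    qed
  qed
qed

section \<open>The regular representation of \<open>C(X, B)\<close> and the algebraic crossed
  product\<close>

definition Pop :: "('x \<Rightarrow> 'b) \<Rightarrow> ('g, ('x, 'k) ell2) ell2 bounded_op"
  where "Pop F = regular_rep id (diagonal_action \<tau> \<beta> \<sigma>) (Cop F)"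

lemma Pop_eq: "continuous_on UNIV F \<Longrightarrow> Pop F = diag_op (\<lambda>t. Cop (\<lambda>x. \<beta> (- t) (F (\<tau> t x))))"
  by (simp add: Pop_def regular_rep_def diagonal_action_Cop)

lemma bounded_Pop:
  assumes "continuous_on UNIV F"
  shows "bounded (range (\<lambda>t. Cop (\<lambda>x. \<beta> (- t) (F (\<tau> t x)))))"
proof -
  obtain C where C: "\<And>x. norm (F x) \<le> C"
    using bounded_cont[OF assms] by blast
  show ?thesis
    by (rule bounded_range_norm[where C = C]) (rule norm_Cop_le, simp add: norm_\<beta> C)
qed

lemma Pop_apply:
  assumes "continuous_on UNIV F"
  shows "ell2_apply (ell2_apply (op_apply (Pop F) \<xi>) t) x = op_apply (\<sigma> (\<beta> (- t) (F (\<tau> t x)))) (ell2_apply (ell2_apply \<xi> t) x)"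
  by (simp add: Pop_eq[OF assms] diag_op_apply[OF bounded_Pop[OF assms]] Cop_apply continuous_translate assms)

lemma norm_Pop_le:
  assumes "continuous_on UNIV F" "\<And>x. norm (F x) \<le> C"
  shows "norm (Pop F) \<le> C"
  unfolding Pop_eq[OF assms(1)] using order_trans[OF norm_ge_zero assms(2)]
  by (intro norm_diag_op_le norm_Cop_le) (auto simp: norm_\<beta> assms(2))

lemma norm_le_Pop:
  assumes "continuous_on UNIV F"
  shows "norm (F x) \<le> norm (Pop F)"
proof -
  have "block_op 0 0 (Pop F) = Cop F"
    unfolding Pop_eq[OF assms] block_op_diag_op[OF bounded_Pop[OF assms]] by (simp add: \<beta>_zero \<tau>_zero)
  then show ?thesis
    using norm_block_op_le[of 0 0 "Pop F"] norm_le_Cop[OF assms, of x] by simp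
qed

lemma Pop_diff:
  "continuous_on UNIV F \<Longrightarrow> continuous_on UNIV G \<Longrightarrow> Pop (\<lambda>x. F x - G x) = Pop F - Pop G"
  by (intro op_eqI ell2_ell2_eqI)
    (simp add: Pop_apply continuous_on_diff \<sigma>_simps \<beta>_simps op_apply_simps ell2_apply_simps)

lemma Pop_add:
  "continuous_on UNIV F \<Longrightarrow> continuous_on UNIV G \<Longrightarrow> Pop (\<lambda>x. F x + G x) = Pop F + Pop G"
  by (intro op_eqI ell2_ell2_eqI)
    (simp add: Pop_apply continuous_on_add \<sigma>_simps \<beta>_simps op_apply_simps ell2_apply_simps)

lemma Pop_mult:
  "continuous_on UNIV F \<Longrightarrow> continuous_on UNIV G \<Longrightarrow> Pop (\<lambda>x. F x * G x) = Pop F * Pop G"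
  by (intro op_eqI ell2_ell2_eqI)
    (simp add: Pop_apply continuous_on_mult \<sigma>_simps \<beta>_simps op_apply_simps)

lemma Pop_scaleC: "continuous_on UNIV F \<Longrightarrow> Pop (\<lambda>x. c *\<^sub>C F x) = c *\<^sub>C Pop F"
  by (intro op_eqI ell2_ell2_eqI)
    (simp add: Pop_apply continuous_scaleC \<sigma>_simps \<beta>_simps op_apply_simps ell2_apply_simps)

lemma Pop_zero: "Pop (\<lambda>_. 0) = 0"
  by (intro op_eqI ell2_ell2_eqI)
    (simp add: Pop_apply \<sigma>_simps \<beta>_simps op_apply_simps ell2_apply_simps)

lemma star_Pop_const: "star (Pop (\<lambda>_. b)) = Pop (\<lambda>_. star b)"
proof (rule star_eqI)
  show "cinner (op_apply (Pop (\<lambda>_. b)) \<xi>) \<eta> = cinner \<xi> (op_apply (Pop (\<lambda>_. star b)) \<eta>)" for \<xi> \<eta>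
    unfolding cinner_ell2_def by (simp add: Pop_apply cinner_star \<sigma>_simps \<beta>_simps)
qed

lemma translation_Pop_const: "translation s * Pop (\<lambda>_. b) * translation (- s) = Pop (\<lambda>_. \<beta> s b)"
proof (intro op_eqI ell2_ell2_eqI)
  fix \<xi> t x
  have "- (- s + t) = - t + s" "- (- s) + (- s + t) = t"
    by (simp_all only: minus_add minus_minus add.assoc[symmetric] right_minus add_0_left)
  then show "ell2_apply (ell2_apply (op_apply (translation s * Pop (\<lambda>_. b) * translation (- s)) \<xi>) t) x =
      ell2_apply (ell2_apply (op_apply (Pop (\<lambda>_. \<beta> s b)) \<xi>) t) x"
    by (simp only: times_bounded_op.rep_eq translation_apply Pop_apply[OF continuous_on_const] \<beta>_add)
qed

lemma conditional_expectation_Pop_translation: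
  assumes "continuous_on UNIV F"
  shows "conditional_expectation (Pop F * translation s) = (if s = 0 then Pop F else 0)"
  unfolding Pop_def
  by (rule conditional_expectation_regular_rep)
    (use bounded_Pop[OF assms] in \<open>simp add: diagonal_action_Cop[OF assms]\<close>)

lemma fourier_component_Pop_translation:
  assumes "continuous_on UNIV F"
  shows "fourier_component r (Pop F * translation s) = (if s = r then Pop F * translation s else 0)"
proof -
  have "Pop F * translation s * translation (- r) = Pop F * translation (s + - r)"
    by (simp only: translation_add mult.assoc)
  then show ?thesis
    using conditional_expectation_Pop_translation[OF assms, of "s + - r"]
    by (simp add: fourier_component_def)
qed

definition crossed_span :: "'b set \<Rightarrow> ('g, ('x, 'k) ell2) ell2 bounded_op set"
  where "crossed_span S = cspan {Pop F * translation s | F s. continuous_on UNIV F \<and> range F \<subseteq> S}"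

lemma reduced_crossed_product_eq:
  assumes "csubspace S" "closed S"
  shows "reduced_crossed_product id (diagonal_action \<tau> \<beta> \<sigma>) (min_tensor \<sigma> S) = closure (crossed_span S)"
proof -
  have "{regular_rep id (diagonal_action \<tau> \<beta> \<sigma>) c * translation s | c s. c \<in> min_tensor \<sigma> S} =
      {Pop F * translation s | F s. continuous_on UNIV F \<and> range F \<subseteq> S}"
    (is "?L = ?R")
  proof (intro set_eqI iffI)
    fix a
    assume "a \<in> ?L"
    then obtain c s where "a = regular_rep id (diagonal_action \<tau> \<beta> \<sigma>) c * translation s" "c \<in> min_tensor \<sigma> S"
      by auto
    moreover from this(2) obtain F where "c = Cop F" "continuous_on UNIV F" "range F \<subseteq> S"
      unfolding min_tensor_eq[OF assms] by auto
    ultimately show "a \<in> ?R"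
      unfolding Pop_def by (intro CollectI exI[of _ F] exI[of _ s]) simp
  next
    fix a
    assume "a \<in> ?R"
    then obtain F s where F: "a = Pop F * translation s" "continuous_on UNIV F" "range F \<subseteq> S"
      by auto
    then have "Cop F \<in> min_tensor \<sigma> S"
      unfolding min_tensor_eq[OF assms] by auto
    with F(1) show "a \<in> ?L"
      unfolding Pop_def by (intro CollectI exI[of _ "Cop F"] exI[of _ s]) simp
  qed
  then show ?thesis
    by (simp add: reduced_crossed_product_def crossed_span_def)
qed

text \<open>The index \<open>0\<close> is forced into \<open>T\<close>, with zero coefficient if
  need be, so that the expectation can be read off as \<open>Pop (H 0)\<close>.\<close>

lemma crossed_span_repr:
  assumes "a \<in> crossed_span UNIV"
  shows "\<exists>T H. finite T \<and> 0 \<in> T \<and> (\<forall>s. continuous_on UNIV (H s)) \<and> a = (\<Sum>s\<in>T. Pop (H s) * translation s)"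
proof -
  \<comment> \<open>The induction needs \<open>H\<close> to vanish off \<open>T\<close>: a new term
    at \<open>r\<close> is then added to \<open>H r\<close> without asking whether \<open>r\<close>
    already belongs to \<open>T\<close>.\<close>
  have "\<exists>T H. finite T \<and> 0 \<in> T \<and> (\<forall>s. continuous_on UNIV (H s)) \<and> (\<forall>s. s \<notin> T \<longrightarrow> H s = (\<lambda>_. 0)) \<and>
      a = (\<Sum>s\<in>T. Pop (H s) * translation s)"
    using assms unfolding crossed_span_def
  proof (induction rule: complex_vector.span_induct_alt)
    case base
    show ?case
      by (rule exI[of _ "{0}"], rule exI[of _ "\<lambda>_ _. 0"]) (simp add: Pop_zero)
  next
    case (step c x y)
    obtain F r where F: "x = Pop F * translation r" "continuous_on UNIV F"
      using step(1) by blast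
    obtain T H where T: "finite T" "0 \<in> T" "\<And>s. continuous_on UNIV (H s)" "\<And>s. s \<notin> T \<Longrightarrow> H s = (\<lambda>_. 0)"
      "y = (\<Sum>s\<in>T. Pop (H s) * translation s)"
      using step(2) by blast
    define H' where "H' = H(r := \<lambda>x. c *\<^sub>C F x + H r x)"
    have y: "y = (\<Sum>s\<in>insert r T. Pop (H s) * translation s)"
      unfolding T(5) using T(1,4) by (intro sum.mono_neutral_left) (auto simp: Pop_zero)
    have "Pop (H' r) = c *\<^sub>C Pop F + Pop (H r)"
      unfolding H'_def using F(2) T(3) by (simp add: Pop_add Pop_scaleC continuous_scaleC)
    moreover have "(\<Sum>s\<in>insert r T - {r}. Pop (H' s) * translation s) = (\<Sum>s\<in>insert r T - {r}. Pop (H s) * translation s)"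
      by (rule sum.cong) (auto simp: H'_def)
    ultimately have "c *\<^sub>C x + y = (\<Sum>s\<in>insert r T. Pop (H' s) * translation s)"
      unfolding y F(1) using T(1)
      by (simp add: sum.remove[of "insert r T" r] scaleC_mult_left distrib_right add.assoc)
    moreover have "continuous_on UNIV (H' s)" for s
      using T(3) F(2) by (auto simp: H'_def intro!: continuous_on_add continuous_scaleC)
    ultimately show ?case
      using T by (intro exI[of _ "insert r T"] exI[of _ H']) (auto simp: H'_def)
  qed
  then show ?thesis
    by blast
qed

lemma conditional_expectation_sum_Pop:
  assumes "finite T" "0 \<in> T" "\<forall>s. continuous_on UNIV (H s)"
  shows "conditional_expectation (\<Sum>s\<in>T. Pop (H s) * translation s) = Pop (H 0)"
  using assms by (simp add: conditional_expectation_sum conditional_expectation_Pop_translation)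

lemma crossed_span_finite_propagation: "crossed_span UNIV \<subseteq> finite_propagation"
proof
  fix a
  assume "a \<in> crossed_span UNIV"
  then obtain T H where T: "finite T" "0 \<in> T" "\<forall>s. continuous_on UNIV (H s)"
    "a = (\<Sum>s\<in>T. Pop (H s) * translation s)"
    using crossed_span_repr by blast
  have "fourier_component r a = Pop (H r) * translation r" if "r \<in> T" for r
  proof -
    have "fourier_component r a = (\<Sum>s\<in>T. fourier_component r (Pop (H s) * translation s))"
      by (simp add: T(4) fourier_component_def sum_distrib_right conditional_expectation_sum)
    then show ?thesis
      using T(1,3) that by (simp add: fourier_component_Pop_translation)
  qed
  then have "a = (\<Sum>s\<in>T. fourier_component s a)"
    using T(4) by simp
  then show "a \<in> finite_propagation"
    using T(1) by (auto simp: finite_propagation_def)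
qed

text \<open>The expectation is contractive and sends the dense algebraic crossed product into the
  range of \<open>Pop\<close>, which is closed because \<open>Pop\<close> is isometric.\<close>

lemma conditional_expectation_crossed_product:
  assumes "a \<in> closure (crossed_span UNIV)"
  obtains F where "continuous_on UNIV F" "conditional_expectation a = Pop F"
proof -
  have "closed {Pop F | F. continuous_on UNIV F \<and> range F \<subseteq> UNIV}"
    by (rule closed_image_continuous_functions[OF Pop_diff norm_le_Pop norm_Pop_le closed_UNIV])
  then have "conditional_expectation a \<in> {Pop F | F. continuous_on UNIV F \<and> range F \<subseteq> UNIV}"
  proof (rule closed_memI)
    fix e :: real
    assume "0 < e"
    then obtain b where b: "b \<in> crossed_span UNIV" "norm (a - b) < e"
      using closure_normD[OF assms] by blast
    obtain T H where "finite T" "0 \<in> T" "\<forall>s. continuous_on UNIV (H s)" "b = (\<Sum>s\<in>T. Pop (H s) * translation s)"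
      using crossed_span_repr[OF b(1)] by blast
    then have "conditional_expectation b \<in> {Pop F | F. continuous_on UNIV F \<and> range F \<subseteq> UNIV}"
      using conditional_expectation_sum_Pop by blast
    moreover have "norm (conditional_expectation a - conditional_expectation b) \<le> e"
      using norm_conditional_expectation_le[of "a - b"] b(2) by (simp add: conditional_expectation_diff)
    ultimately show "\<exists>y\<in>{Pop F | F. continuous_on UNIV F \<and> range F \<subseteq> UNIV}. norm (conditional_expectation a - y) \<le> e"
      by blast
  qed
  then show ?thesis
    using that by blast
qed

end

section \<open>Intermediate algebras\<close>

lemma conditional_expectation_translation:
  assumes "s \<noteq> 0"
  shows "conditional_expectation (translation s :: ('g::group_add, 'h::complex_hilbert_space) ell2 bounded_op) = 0"
proof (intro op_eqI ell2_eqI)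
  fix \<xi> :: "('g, 'h) ell2" and t
  have "t \<noteq> s + t"
    using assms by (metis add.left_neutral add_right_cancel)
  then show "ell2_apply (op_apply (conditional_expectation (translation s)) \<xi>) t = ell2_apply (op_apply 0 \<xi>) t"
    by (simp add: conditional_expectation_apply block_op_apply translation_single ell2_single.rep_eq
        op_apply_simps ell2_apply_simps)
qed

lemma csubspace_closure:
  fixes S :: "'a::complex_normed_vector set"
  assumes "csubspace S"
  shows "csubspace (closure S)"
proof (rule complex_vector.subspaceI)
  show "0 \<in> closure S"
    using complex_vector.subspace_0[OF assms] closure_subset by blast
next
  fix x y
  assume "x \<in> closure S" "y \<in> closure S"
  then obtain f g where f: "\<And>n. f n \<in> S" "f \<longlonglongrightarrow> x" and g: "\<And>n. g n \<in> S" "g \<longlonglongrightarrow> y"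
    unfolding closure_sequential by blast
  have "f n + g n \<in> S" for n
    using complex_vector.subspace_add[OF assms] f(1) g(1) by blast
  then show "x + y \<in> closure S"
    unfolding closure_sequential
    using tendsto_add[OF f(2) g(2)] by (intro exI[of _ "\<lambda>n. f n + g n"]) simp
next
  fix c x
  assume "x \<in> closure S"
  then obtain f where f: "\<And>n. f n \<in> S" "f \<longlonglongrightarrow> x"
    unfolding closure_sequential by blast
  have "bounded_linear ((*\<^sub>C) c :: 'a \<Rightarrow> 'a)"
    by (rule bounded_clinear_bounded_linear, rule bounded_clinearI[where K = "cmod c"])
      (auto simp: scaleC_add_right scaleC_scaleC norm_scaleC mult.commute)
  from bounded_linear.tendsto[OF this f(2)] have "(\<lambda>n. c *\<^sub>C f n) \<longlonglongrightarrow> c *\<^sub>C x" .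
  moreover have "c *\<^sub>C f n \<in> S" for n
    using complex_vector.subspace_scale[OF assms] f(1) by blast
  ultimately show "c *\<^sub>C x \<in> closure S"
    unfolding closure_sequential by (intro exI[of _ "\<lambda>n. c *\<^sub>C f n"]) simp
qed

context crossed_system
begin

section \<open>Averages of operator-valued elements under plumpness and minimality\<close>

lemma mult_rep_translation_mem:
  fixes f :: "'x \<Rightarrow> complex"
  assumes "continuous_on UNIV f"
  shows "mult_rep \<tau> f * translation s \<in> reduced_crossed_product (\<lambda>f. tensor_op f 1) (fun_action \<tau>) cont_funs"
  unfolding reduced_crossed_product_def
  by (intro subsetD[OF closure_subset] complex_vector.span_base) (use assms in \<open>auto simp: cont_funs_def\<close>)

lemma averaging_Pop_translation_apply:
  assumes "\<And>j. j \<in> J \<Longrightarrow> continuous_on UNIV (g j)" and "continuous_on UNIV F"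
  shows "ell2_apply (ell2_apply (op_apply (averaging \<tau> J s g (Pop F * translation r)) \<xi>) t) x =
    (\<Sum>j\<in>J. complex_of_real (g j (\<tau> t x) * g j (\<tau> (s j + (- r + (- s j + t))) x)) *\<^sub>C
      op_apply (\<sigma> (\<beta> (- (- s j + t)) (F (\<tau> (- s j + t) x)))) (ell2_apply (ell2_apply \<xi> (s j + (- r + (- s j + t)))) x))"
  using assms
  by (simp add: averaging_apply[OF space_action] mult_rep_apply[OF space_action] Pop_apply translation_apply
      continuous_on_of_real scaleC_scaleC op_apply_scaleC times_bounded_op.rep_eq)

text \<open>The coefficients of \<open>averaging \<tau> J s g (translation r)\<close> are nonnegative functions, so the
  averages of \<open>\<Sum>translation r\<close> dominate those of all elements with the same support.\<close>

lemma norm_averaging_dominated: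
  assumes g: "\<And>j. j \<in> J \<Longrightarrow> continuous_on UNIV (g j)" "\<And>j x. j \<in> J \<Longrightarrow> 0 \<le> g j x"
    and H: "\<And>r. r \<in> T \<Longrightarrow> continuous_on UNIV (H r)" "\<And>r x. r \<in> T \<Longrightarrow> norm (H r x) \<le> C" and C: "0 \<le> C"
  shows "norm (averaging \<tau> J s g (\<Sum>r\<in>T. Pop (H r) * translation r)) \<le>
    C * norm (averaging \<tau> J s g (\<Sum>r\<in>T. translation r) :: ('g, ('x, complex) ell2) ell2 bounded_op)"
proof (rule norm_op_dominated[OF C])
  fix \<xi> :: "('g, ('x, 'k) ell2) ell2" and \<zeta> :: "('g, ('x, complex) ell2) ell2" and t x
  assume \<zeta>: "\<And>t x. ell2_apply (ell2_apply \<zeta> t) x = complex_of_real (norm (ell2_apply (ell2_apply \<xi> t) x))"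
  define w where "w r j = g j (\<tau> t x) * g j (\<tau> (s j + (- r + (- s j + t))) x)" for r j
  define n where "n r j = norm (ell2_apply (ell2_apply \<xi> (s j + (- r + (- s j + t)))) x)" for r j
  have w: "0 \<le> w r j" if "j \<in> J" for r j
    using g(2)[OF that] by (simp add: w_def)
  have "ell2_apply (ell2_apply (op_apply (averaging \<tau> J s g (\<Sum>r\<in>T. translation r)) \<zeta>) t) x =
      (\<Sum>r\<in>T. \<Sum>j\<in>J. complex_of_real (w r j) *\<^sub>C complex_of_real (n r j))"
    unfolding averaging_sum op_apply_sum ell2_apply_sum
    by (intro sum.cong refl, subst averaging_translation_apply[OF space_action])
      (simp_all add: g(1) \<zeta> w_def n_def)
  also have "\<dots> = complex_of_real (\<Sum>r\<in>T. \<Sum>j\<in>J. w r j * n r j)"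
    by (simp add: scaleC_complex_def)
  \<comment> \<open>No cancellation can occur among nonnegative terms, so the modulus is the very
    sum that majorizes the operator-valued expression.\<close>
  finally have scalar: "cmod (ell2_apply (ell2_apply (op_apply (averaging \<tau> J s g (\<Sum>r\<in>T. translation r)) \<zeta>) t) x) =
      (\<Sum>r\<in>T. \<Sum>j\<in>J. w r j * n r j)"
    using w by (simp only: norm_of_real) (intro abs_of_nonneg sum_nonneg mult_nonneg_nonneg, auto simp: n_def)
  have "ell2_apply (ell2_apply (op_apply (averaging \<tau> J s g (\<Sum>r\<in>T. Pop (H r) * translation r)) \<xi>) t) x =
      (\<Sum>r\<in>T. \<Sum>j\<in>J. complex_of_real (w r j) *\<^sub>C
        op_apply (\<sigma> (\<beta> (- (- s j + t)) (H r (\<tau> (- s j + t) x)))) (ell2_apply (ell2_apply \<xi> (s j + (- r + (- s j + t)))) x))"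
    unfolding averaging_sum op_apply_sum ell2_apply_sum
    by (intro sum.cong refl, subst averaging_Pop_translation_apply) (simp_all add: g(1) H(1) w_def)
  also have "norm \<dots> \<le> (\<Sum>r\<in>T. \<Sum>j\<in>J. C * (w r j * n r j))"
  proof (intro sum_norm_le)
    fix r j
    assume "r \<in> T" "j \<in> J"
    have le: "norm (op_apply (\<sigma> (\<beta> (- (- s j + t)) (H r (\<tau> (- s j + t) x)))) (ell2_apply (ell2_apply \<xi> (s j + (- r + (- s j + t)))) x))
        \<le> C * n r j"
      unfolding n_def using H(2)[OF \<open>r \<in> T\<close>]
      by (intro order_trans[OF norm_op_apply_le] mult_right_mono) (simp_all add: norm_\<sigma> norm_\<beta>)
    show "norm (complex_of_real (w r j) *\<^sub>C
        op_apply (\<sigma> (\<beta> (- (- s j + t)) (H r (\<tau> (- s j + t) x)))) (ell2_apply (ell2_apply \<xi> (s j + (- r + (- s j + t)))) x))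
        \<le> C * (w r j * n r j)"
      using mult_left_mono[OF le w[OF \<open>j \<in> J\<close>, of r]] w[OF \<open>j \<in> J\<close>, of r]
      by (simp add: norm_scaleC mult.left_commute)
  qed
  also have "\<dots> = C * (\<Sum>r\<in>T. \<Sum>j\<in>J. w r j * n r j)"
    by (simp only: sum_distrib_left)
  finally show "norm (ell2_apply (ell2_apply (op_apply (averaging \<tau> J s g (\<Sum>r\<in>T. Pop (H r) * translation r)) \<xi>) t) x) \<le>
      C * cmod (ell2_apply (ell2_apply (op_apply (averaging \<tau> J s g (\<Sum>r\<in>T. translation r)) \<zeta>) t) x)"
    unfolding scalar .
qed

text \<open>Plumpness is applied to the sum of \<open>translation r\<close> over \<open>T\<close>,
  whose expectation is zero because \<open>0\<close> is not in \<open>T\<close>. The averaging data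
  are thus chosen from \<open>T\<close> and \<open>e\<close> alone, and domination transfers the
  estimate to the coefficients \<open>H\<close>.\<close>

lemma plump_averaging:
  assumes N: "plump \<tau> N" and T: "finite T" "0 \<notin> T"
    and H: "\<And>r. r \<in> T \<Longrightarrow> continuous_on UNIV (H r)" "\<And>r x. r \<in> T \<Longrightarrow> norm (H r x) \<le> C" and C: "0 \<le> C"
    and e: "0 < e"
  shows "\<exists>(m::nat) s g. (\<forall>j<m. s j \<in> N \<and> continuous_on UNIV (g j)) \<and> (\<forall>x. (\<Sum>j<m. (g j x)\<^sup>2) = 1) \<and>
    norm (averaging \<tau> {..<m} s g (\<Sum>r\<in>T. Pop (H r) * translation r)) \<le> C * e"
proof -
  define a :: "('g, ('x, complex) ell2) ell2 bounded_op" where "a = (\<Sum>r\<in>T. translation r)"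
  have "a \<in> reduced_crossed_product mult_op (fun_action \<tau>) cont_funs"
    unfolding a_def reduced_crossed_product_def
  proof (intro subsetD[OF closure_subset] complex_vector.span_sum complex_vector.span_base CollectI exI conjI)
    show "translation r = mult_rep \<tau> (\<lambda>_. 1) * translation r" for r
      by (simp add: mult_rep_one[OF space_action])
  qed (simp add: cont_funs_def)
  then obtain m :: nat and s :: "nat \<Rightarrow> 'g" and g :: "nat \<Rightarrow> 'x \<Rightarrow> real"
    where sg: "\<forall>j<m. s j \<in> N \<and> continuous_on UNIV (g j) \<and> (\<forall>x. 0 \<le> g j x)" "\<forall>x. (\<Sum>j<m. (g j x)\<^sup>2) = 1"
      "norm (averaging \<tau> {..<m} s g a - conditional_expectation a) < e"
    using N e unfolding plump_def Let_def averaging_def by blast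
  have "conditional_expectation a = 0"
    using T unfolding a_def conditional_expectation_sum
    by (intro sum.neutral) (auto intro: conditional_expectation_translation)
  then have small: "norm (averaging \<tau> {..<m} s g a) \<le> e"
    using sg(3) by simp
  have "norm (averaging \<tau> {..<m} s g (\<Sum>r\<in>T. Pop (H r) * translation r)) \<le> C * norm (averaging \<tau> {..<m} s g a)"
    unfolding a_def using sg(1) H C by (intro norm_averaging_dominated) auto
  also have "\<dots> \<le> C * e"
    by (rule mult_left_mono[OF small C])
  finally show ?thesis
    using sg(1,2) by blast
qed

text \<open>Kernel elements do not touch \<open>B\<close>, so averaging replaces \<open>F x\<close>
  by a combination of values of \<open>F\<close> at translates of \<open>x\<close>. When the squares
  of the \<open>g j\<close> sum to one it is convex, and constants are fixed.\<close>

lemma averaging_Pop: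
  assumes s: "\<And>j. j \<in> J \<Longrightarrow> s j \<in> action_kernel \<beta>" and g: "\<And>j. j \<in> J \<Longrightarrow> continuous_on UNIV (g j)"
    and F: "continuous_on UNIV F"
  shows "averaging \<tau> J s g (Pop F) = Pop (\<lambda>x. \<Sum>j\<in>J. complex_of_real ((g j x)\<^sup>2) *\<^sub>C F (\<tau> (- s j) x))"
    and "continuous_on UNIV (\<lambda>x. \<Sum>j\<in>J. complex_of_real ((g j x)\<^sup>2) *\<^sub>C F (\<tau> (- s j) x))"
proof -
  show cont: "continuous_on UNIV (\<lambda>x. \<Sum>j\<in>J. complex_of_real ((g j x)\<^sup>2) *\<^sub>C F (\<tau> (- s j) x))"
    using g continuous_on_compose2[OF F continuous_\<tau>]
    by (intro continuous_on_sum continuous_scaleC continuous_on_of_real continuous_on_power) auto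
  show "averaging \<tau> J s g (Pop F) = Pop (\<lambda>x. \<Sum>j\<in>J. complex_of_real ((g j x)\<^sup>2) *\<^sub>C F (\<tau> (- s j) x))"
  proof (intro op_eqI ell2_ell2_eqI)
    fix \<xi> t x
    \<comment> \<open>\<open>Pop F\<close> is treated as \<open>Pop F * translation 0\<close>, hence
      the term \<open>- 0\<close> from the general coordinate formula.\<close>
    have "s j + (- 0 + (- s j + t)) = t" for j
      by (simp add: add.assoc[symmetric])
    moreover have "\<beta> (- (- s j + t)) b = \<beta> (- t) b" if "j \<in> J" for j b
    proof -
      have "- (- s j + t) = - t + s j"
        by (simp only: minus_add minus_minus)
      then show ?thesis
        using s[OF that] by (simp only: \<beta>_add) (simp add: action_kernel_def)
    qed
    ultimately have "ell2_apply (ell2_apply (op_apply (averaging \<tau> J s g (Pop F * translation 0)) \<xi>) t) x =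
        (\<Sum>j\<in>J. complex_of_real ((g j (\<tau> t x))\<^sup>2) *\<^sub>C
          op_apply (\<sigma> (\<beta> (- t) (F (\<tau> (- s j + t) x)))) (ell2_apply (ell2_apply \<xi> t) x))"
      by (subst averaging_Pop_translation_apply) (simp_all add: g F power2_eq_square del: minus_zero)
    then show "ell2_apply (ell2_apply (op_apply (averaging \<tau> J s g (Pop F)) \<xi>) t) x =
        ell2_apply (ell2_apply (op_apply (Pop (\<lambda>x. \<Sum>j\<in>J. complex_of_real ((g j x)\<^sup>2) *\<^sub>C F (\<tau> (- s j) x))) \<xi>) t) x"
      by (simp add: translation_zero Pop_apply[OF cont] \<sigma>_simps \<beta>_simps op_apply_sum op_apply_simps \<tau>_add
          del: of_real_power)
  qed
qed

lemma action_kernel_minus: "s \<in> action_kernel \<beta> \<Longrightarrow> - s \<in> action_kernel \<beta>"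
  unfolding action_kernel_def using \<beta>_minus(2)[of s] by auto

text \<open>Dense kernel orbits let every point be moved into \<open>V\<close> by some kernel
  element, so preimages of \<open>V\<close> cover \<open>X\<close> and a partition of unity can be
  subordinated to them. The inverse \<open>- s p\<close> matches the translates produced by
  averaging.\<close>

lemma minimal_partition:
  assumes min: "minimal_on (action_kernel \<beta>) \<tau>" and V: "open V" "x0 \<in> V"
  shows "\<exists>(P :: 'x set) s g. finite P \<and> (\<forall>p. s p \<in> action_kernel \<beta>) \<and> (\<forall>p. continuous_on UNIV (g p)) \<and>
    (\<forall>p x. 0 \<le> (g p x :: real)) \<and> (\<forall>x. (\<Sum>p\<in>P. g p x) = 1) \<and>
    (\<forall>p x. g p x \<noteq> 0 \<longrightarrow> \<tau> (- s p) x \<in> V)"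
proof -
  have "\<exists>s\<in>action_kernel \<beta>. \<tau> (- s) x \<in> V" for x
  proof -
    have "V \<inter> closure {\<tau> s x | s. s \<in> action_kernel \<beta>} \<noteq> {}"
      using min V(2) unfolding minimal_on_def by auto
    then obtain s where "s \<in> action_kernel \<beta>" "\<tau> s x \<in> V"
      using open_Int_closure_eq_empty[OF V(1), of "{\<tau> s x | s. s \<in> action_kernel \<beta>}"] by auto
    then show ?thesis
      using action_kernel_minus by (intro bexI[of _ "- s"]) auto
  qed
  then obtain s where s: "\<And>x. s x \<in> action_kernel \<beta>" "\<And>x. \<tau> (- s x) x \<in> V"
    by metis
  have "open (\<tau> (- s p) -` V)" for p
    by (rule open_vimage[OF V(1) continuous_\<tau>])
  moreover have "x \<in> \<tau> (- s x) -` V" for x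
    using s(2) by simp
  ultimately obtain P and g :: "'x \<Rightarrow> 'x \<Rightarrow> real"
    where "finite P" "\<And>p. continuous_on UNIV (g p)" "\<And>p x. 0 \<le> g p x" "\<And>x. (\<Sum>p\<in>P. g p x) = 1"
      "\<And>p x. g p x \<noteq> 0 \<Longrightarrow> x \<in> \<tau> (- s p) -` V"
    using partition_of_unity[OF compact_X, of "\<lambda>p. \<tau> (- s p) -` V"] by metis
  then show ?thesis
    using s(1) by (intro exI[of _ P] exI[of _ s] exI[of _ g]) auto
qed

end

locale intermediate_algebra = crossed_system \<tau> \<beta> \<sigma>
  for \<tau> :: "'g::group_add \<Rightarrow> 'x::t2_space \<Rightarrow> 'x"
    and \<beta> :: "'g \<Rightarrow> 'b::{cstar_algebra, real_normed_algebra_1} \<Rightarrow> 'b"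
    and \<sigma> :: "'b \<Rightarrow> 'k::complex_hilbert_space bounded_op" +
  fixes A :: "('g, ('x, 'k) ell2) ell2 bounded_op set"
  assumes plump_kernel: "plump \<tau> (action_kernel \<beta>)"
    and minimal_kernel: "minimal_on (action_kernel \<beta>) \<tau>"
    and subalgebra: "cstar_subalgebra A"
    and lower: "reduced_crossed_product (\<lambda>f. tensor_op f 1) (fun_action \<tau>) cont_funs \<subseteq> A"
    and upper: "A \<subseteq> reduced_crossed_product id (diagonal_action \<tau> \<beta> \<sigma>) (min_tensor \<sigma> UNIV)"
begin

lemma csubspace_A: "csubspace A" and closed_A: "closed A"
  and mult_A: "a \<in> A \<Longrightarrow> b \<in> A \<Longrightarrow> a * b \<in> A" and star_A: "a \<in> A \<Longrightarrow> star a \<in> A"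
  using subalgebra by (auto simp: cstar_subalgebra_def)

lemma A_subset_closure: "A \<subseteq> closure (crossed_span UNIV)"
  using upper reduced_crossed_product_eq[OF complex_vector.subspace_UNIV closed_UNIV] by simp

lemma mult_rep_mem:
  assumes "continuous_on UNIV f"
  shows "mult_rep \<tau> f \<in> A"
  using mult_rep_translation_mem[OF assms, of 0] lower by (auto simp: translation_zero)

lemma translation_mem: "translation s \<in> A"
  using mult_rep_translation_mem[of "\<lambda>_. 1" s] lower by (auto simp: mult_rep_one[OF space_action])

lemma averaging_mem:
  assumes "\<And>j. j \<in> J \<Longrightarrow> continuous_on UNIV (g j)" "a \<in> A"
  shows "averaging \<tau> J s g a \<in> A"
  unfolding averaging_def using assms
  by (intro csubspace_sum[OF csubspace_A] mult_A star_A translation_mem mult_rep_mem continuous_on_of_real)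

text \<open>First average \<open>a\<close> by minimality so that its expectation becomes close to the constant
  \<open>F x0\<close>, which all later averages over the kernel fix; then use plumpness to remove the other
  Fourier coefficients.\<close>

lemma Pop_value_mem:
  assumes a: "a \<in> A" and F: "continuous_on UNIV F" "conditional_expectation a = Pop F"
  shows "Pop (\<lambda>_. F x0) \<in> A"
proof (rule closed_memI[OF closed_A])
  fix e :: real
  assume e: "0 < e"
  \<comment> \<open>The error budget at the end is \<open>d + (2 * d + d)\<close>: approximation of
    \<open>b\<close> by \<open>c\<close>, distance of \<open>Pop (H 0)\<close> from the constant,
    and the part averaged away by plumpness.\<close>
  define d where "d = e / 4"
  have d: "0 < d"
    using e by (simp add: d_def)
  define V where "V = {y. norm (F y - F x0) < d}"
  have "open V" "x0 \<in> V"
    using d F(1) by (auto simp: V_def intro!: open_Collect_less continuous_intros)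
  from minimal_partition[OF minimal_kernel this] obtain P :: "'x set" and r and g :: "'x \<Rightarrow> 'x \<Rightarrow> real"
    where P: "finite P" "\<And>p. r p \<in> action_kernel \<beta>" "\<And>p. continuous_on UNIV (g p)" "\<And>p x. 0 \<le> g p x"
      "\<And>x. (\<Sum>p\<in>P. g p x) = 1" "\<And>p x. g p x \<noteq> 0 \<Longrightarrow> \<tau> (- r p) x \<in> V"
    by blast
  \<comment> \<open>Averaging weighs with squares, whereas the partition of unity sums without
    them.\<close>
  define h where "h p x = sqrt (g p x)" for p x
  have h: "continuous_on UNIV (h p)" "(h p x)\<^sup>2 = g p x" for p x
    using P(3,4) by (auto simp: h_def intro!: continuous_on_real_sqrt)
  define b where "b = averaging \<tau> P r h a"
  have b: "b \<in> A"
    unfolding b_def by (rule averaging_mem[OF h(1) a])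
  define F' where "F' x = (\<Sum>p\<in>P. complex_of_real ((h p x)\<^sup>2) *\<^sub>C F (\<tau> (- r p) x))" for x
  have F': "conditional_expectation b = Pop F'" "continuous_on UNIV F'"
    unfolding b_def conditional_expectation_averaging[OF space_action h(1)] F(2) F'_def
    using averaging_Pop[where J = P, OF P(2) h(1) F(1)] by auto
  have "norm (F' x - F x0) \<le> d" for x
    unfolding F'_def scaleC_of_real h(2)
    by (rule convex_combination_norm_diff_le[OF P(1) P(4) P(5)]) (use P(6) in \<open>auto simp: V_def less_imp_le\<close>)
  then have near1: "norm (conditional_expectation b - Pop (\<lambda>_. F x0)) \<le> d"
    unfolding F'(1) Pop_diff[OF F'(2) continuous_on_const, symmetric]
    by (intro norm_Pop_le continuous_on_diff F'(2) continuous_on_const)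
  \<comment> \<open>The finite support \<open>T\<close> has to be fixed before plumpness is invoked,
    since the averaging data depend on it.\<close>
  obtain c where c: "c \<in> crossed_span UNIV" "norm (b - c) < d"
    using closure_normD[of b "crossed_span UNIV" d] A_subset_closure b d by blast
  obtain T H where T: "finite T" "0 \<in> T" "\<forall>s. continuous_on UNIV (H s)" "c = (\<Sum>s\<in>T. Pop (H s) * translation s)"
    using crossed_span_repr[OF c(1)] by blast
  have "\<forall>s. \<exists>C. (\<forall>x. norm (H s x) \<le> C) \<and> 0 \<le> C"
    using bounded_cont T(3) by metis
  then obtain C where C: "\<And>s x. norm (H s x) \<le> C s" "\<And>s. 0 \<le> C s"
    by metis
  \<comment> \<open>Domination needs one bound for all coefficients; the \<open>+ 1\<close> in the
    denominator of \<open>e'\<close> covers the case \<open>K = 0\<close>.\<close>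
  define K where "K = (\<Sum>s\<in>T. C s)"
  have K: "0 \<le> K" "norm (H s x) \<le> K" if "s \<in> T" for s x
    using C T(1) that member_le_sum[of s T C] by (auto simp: K_def intro: sum_nonneg order_trans)
  have K0: "0 \<le> K"
    using C(2) by (simp add: K_def sum_nonneg)
  define e' where "e' = d / (K + 1)"
  have e': "0 < e'" "K * e' \<le> d"
    using d K0 by (auto simp: e'_def pos_divide_le_eq algebra_simps)
  have "\<exists>(m::nat) s g. (\<forall>j<m. s j \<in> action_kernel \<beta> \<and> continuous_on UNIV (g j)) \<and> (\<forall>x. (\<Sum>j<m. (g j x)\<^sup>2) = 1) \<and>
    norm (averaging \<tau> {..<m} s g (\<Sum>r\<in>T - {0}. Pop (H r) * translation r)) \<le> K * e'"
    using plump_kernel T K K0 e'(1) by (intro plump_averaging) auto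
  then obtain m :: nat and s k where sk: "\<And>j. j \<in> {..<m} \<Longrightarrow> s j \<in> action_kernel \<beta>"
    "\<And>j. j \<in> {..<m} \<Longrightarrow> continuous_on UNIV (k j)" "\<And>x. (\<Sum>j\<in>{..<m}. (k j x)\<^sup>2) = 1"
    "norm (averaging \<tau> {..<m} s k (\<Sum>r\<in>T - {0}. Pop (H r) * translation r)) \<le> K * e'"
    by auto
  define \<Phi> :: "('g, ('x, 'k) ell2) ell2 bounded_op \<Rightarrow> ('g, ('x, 'k) ell2) ell2 bounded_op" where "\<Phi> = averaging \<tau> {..<m} s k"
  have contr: "norm (\<Phi> y) \<le> norm y" for y
    unfolding \<Phi>_def by (rule norm_averaging_le[OF space_action sk(2,3)])
  have fix_const: "\<Phi> (Pop (\<lambda>_. F x0)) = Pop (\<lambda>_. F x0)"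
  proof -
    have "(\<Sum>j<m. complex_of_real ((k j x)\<^sup>2) *\<^sub>C F x0) = F x0" for x
      unfolding complex_vector.scale_sum_left[symmetric] of_real_sum[symmetric] sk(3) by simp
    moreover have "\<Phi> (Pop (\<lambda>_. F x0)) = Pop (\<lambda>x. \<Sum>j<m. complex_of_real ((k j x)\<^sup>2) *\<^sub>C F x0)"
      unfolding \<Phi>_def by (rule averaging_Pop(1)) (use sk(1,2) in simp_all)
    ultimately show ?thesis
      by (simp only:)
  qed
  \<comment> \<open>One \<open>d\<close> comes from replacing \<open>b\<close> by \<open>c\<close>
    under the contractive expectation, the other from \<open>near1\<close>.\<close>
  have near2: "norm (Pop (H 0) - Pop (\<lambda>_. F x0)) \<le> 2 * d"
  proof -
    have "Pop (H 0) = conditional_expectation c"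
      unfolding T(4) by (rule conditional_expectation_sum_Pop[OF T(1-3), symmetric])
    then have "norm (Pop (H 0) - conditional_expectation b) \<le> d"
      using norm_conditional_expectation_le[of "c - b"] c(2)
      by (simp add: conditional_expectation_diff norm_minus_commute)
    then show ?thesis
      using near1 norm_triangle_ineq[of "Pop (H 0) - conditional_expectation b" "conditional_expectation b - Pop (\<lambda>_. F x0)"]
      by simp
  qed
  have "c = Pop (H 0) + (\<Sum>r\<in>T - {0}. Pop (H r) * translation r)"
    unfolding T(4) using T(1,2) by (simp add: sum.remove[of T 0] translation_zero)
  then have "b - Pop (\<lambda>_. F x0) = (b - c) + ((Pop (H 0) - Pop (\<lambda>_. F x0)) + (\<Sum>r\<in>T - {0}. Pop (H r) * translation r))"
    by simp
  then have "\<Phi> (b - Pop (\<lambda>_. F x0)) = \<Phi> (b - c) +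
      (\<Phi> (Pop (H 0) - Pop (\<lambda>_. F x0)) + \<Phi> (\<Sum>r\<in>T - {0}. Pop (H r) * translation r))"
    by (simp only: \<Phi>_def averaging_add)
  moreover have "\<Phi> (b - Pop (\<lambda>_. F x0)) = \<Phi> b - Pop (\<lambda>_. F x0)"
    using fix_const by (simp only: \<Phi>_def averaging_diff)
  ultimately have "\<Phi> b - Pop (\<lambda>_. F x0) = \<Phi> (b - c) +
      (\<Phi> (Pop (H 0) - Pop (\<lambda>_. F x0)) + \<Phi> (\<Sum>r\<in>T - {0}. Pop (H r) * translation r))"
    by (simp only:)
  also have "norm \<dots> \<le> d + (2 * d + d)"
    using contr[of "b - c"] contr[of "Pop (H 0) - Pop (\<lambda>_. F x0)"] c(2) near2 sk(4) e'(2)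
    by (intro norm_triangle_mono) (auto simp: \<Phi>_def)
  finally have "norm (Pop (\<lambda>_. F x0) - \<Phi> b) \<le> e"
    by (simp add: d_def norm_minus_commute)
  moreover have "\<Phi> b \<in> A"
    unfolding \<Phi>_def by (rule averaging_mem[OF sk(2) b])
  ultimately show "\<exists>y\<in>A. norm (Pop (\<lambda>_. F x0) - y) \<le> e"
    by blast
qed

text \<open>\<open>F\<close> is approximated by sums of scalar functions times constants
  \<open>F p\<close>; the former lie in \<open>A\<close> because \<open>C(X)\<close> does, the
  latter by assumption.\<close>

lemma Pop_mem:
  assumes F: "continuous_on UNIV F" "\<And>x. Pop (\<lambda>_. F x) \<in> A"
  shows "Pop F \<in> A"
proof (rule closed_memI[OF closed_A])
  fix e :: real
  assume "0 < e"
  then obtain P and g :: "'x \<Rightarrow> 'x \<Rightarrow> real" where P: "finite P" "\<And>p. continuous_on UNIV (g p)"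
    "\<And>x. norm ((\<Sum>p\<in>P. g p x *\<^sub>R F p) - F x) \<le> e"
    using partition_of_unity_approx[OF compact_X F(1)] by metis
  define G where "G x = (\<Sum>p\<in>P. complex_of_real (g p x) *\<^sub>C F p)" for x
  have G: "continuous_on UNIV G"
    unfolding G_def by (intro continuous_on_sum continuous_scaleC continuous_on_of_real P(2)) simp
  have "Pop G = (\<Sum>p\<in>P. mult_rep \<tau> (\<lambda>x. complex_of_real (g p x)) * Pop (\<lambda>_. F p))"
    by (intro op_eqI ell2_ell2_eqI)
      (simp add: Pop_apply[OF G] op_apply_sum ell2_apply_sum Pop_apply mult_rep_apply[OF space_action]
        times_bounded_op.rep_eq continuous_on_of_real P(2) G_def \<sigma>_simps \<beta>_simps scaleC_bounded_op.rep_eq)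
  also have "\<dots> \<in> A"
    by (intro csubspace_sum[OF csubspace_A] mult_A mult_rep_mem continuous_on_of_real P(2) F(2))
  finally have "Pop G \<in> A" .
  moreover have "norm (Pop F - Pop G) \<le> e"
    unfolding Pop_diff[OF F(1) G, symmetric]
    by (rule norm_Pop_le[OF continuous_on_diff[OF F(1) G]])
      (use P(3) in \<open>simp add: G_def scaleC_of_real norm_minus_commute\<close>)
  ultimately show "\<exists>y\<in>A. norm (Pop F - y) \<le> e"
    by blast
qed

lemma conditional_expectation_mem:
  assumes "a \<in> A"
  shows "conditional_expectation a \<in> A"
proof -
  obtain F where F: "continuous_on UNIV F" "conditional_expectation a = Pop F"
    using conditional_expectation_crossed_product A_subset_closure assms by blast
  show ?thesis
    unfolding F(2) by (rule Pop_mem[OF F(1) Pop_value_mem[OF assms F]])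
qed

section \<open>The algebra of coefficients of \<open>A\<close>\<close>

definition coefficient_algebra
  where "coefficient_algebra = {b. Pop (\<lambda>_. b) \<in> A}"

lemma coefficient_algebra_cstar_subalgebra: "cstar_subalgebra coefficient_algebra"
  unfolding cstar_subalgebra_def
proof (intro conjI ballI)
  show "csubspace coefficient_algebra"
  proof (rule complex_vector.subspaceI)
    show "0 \<in> coefficient_algebra"
      using complex_vector.subspace_0[OF csubspace_A] by (simp add: coefficient_algebra_def Pop_zero)
    show "x + y \<in> coefficient_algebra" if "x \<in> coefficient_algebra" "y \<in> coefficient_algebra" for x y
      using that complex_vector.subspace_add[OF csubspace_A] by (simp add: coefficient_algebra_def Pop_add)
    show "c *\<^sub>C x \<in> coefficient_algebra" if "x \<in> coefficient_algebra" for c x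
      using that complex_vector.subspace_scale[OF csubspace_A] by (simp add: coefficient_algebra_def Pop_scaleC)
  qed
  show "x * y \<in> coefficient_algebra" if "x \<in> coefficient_algebra" "y \<in> coefficient_algebra" for x y
    using that mult_A by (simp add: coefficient_algebra_def Pop_mult)
  show "star x \<in> coefficient_algebra" if "x \<in> coefficient_algebra" for x
    using that star_A by (simp add: coefficient_algebra_def star_Pop_const[symmetric])
  have "bounded_clinear (\<lambda>b. Pop (\<lambda>_. b))"
    by (rule bounded_clinearI[where K = 1]) (simp_all add: Pop_add Pop_scaleC norm_Pop_le)
  then have "continuous_on UNIV (\<lambda>b. Pop (\<lambda>_. b))"
    by (rule bounded_linear.continuous_on[OF bounded_clinear_bounded_linear continuous_on_id])
  then show "closed coefficient_algebra"
    unfolding coefficient_algebra_def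
    using closed_vimage[OF closed_A] by (simp add: vimage_def)
qed

lemma coefficient_algebra_invariant: "\<beta> s ` coefficient_algebra \<subseteq> coefficient_algebra"
proof
  fix b
  assume "b \<in> \<beta> s ` coefficient_algebra"
  then obtain b' where "b = \<beta> s b'" "Pop (\<lambda>_. b') \<in> A"
    by (auto simp: coefficient_algebra_def)
  then show "b \<in> coefficient_algebra"
    unfolding coefficient_algebra_def mem_Collect_eq
    by (simp only: translation_Pop_const[symmetric] mult_A translation_mem)
qed

lemma crossed_span_coefficient_algebra: "closure (crossed_span coefficient_algebra) \<subseteq> A"
proof -
  have "{Pop F * translation s | F s. continuous_on UNIV F \<and> range F \<subseteq> coefficient_algebra} \<subseteq> A"
  proof (clarify)
    fix F :: "'x \<Rightarrow> 'b" and s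
    assume "continuous_on UNIV F" "range F \<subseteq> coefficient_algebra"
    then have "Pop F \<in> A"
      using Pop_mem[of F] by (auto simp: coefficient_algebra_def)
    then show "Pop F * translation s \<in> A"
      by (rule mult_A[OF _ translation_mem])
  qed
  then show ?thesis
    unfolding crossed_span_def
    by (intro closure_minimal complex_vector.span_minimal csubspace_A closed_A)
qed

text \<open>\<open>Pop_value_mem\<close> is applied to \<open>a * translation (- s)\<close>, which
  also belongs to \<open>A\<close> and whose expectation is the \<open>s\<close>-th coefficient of
  \<open>a\<close>.\<close>

lemma fourier_component_mem:
  assumes "a \<in> A"
  shows "fourier_component s a \<in> crossed_span coefficient_algebra"
proof -
  have mem: "a * translation (- s) \<in> A"
    by (rule mult_A[OF assms translation_mem])
  then obtain F where F: "continuous_on UNIV F" "conditional_expectation (a * translation (- s)) = Pop F"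
    using conditional_expectation_crossed_product A_subset_closure by blast
  have "range F \<subseteq> coefficient_algebra"
    using Pop_value_mem[OF mem F] by (auto simp: coefficient_algebra_def)
  then show ?thesis
    unfolding fourier_component_def F(2) crossed_span_def
    using F(1) by (intro complex_vector.span_base) auto
qed

end

theorem theorem4:
  fixes \<tau> :: "'g::group_add \<Rightarrow> 'x::t2_space \<Rightarrow> 'x"
    and \<beta> :: "'g \<Rightarrow> 'b::{cstar_algebra, real_normed_algebra_1} \<Rightarrow> 'b"
    and \<sigma> :: "'b \<Rightarrow> 'k::complex_hilbert_space bounded_op"
    and A :: "('g, ('x, 'k) ell2) ell2 bounded_op set"
  assumes "compact_space_action \<tau>"
    and "cstar_action \<beta>"
    and "faithful_rep \<sigma>"
    and "plump \<tau> (action_kernel \<beta>)"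
    and "minimal_on (action_kernel \<beta>) \<tau>"
    and "cstar_subalgebra A"
    and "reduced_crossed_product (\<lambda>f. tensor_op f 1) (fun_action \<tau>) cont_funs \<subseteq> A"
    and "A \<subseteq> reduced_crossed_product id (diagonal_action \<tau> \<beta> \<sigma>) (min_tensor \<sigma> UNIV)"
  shows "conditional_expectation ` A \<subseteq> A \<and>
    (approximation_property TYPE('g) \<longrightarrow>
      (\<exists>B'. cstar_subalgebra B' \<and> (\<forall>s. \<beta> s ` B' \<subseteq> B') \<and>
        A = reduced_crossed_product id (diagonal_action \<tau> \<beta> \<sigma>) (min_tensor \<sigma> B')))"
proof -
  interpret intermediate_algebra \<tau> \<beta> \<sigma> A
    using assms by unfold_locales
  \<comment> \<open>The largest possible choice: if the crossed product by some \<open>B'\<close>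
    lies in \<open>A\<close>, then every \<open>b\<close> in \<open>B'\<close> satisfies
    \<open>Pop (\<lambda>_. b) \<in> A\<close>.\<close>
  let ?B = coefficient_algebra
  have B: "csubspace ?B" "closed ?B"
    using coefficient_algebra_cstar_subalgebra by (auto simp: cstar_subalgebra_def)
  have "A = reduced_crossed_product id (diagonal_action \<tau> \<beta> \<sigma>) (min_tensor \<sigma> ?B)"
    if AP: "approximation_property TYPE('g)"
    unfolding reduced_crossed_product_eq[OF B]
  proof (rule antisym)
    show "A \<subseteq> closure (crossed_span ?B)"
    proof
      fix a
      assume a: "a \<in> A"
      show "a \<in> closure (crossed_span ?B)"
      proof (rule approximation_property_mem[OF AP])
        show "csubspace (closure (crossed_span ?B))"
          unfolding crossed_span_def by (intro csubspace_closure complex_vector.subspace_span)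
        show "fourier_component s a \<in> closure (crossed_span ?B)" for s
          using fourier_component_mem[OF a] closure_subset by blast
        show "a \<in> closure finite_propagation"
          using a A_subset_closure closure_mono[OF crossed_span_finite_propagation] by blast
      qed simp
    qed
  qed (rule crossed_span_coefficient_algebra)
  then show ?thesis
    using conditional_expectation_mem coefficient_algebra_cstar_subalgebra coefficient_algebra_invariant
    by blast
qed

end
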